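(* Let $\Delta\ge 3$ be an integer and $\delta\in(0,1)$. Let $\beta,\gamma,\lambda$ be reals with $0\le\beta\le\gamma$, $\gamma>0$, $\beta\gamma<1$ and $\lambda>0$, and assume that $(\beta,\gamma,\lambda)$ is up-to-$\Delta$ unique with gap $\delta$. Then for every $n$-vertex graph $G$ of maximum degree $\Delta$, the mixing time of the Glauber dynamics for the $2$-spin system on $G$ with parameters $(\beta,\gamma,\lambda)$ is $O(n^{2+72/\delta})$ (the implied constant not depending on $n$ or on $G$).
   Context: For a finite graph $G=(V,E)$ and reals $\beta,\gamma\ge 0$, $\lambda>0$ (convention $0^0=1$), the 2-spin system with parameters $(\beta,\gamma,\lambda)$ is the distribution $\mu_G(\sigma)\propto \beta^{m_1(\sigma)}\gamma^{m_0(\sigma)}\lambda^{n_1(\sigma)}$ on $\sigma\in\{0,1\}^V$, where $m_s(\sigma)$ is the number of edges $uv$ with $\sigma_u=\sigma_v=s$ and $n_1(\sigma)$ the number of vertices with spin $1$. The Glauber dynamics: from $X_t$, pick $v\in V$ uniformly at random, keep all other spins, and redraw the spin of $v$ from the conditional distribution of $\sigma_v$ under $\mu_G$ given all other spins. Mixing time: $\max_{x_0}\min\{t\ge0:\|P^t(x_0,\cdot)-\mu_G\|_{\mathrm{TV}}\le 1/4\}$. For $1\le d<\Delta$ let $f_d(R)=\lambda\left(\frac{\beta R+1}{R+\gamma}\right)^d$ and let $R_d^*$ be its unique fixed point in $(0,\infty)$. The parameters are up-to-$\Delta$ unique with gap $\delta\in(0,1)$ if $|f_d'(R_d^* )|<1-\delta$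 for all integers $1\le d<\Delta$. *)

theory Defs
  imports "HOL-Probability.Probability"
begin

section \<open>Finite simple graphs\<close>

definition simple_graph :: "'a set \<Rightarrow> 'a set set \<Rightarrow> bool" where
  "simple_graph V E \<longleftrightarrow> finite V \<and> (\<forall>e\<in>E. e \<subseteq> V \<and> card e = 2)"

definition degree :: "'a set set \<Rightarrow> 'a \<Rightarrow> nat" where
  "degree E v = card {e \<in> E. v \<in> e}"

text \<open>Meaningful only for nonempty \<open>V\<close>.\<close>

definition max_degree :: "'a set \<Rightarrow> 'a set set \<Rightarrow> nat" where
  "max_degree V E = Max (degree E ` V)"

section \<open>Two-spin systems\<close>

definition configs :: "'a set \<Rightarrow> ('a \<Rightarrow> nat) set" where
  "configs V = V \<rightarrow>\<^sub>E {0, 1}"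

definition mono_edges :: "'a set set \<Rightarrow> nat \<Rightarrow> ('a \<Rightarrow> nat) \<Rightarrow> nat" where
  "mono_edges E s \<sigma> = card {e \<in> E. \<forall>v\<in>e. \<sigma> v = s}"

definition ones :: "'a set \<Rightarrow> ('a \<Rightarrow> nat) \<Rightarrow> nat" where
  "ones V \<sigma> = card {v \<in> V. \<sigma> v = 1}"

text \<open>Powers with natural exponents satisfy \<open>0 ^ 0 = 1\<close>, which matters for \<open>\<beta> = 0\<close>.\<close>

definition weight ::
  "'a set \<Rightarrow> 'a set set \<Rightarrow> real \<Rightarrow> real \<Rightarrow> real \<Rightarrow> ('a \<Rightarrow> nat) \<Rightarrow> real" where
  "weight V E \<beta> \<gamma> lam \<sigma> =
     \<beta> ^ mono_edges E 1 \<sigma> * \<gamma> ^ mono_edges E 0 \<sigma> * lam ^ ones V \<sigma>"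

definition partition_function ::
  "'a set \<Rightarrow> 'a set set \<Rightarrow> real \<Rightarrow> real \<Rightarrow> real \<Rightarrow> real" where
  "partition_function V E \<beta> \<gamma> lam = (\<Sum>\<sigma>\<in>configs V. weight V E \<beta> \<gamma> lam \<sigma>)"

definition gibbs ::
  "'a set \<Rightarrow> 'a set set \<Rightarrow> real \<Rightarrow> real \<Rightarrow> real \<Rightarrow> ('a \<Rightarrow> nat) pmf" where
  "gibbs V E \<beta> \<gamma> lam = embed_pmf (\<lambda>\<sigma>.
     if \<sigma> \<in> configs V then weight V E \<beta> \<gamma> lam \<sigma> / partition_function V E \<beta> \<gamma> lam else 0)"

lemma finite_configs: "finite V \<Longrightarrow> finite (configs V)"
  unfolding configs_def by (intro finite_PiE) auto

lemma weight_nonneg: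
  "\<beta> \<ge> 0 \<Longrightarrow> \<gamma> \<ge> 0 \<Longrightarrow> lam \<ge> 0 \<Longrightarrow> weight V E \<beta> \<gamma> lam \<sigma> \<ge> 0"
  by (simp add: weight_def)

text \<open>For \<open>\<gamma> > 0\<close> the all-zero configuration has positive weight, even if \<open>\<beta> = 0\<close>.\<close>

lemma partition_function_pos:
  assumes "simple_graph V E" "\<beta> \<ge> 0" "\<gamma> > 0" "lam > 0"
  shows "partition_function V E \<beta> \<gamma> lam > 0"
proof -
  define z where "z = (\<lambda>v. if v \<in> V then 0 else undefined :: nat)"
  have z: "z \<in> configs V"
    by (auto simp: configs_def z_def)
  have "\<not> (\<forall>v\<in>e. z v = 1)" if "e \<in> E" for e
  proof -
    from that assms(1) have "e \<subseteq> V" "card e = 2"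
      by (auto simp: simple_graph_def)
    then obtain v where "v \<in> e" "v \<in> V"
      by (metis card.empty ex_in_conv subsetD zero_neq_numeral)
    then show ?thesis
      by (auto simp: z_def)
  qed
  then have "{e \<in> E. \<forall>v\<in>e. z v = 1} = {}"
    by blast
  then have "mono_edges E 1 z = 0"
    unfolding mono_edges_def by (simp only: card.empty)
  then have "weight V E \<beta> \<gamma> lam z > 0"
    unfolding weight_def using assms by (simp only: power_0) simp
  then show ?thesis
    unfolding partition_function_def using z assms
    by (intro sum_pos2[of _ z]) (auto simp: simple_graph_def finite_configs weight_nonneg)
qed

lemma pmf_gibbs:
  assumes "simple_graph V E" "\<beta> \<ge> 0" "\<gamma> > 0" "lam > 0"
  shows "pmf (gibbs V E \<beta> \<gamma> lam) \<sigma> =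
    (if \<sigma> \<in> configs V then weight V E \<beta> \<gamma> lam \<sigma> / partition_function V E \<beta> \<gamma> lam else 0)"
proof -
  let ?Z = "partition_function V E \<beta> \<gamma> lam"
  let ?p = "\<lambda>\<sigma>. if \<sigma> \<in> configs V then weight V E \<beta> \<gamma> lam \<sigma> / ?Z else 0"
  have Z: "?Z > 0"
    using assms by (rule partition_function_pos)
  have fin: "finite (configs V)"
    using assms by (simp add: simple_graph_def finite_configs)
  have nonneg: "?p \<sigma> \<ge> 0" for \<sigma>
    using Z assms by (simp add: weight_nonneg)
  have "(\<integral>\<^sup>+ \<sigma>. ennreal (?p \<sigma>) \<partial>count_space UNIV) = (\<Sum>\<sigma>\<in>configs V. ennreal (?p \<sigma>))"
    by (rule nn_integral_count_space'[OF fin]) auto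
  also have "\<dots> = ennreal (\<Sum>\<sigma>\<in>configs V. ?p \<sigma>)"
    using nonneg by (intro sum_ennreal) blast
  also have "(\<Sum>\<sigma>\<in>configs V. ?p \<sigma>) = ?Z / ?Z"
    by (simp add: partition_function_def flip: sum_divide_distrib)
  finally show ?thesis
    unfolding gibbs_def using nonneg Z by (subst pmf_embed_pmf) simp_all
qed

section \<open>Glauber dynamics and mixing time\<close>

text \<open>One update from \<open>\<sigma>\<close>. The conditioning event contains \<open>\<sigma>\<close>, so the conditional distribution
  is well defined whenever \<open>\<sigma>\<close> has positive probability; this is why the state space is taken to be
  the support of the Gibbs distribution. It is all of \<^term>\<open>configs V\<close> if \<open>\<beta> > 0\<close>.\<close>

definition glauber_step ::
  "'a set \<Rightarrow> 'a set set \<Rightarrow> real \<Rightarrow> real \<Rightarrow> real \<Rightarrow> ('a \<Rightarrow> nat) \<Rightarrow> ('a \<Rightarrow> nat) pmf" where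
  "glauber_step V E \<beta> \<gamma> lam \<sigma> =
     bind_pmf (pmf_of_set V) (\<lambda>v.
       map_pmf (\<lambda>\<tau>. \<sigma>(v := \<tau> v))
         (cond_pmf (gibbs V E \<beta> \<gamma> lam) {\<tau>. \<forall>u\<in>V - {v}. \<tau> u = \<sigma> u}))"

definition glauber_dist ::
  "'a set \<Rightarrow> 'a set set \<Rightarrow> real \<Rightarrow> real \<Rightarrow> real \<Rightarrow> nat \<Rightarrow> ('a \<Rightarrow> nat) \<Rightarrow> ('a \<Rightarrow> nat) pmf" where
  "glauber_dist V E \<beta> \<gamma> lam t x =
     ((\<lambda>p. bind_pmf p (glauber_step V E \<beta> \<gamma> lam)) ^^ t) (return_pmf x)"

definition tv_dist :: "'b pmf \<Rightarrow> 'b pmf \<Rightarrow> real" where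
  "tv_dist p q = (SUP A. \<bar>measure_pmf.prob p A - measure_pmf.prob q A\<bar>)"

text \<open>Taken in \<^typ>\<open>enat\<close>, so that the value is \<open>\<infinity>\<close> if the threshold is never reached from some
  starting state; \<open>SUP\<close> and \<open>INF\<close> are otherwise a maximum and a minimum.\<close>

definition mixing_time ::
  "'a set \<Rightarrow> 'a set set \<Rightarrow> real \<Rightarrow> real \<Rightarrow> real \<Rightarrow> enat" where
  "mixing_time V E \<beta> \<gamma> lam =
     (SUP x\<in>set_pmf (gibbs V E \<beta> \<gamma> lam).
        INF t\<in>{t. tv_dist (glauber_dist V E \<beta> \<gamma> lam t x) (gibbs V E \<beta> \<gamma> lam) \<le> 1 / 4}. enat t)"

section \<open>Uniqueness regime\<close>

definition tree_rec :: "real \<Rightarrow> real \<Rightarrow> real \<Rightarrow> nat \<Rightarrow> real \<Rightarrow> real" where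
  "tree_rec \<beta> \<gamma> lam d R = lam * ((\<beta> * R + 1) / (R + \<gamma>)) ^ d"

definition tree_fixpoint :: "real \<Rightarrow> real \<Rightarrow> real \<Rightarrow> nat \<Rightarrow> real" where
  "tree_fixpoint \<beta> \<gamma> lam d = (THE R. R > 0 \<and> tree_rec \<beta> \<gamma> lam d R = R)"

lemma tree_fixpoint_ex1:
  assumes "\<beta> \<ge> 0" "\<gamma> > 0" "\<beta> * \<gamma> < 1" "lam > 0"
  shows "\<exists>!R. R > 0 \<and> tree_rec \<beta> \<gamma> lam d R = R"
proof -
  have antimono: "tree_rec \<beta> \<gamma> lam d S \<le> tree_rec \<beta> \<gamma> lam d R" if "0 \<le> R" "R \<le> S" for R S
  proof -
    have "(1 - \<beta> * \<gamma>) * R \<le> (1 - \<beta> * \<gamma>) * S"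
      using that assms by (intro mult_left_mono) auto
    then have "(\<beta> * S + 1) * (R + \<gamma>) \<le> (\<beta> * R + 1) * (S + \<gamma>)"
      by (simp add: algebra_simps)
    then have "(\<beta> * S + 1) / (S + \<gamma>) \<le> (\<beta> * R + 1) / (R + \<gamma>)"
      using that assms by (simp add: divide_simps)
    then show ?thesis
      unfolding tree_rec_def using that assms
      by (intro mult_left_mono power_mono) (auto intro!: divide_nonneg_pos add_nonneg_pos)
  qed
  define M where "M = tree_rec \<beta> \<gamma> lam d 0"
  have M: "M > 0"
    using assms by (simp add: M_def tree_rec_def)
  have "continuous_on {0..M} (\<lambda>R. R - tree_rec \<beta> \<gamma> lam d R)"
    unfolding tree_rec_def using assms by (intro continuous_intros) auto
  moreover have "tree_rec \<beta> \<gamma> lam d M \<le> M"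
    using antimono[of 0 M] M by (simp add: M_def)
  ultimately obtain R where R: "0 \<le> R" "R - tree_rec \<beta> \<gamma> lam d R = 0"
    using IVT'[of "\<lambda>R. R - tree_rec \<beta> \<gamma> lam d R" 0 0 M] M by (auto simp: M_def)
  moreover have "R \<noteq> 0"
    using R M by (auto simp: M_def)
  ultimately have "R > 0 \<and> tree_rec \<beta> \<gamma> lam d R = R"
    by simp
  moreover have "R1 = R2"
    if "R1 > 0 \<and> tree_rec \<beta> \<gamma> lam d R1 = R1" "R2 > 0 \<and> tree_rec \<beta> \<gamma> lam d R2 = R2" for R1 R2
    using antimono[of R1 R2] antimono[of R2 R1] that by linarith
  ultimately show ?thesis
    by blast
qed

definition up_to_unique :: "nat \<Rightarrow> real \<Rightarrow> real \<Rightarrow> real \<Rightarrow> real \<Rightarrow> bool" where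
  "up_to_unique \<Delta> \<delta> \<beta> \<gamma> lam \<longleftrightarrow>
     (\<forall>d. 1 \<le> d \<and> d < \<Delta> \<longrightarrow>
        \<bar>deriv (tree_rec \<beta> \<gamma> lam d) (tree_fixpoint \<beta> \<gamma> lam d)\<bar> < 1 - \<delta>)"

end

theory Submission
  imports Defs
begin

text \<open>The potential \<open>1 / sqrt (R * (\<beta> * R + 1) * (R + \<gamma>))\<close> makes the tree recursion contract with
  factor \<open>sqrt (1 - \<delta>)\<close>; through the self-avoiding walk recursion this bounds the total influence
  of a vertex, under any pinning, by a constant \<open>H\<close>. Spectral independence then says that freeing
  each vertex with a small constant probability \<open>\<theta>\<close> retains a fraction \<open>\<theta> powr H\<close> of the variance.
  For small \<open>\<theta>\<close> the free vertices fall into components of bounded exponential moment, on which a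
  crude spectral gap bound suffices. Hence the spectral gap is of order \<open>1 / n\<close> and the mixing time is
  \<open>O(n\<^sup>2)\<close>, with a constant depending on \<open>\<Delta>\<close> and the parameters.\<close>

text \<open>The normalisation makes all degrees fit. Once \<open>\<gamma> ^ card E\<close> is
  divided out, a vertex with k neighbours carries the field lam / \<gamma>^k. If one neighbour is
  pinned to 0 it has at most k - 1 children, and the fixed-point equation for d = k - 1, rewritten
  in x = R / \<gamma>, has exactly this prefactor. So a vertex of degree k is compared with the
  recursion of arity k - 1, which is where uniqueness enters for every d below \<Delta>. Pinned
  neighbours stay as dummy children with ratio 0 or infinity; for \<kappa> > 0 the sensitivity
  vanishes at both, so they cost nothing when children are averaged. The weights
  sqrt(\<open>sens\<close>) are the potential in another guise: up to the factor sqrt(1 - \<kappa>),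
  sqrt(\<open>sens \<kappa> x\<close>) is x times 1 / sqrt(x (1 + \<kappa> x) (1 + x)). The obstacle
  in the variance part is \<beta> = 0, where configurations can be forbidden. Switching a spin from
  1 to 0 is always allowed and divides the weight by at most the largest field, and the crude local
  comparison uses only this direction.\<close>

section \<open>Contraction of the tree recursion\<close>

text \<open>Up to sign, the derivative of \<open>ln ((1 + \<kappa> * x) / (1 + x))\<close> with respect to \<open>ln x\<close>. Here \<open>\<kappa> = \<beta> * \<gamma>\<close>, and the
  ratios \<open>R\<close> of the tree recursion are normalised to \<open>x = R / \<gamma>\<close>.\<close>

definition sens :: "real \<Rightarrow> real \<Rightarrow> real" where
  "sens \<kappa> x = (1 - \<kappa>) * x / ((1 + \<kappa> * x) * (1 + x))"

section \<open>Contraction for equal children\<close>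

text \<open>With h = m \<open>sens\<close>, the logarithmic derivative of F up to sign, h x * h (F
  x) is the squared contraction rate of F in the potential. It is unimodal in x, since its
  logarithmic derivative has the sign of a decreasing function \<open>num\<close>. The maximum need
  not sit at the fixed point c; there the value is h(c)^2, and the room between h(c)^2 and h(c) pays
  for the displacement.\<close>

lemma two_step_contraction:
  fixes \<kappa> \<Lambda> c x :: real and m :: nat
  defines "F \<equiv> \<lambda>x. \<Lambda> * ((1 + \<kappa> * x) / (1 + x)) ^ m"
  assumes \<kappa>: "0 \<le> \<kappa>" "\<kappa> < 1" and \<Lambda>: "\<Lambda> > 0" and c: "c > 0" "F c = c"
    and uniq: "m * sens \<kappa> c < 1" and x: "x > 0"
  shows "(m * sens \<kappa> x) * (m * sens \<kappa> (F x)) \<le> m * sens \<kappa> c"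
proof -
  \<comment> \<open>D x = 1 / x + (1 + \<kappa>) + \<kappa> x, so h = m (1 - \<kappa>) / D. Moreover
    k = - x D', and q = k / D is minus the derivative of ln D with respect to ln x.\<close>
  define D where "D = (\<lambda>x. (1 + \<kappa> * x) * (1 + x) / x)"
  define k where "k = (\<lambda>x. (1 - \<kappa> * x\<^sup>2) / x)"
  define q where "q = (\<lambda>x. (1 - \<kappa> * x\<^sup>2) / ((1 + \<kappa> * x) * (1 + x)))"
  define h where "h = (\<lambda>x. real m * sens \<kappa> x)"
  \<comment> \<open>This is D x times q x - h x * q (F x), which is minus the derivative of L with
    respect to ln x. Clearing D makes it visibly decreasing: k decreases, and q o F increases
    because q and F both decrease.\<close>
  define num where "num = (\<lambda>x. k x - m * (1 - \<kappa>) * q (F x))"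
  define L where "L = (\<lambda>x. ln (D x) + ln (D (F x)))"
  have pos: "1 + \<kappa> * x > 0" "1 + x > 0" if "x > 0" for x
    using that \<kappa> by (auto intro!: add_pos_nonneg)
  have D_pos: "D x > 0" if "x > 0" for x
    using that pos unfolding D_def by auto
  have F_pos: "F x > 0" if "x > 0" for x
    using that pos \<Lambda> unfolding F_def by auto
  have h_pos: "h x \<ge> 0" if "x > 0" for x
    unfolding h_def sens_def using that pos[OF that] \<kappa> by auto
  have h_D: "h x = m * (1 - \<kappa>) / D x" if "x > 0" for x
    unfolding h_def sens_def D_def using that by simp
  have q_kD: "q x = k x / D x" if "x > 0" for x
    unfolding q_def D_def k_def using that by simp
  have h_kq: "h x * k x = m * (1 - \<kappa>) * q x" if "x > 0" for x
    using h_D[OF that] q_kD[OF that] by simp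
  have q_anti: "q y \<le> q x" if "0 < x" "x \<le> y" for x y
  proof -
    have "(1 - \<kappa> * x\<^sup>2) * ((1 + \<kappa> * y) * (1 + y)) - (1 - \<kappa> * y\<^sup>2) * ((1 + \<kappa> * x) * (1 + x))
      = (y - x) * ((1 + \<kappa>) + 2 * \<kappa> * (x + y) + (1 + \<kappa>) * \<kappa> * (x * y))"
      by (simp add: algebra_simps power2_eq_square)
    also have "\<dots> \<ge> 0" using that \<kappa> by (intro mult_nonneg_nonneg add_nonneg_nonneg) auto
    finally show ?thesis
      unfolding q_def using pos[of x] pos[of y] that by (simp add: frac_le_eq divide_le_0_iff)
  qed
  have k_anti: "k y \<le> k x" if "0 < x" "x \<le> y" for x y
  proof -
    have "1 / y \<le> 1 / x" using that by (simp add: frac_le)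
    moreover have "\<kappa> * x \<le> \<kappa> * y" using that \<kappa> by (intro mult_left_mono) auto
    moreover have "k x = 1 / x - \<kappa> * x" "k y = 1 / y - \<kappa> * y"
      unfolding k_def using that by (simp_all add: field_simps power2_eq_square)
    ultimately show ?thesis by linarith
  qed
  have F_anti: "F y \<le> F x" if "0 < x" "x \<le> y" for x y
  proof -
    have "(1 - \<kappa>) * x \<le> (1 - \<kappa>) * y" using that \<kappa> by (intro mult_left_mono) auto
    then have "(1 + \<kappa> * y) * (1 + x) \<le> (1 + \<kappa> * x) * (1 + y)" by (simp add: algebra_simps)
    then have "(1 + \<kappa> * y) / (1 + y) \<le> (1 + \<kappa> * x) / (1 + x)"
      using pos[of x] pos[of y] that by (simp add: divide_simps)
    then show ?thesis unfolding F_def using pos[of y] that \<Lambda>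
      by (intro mult_left_mono power_mono) auto
  qed
  have num_anti: "num y \<le> num x" if "0 < x" "x \<le> y" for x y
    unfolding num_def using that k_anti[OF that] q_anti[OF F_pos F_anti[OF that]] \<kappa>
    by (intro diff_mono mult_left_mono) auto
  have num_D: "num x = (q x - h x * q (F x)) * D x" if "x > 0" for x
  proof -
    have "h x * D x = m * (1 - \<kappa>)" "q x * D x = k x"
      using h_D[OF that] q_kD[OF that] D_pos[OF that] by simp_all
    moreover have "(q x - h x * q (F x)) * D x = q x * D x - h x * D x * q (F x)"
      by (simp add: algebra_simps)
    ultimately show ?thesis unfolding num_def by simp
  qed
  have dlnD: "((\<lambda>x. ln (D x)) has_real_derivative - q x / x) (at x)" if "x > 0" for x
  proof -
    have "((\<lambda>x. ln (D x)) has_real_derivative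
      (((\<kappa> * (1 + x) + (1 + \<kappa> * x)) * x - (1 + \<kappa> * x) * (1 + x)) / (x * x)) / D x) (at x)"
      unfolding D_def using that pos[OF that]
      by (auto intro!: derivative_eq_intros simp: D_def)
    moreover have "(((\<kappa> * (1 + x) + (1 + \<kappa> * x)) * x - (1 + \<kappa> * x) * (1 + x)) / (x * x)) / D x = - q x / x"
      unfolding D_def q_def using that pos[OF that]
      by (simp add: divide_simps) (simp add: algebra_simps power2_eq_square)
    ultimately show ?thesis by simp
  qed
  have dF: "(F has_real_derivative - F x * h x / x) (at x)" if "x > 0" for x
  proof (cases m)
    case 0
    then show ?thesis unfolding F_def h_def by simp
  next
    case (Suc j)
    have g: "((\<lambda>x. (1 + \<kappa> * x) / (1 + x)) has_real_derivative
        (\<kappa> * (1 + x) - (1 + \<kappa> * x)) / ((1 + x) * (1 + x))) (at x)"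
      using that pos[OF that] by (auto intro!: derivative_eq_intros)
    have "(F has_real_derivative \<Lambda> * (m * ((1 + \<kappa> * x) / (1 + x)) ^ j *
      ((\<kappa> * (1 + x) - (1 + \<kappa> * x)) / ((1 + x) * (1 + x))))) (at x)"
      using DERIV_cmult[OF DERIV_power[OF g, of m], of \<Lambda>] Suc
      unfolding F_def by (simp add: mult_ac)
    moreover have "\<Lambda> * (m * ((1 + \<kappa> * x) / (1 + x)) ^ j *
      ((\<kappa> * (1 + x) - (1 + \<kappa> * x)) / ((1 + x) * (1 + x)))) = - F x * h x / x"
      unfolding F_def h_def sens_def Suc power_Suc using that pos[OF that]
      by (simp add: divide_simps) (simp add: algebra_simps)
    ultimately show ?thesis by simp
  qed
  have dL: "(L has_real_derivative - num x / (x * D x)) (at x)" if "x > 0" for x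
  proof -
    have "(L has_real_derivative - q x / x + (- q (F x) / F x) * (- F x * h x / x)) (at x)"
      unfolding L_def
      by (intro DERIV_add dlnD[OF that] DERIV_chain2[OF dlnD[OF F_pos[OF that]] dF[OF that]])
    moreover have "- q x / x + (- q (F x) / F x) * (- F x * h x / x) = - num x / (x * D x)"
    proof -
      have "num x / (x * D x) = (q x - h x * q (F x)) / x"
        using num_D[OF that] D_pos[OF that] by simp
      then show ?thesis using F_pos[OF that] that by (simp add: diff_divide_distrib)
    qed
    ultimately show ?thesis by simp
  qed
  have prod_L: "h x * h (F x) = (m * (1 - \<kappa>))\<^sup>2 * exp (- L x)" if "x > 0" for x
  proof -
    have "exp (- L x) = 1 / (D x * D (F x))"
      unfolding L_def using D_pos[OF that] D_pos[OF F_pos[OF that]]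
      by (simp add: exp_minus exp_diff divide_simps)
    then show ?thesis using h_D[OF that] h_D[OF F_pos[OF that]] by (simp add: power2_eq_square)
  qed
  have L_mono: "h y * h (F y) \<le> h x * h (F x)" if "x > 0" "y > 0" "L x \<le> L y" for x y
    using prod_L[OF that(1)] prod_L[OF that(2)] that(3) by (simp add: mult_left_mono)
  have up: "h x * h (F x) \<le> h y * h (F y)" if "0 < x" "x \<le> y" "num y \<ge> 0" for x y
  proof -
    have "L y \<le> L x"
    proof (rule DERIV_nonpos_imp_nonincreasing[OF that(2)])
      fix z assume z: "x \<le> z" "z \<le> y"
      then have "z > 0" "num z \<ge> 0" using that num_anti[of z y] by auto
      then show "\<exists>d. (L has_real_derivative d) (at z) \<and> d \<le> 0"
        using dL[of z] D_pos[of z] by (intro exI[of _ "- num z / (z * D z)"]) auto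
    qed
    then show ?thesis using L_mono that by auto
  qed
  have down: "h y * h (F y) \<le> h x * h (F x)" if "0 < x" "x \<le> y" "num x \<le> 0" for x y
  proof -
    have "L x \<le> L y"
    proof (rule DERIV_nonneg_imp_nondecreasing[OF that(2)])
      fix z assume z: "x \<le> z" "z \<le> y"
      then have "z > 0" "num z \<le> 0" using that num_anti[of x z] by auto
      then show "\<exists>d. (L has_real_derivative d) (at z) \<and> d \<ge> 0"
        using dL[of z] D_pos[of z] by (intro exI[of _ "- num z / (z * D z)"]) (auto simp: divide_nonpos_pos)
    qed
    then show ?thesis using L_mono that by auto
  qed
  have hc: "h c < 1" "h c \<ge> 0" using uniq h_pos c by (auto simp: h_def)
  have at_c: "h c * h (F c) \<le> h c"
    using c hc by (simp add: mult_left_le)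
  have num_c: "num c = q c * (1 - h c) * D c"
    using num_D[of c] c by (simp add: algebra_simps)
  have cont_num: "continuous_on {a..b} num" if "a > 0" for a b
  proof -
    have "continuous_on {a..b} F"
      using that by (intro continuous_at_imp_continuous_on ballI DERIV_isCont[OF dF]) auto
    moreover have "1 + \<kappa> * F z \<noteq> 0" "1 + F z \<noteq> 0" "z \<noteq> 0" if "z \<in> {a..b}" for z
      using that \<open>a > 0\<close> F_pos[of z] pos[of "F z"] by auto
    ultimately show ?thesis unfolding num_def k_def q_def
      by (intro continuous_intros) auto
  qed
  \<comment> \<open>Between c and the maximum, \<open>num z \<ge> 0\<close> gives h z * q (F z)
    \<le> q z \<le> q c. Through h k = m (1 - \<kappa>) q, used at F z and at c, this reads h z * h
    (F z) * k (F z) \<le> h c * k c. Finally k c \<le> k (F z), since F z \<le> c, and the positive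
    k (F z) cancels. In \<open>left\<close> all signs are reversed.\<close>
  have right: "h z * h (F z) \<le> h c" if "z \<ge> c" "num c > 0" "num z \<ge> 0" for z
  proof -
    have qc: "q c > 0" using num_c \<open>num c > 0\<close> hc D_pos[OF c(1)] by (simp add: zero_less_mult_iff)
    have z0: "z > 0" using that c by simp
    have Fz: "F z > 0" "F z \<le> c" using F_pos[OF z0] F_anti[of c z] that c by auto
    have kc: "k c > 0" using q_kD[of c] qc c D_pos[of c] by (simp add: zero_less_divide_iff)
    have kF: "k (F z) \<ge> k c" "k (F z) > 0" using k_anti[OF Fz] kc by auto
    have qF: "q (F z) > 0" using q_kD[OF Fz(1)] kF D_pos[OF Fz(1)] by simp
    have a: "h z * q (F z) \<le> q z" using num_D[OF z0] that D_pos[OF z0] by (simp add: zero_le_mult_iff)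
    have b: "q z \<le> q c" using q_anti[of c z] that c by simp
    have "h z * h (F z) * k (F z) = h z * q (F z) * (m * (1 - \<kappa>))"
      using arg_cong[OF h_kq[OF Fz(1)], of "\<lambda>t. h z * t"] by (simp only: mult_ac)
    also have "\<dots> \<le> q c * (m * (1 - \<kappa>))" using a b \<kappa> by (intro mult_right_mono) auto
    also have "\<dots> = h c * k c" using h_kq[of c] c by (simp add: algebra_simps)
    also have "\<dots> \<le> h c * k (F z)" using hc kF by (intro mult_left_mono) auto
    finally show ?thesis using kF by simp
  qed
  have left: "h z * h (F z) \<le> h c" if "0 < z" "z \<le> c" "num c < 0" "num z \<le> 0" for z
  proof -
    have qc: "q c < 0" using num_c \<open>num c < 0\<close> hc D_pos[OF c(1)]
      by (metis c(1) diff_gt_0_iff_gt linorder_not_le mult_nonneg_nonneg less_eq_real_def)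
    have z0: "z > 0" using that c by simp
    have Fz: "F z > 0" "c \<le> F z" using F_pos[OF z0] F_anti[of z c] that c by auto
    have kc: "k c < 0" using q_kD[of c] qc c D_pos[of c] by (simp add: divide_less_0_iff)
    have kF: "k (F z) \<le> k c" "k (F z) < 0" using k_anti[OF c(1) Fz(2)] kc by auto
    have a: "h z * q (F z) \<ge> q z" using num_D[OF z0] that D_pos[OF z0] by (simp add: mult_le_0_iff)
    have b: "q z \<ge> q c" using q_anti[of z c] that c by simp
    have "h z * h (F z) * - k (F z) = - (h z * q (F z)) * (m * (1 - \<kappa>))"
      using arg_cong[OF h_kq[OF Fz(1)], of "\<lambda>t. h z * t"]
      by (simp only: mult_ac mult_minus_left mult_minus_right)
    also have "\<dots> \<le> - q c * (m * (1 - \<kappa>))" using a b \<kappa> by (intro mult_right_mono) auto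
    also have "\<dots> = h c * - k c" using h_kq[of c] c by (simp add: algebra_simps)
    also have "\<dots> \<le> h c * - k (F z)" using hc kF by (intro mult_left_mono) auto
    finally show ?thesis using kF by simp
  qed
  have "h x * h (F x) \<le> h c"
  proof -
    \<comment> \<open>The sign of \<open>num c\<close> tells on which side of c the maximum lies. In
      the fourth and sixth case x is beyond it; the zero z of \<open>num\<close> between c and x is
      then the maximiser and is bounded in place of x.\<close>
    consider "x \<le> c" "num c \<ge> 0" | "x \<ge> c" "num c \<le> 0" | "x > c" "num c > 0" "num x \<ge> 0"
      | "x > c" "num c > 0" "num x < 0" | "x < c" "num c < 0" "num x \<le> 0"
      | "x < c" "num c < 0" "num x > 0" by linarith
    then show ?thesis
    proof cases
      case 1 then show ?thesis using up[of x c] x at_c by linarith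
    next
      case 2 then show ?thesis using down[of c x] c at_c by linarith
    next
      case 3 then show ?thesis using right[of x] by simp
    next
      case 4
      obtain z where z: "c \<le> z" "z \<le> x" "num z = 0"
        using IVT2'[of num x 0 c] cont_num[OF c(1), of x] 4 by auto
      then show ?thesis using down[of z x] right[of z] 4 c by auto
    next
      case 5 then show ?thesis using left[of x] x by simp
    next
      case 6
      obtain z where z: "x \<le> z" "z \<le> c" "num z = 0"
        using IVT2'[of num c 0 x] cont_num[OF x, of c] 6 by auto
      then show ?thesis using up[of x z] left[of z] 6 x by auto
    qed
  qed
  then show ?thesis unfolding h_def .
qed


section \<open>Contraction for unequal and pinned children\<close>

lemma sens_nonneg: "0 \<le> \<kappa> \<Longrightarrow> \<kappa> < 1 \<Longrightarrow> 0 \<le> x \<Longrightarrow> 0 \<le> sens \<kappa> x"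
  unfolding sens_def by (intro divide_nonneg_nonneg mult_nonneg_nonneg) auto

lemma sens_le_1:
  assumes "0 \<le> \<kappa>" "\<kappa> < 1" "0 \<le> x"
  shows "sens \<kappa> x \<le> 1"
proof -
  have "0 \<le> \<kappa> * x" "0 \<le> \<kappa> * x * x" using assms by auto
  then have "(1 - \<kappa>) * x \<le> (1 + \<kappa> * x) * (1 + x)" by (simp add: algebra_simps)
  moreover have "(1 + \<kappa> * x) * (1 + x) > 0" using assms by (intro mult_pos_pos add_pos_nonneg) auto
  ultimately show ?thesis unfolding sens_def by simp
qed

text \<open>In terms of t, the factor contributed by a child, the sensitivity is a concave function
  of ln t. It vanishes at t = 1 and, for \<kappa> > 0, at t = \<kappa>, the factors of children
  pinned to 0 and to 1.\<close>

lemma sens_eq: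
  assumes "0 \<le> \<kappa>" "0 \<le> x" and t: "t = (1 + \<kappa> * x) / (1 + x)"
  shows "(1 - \<kappa>) * sens \<kappa> x = 1 + \<kappa> - t - \<kappa> / t"
proof -
  have "1 + \<kappa> * x > 0" "1 + x > 0" using assms by (auto intro!: add_pos_nonneg)
  then show ?thesis unfolding sens_def t
    by (simp add: divide_simps) (simp add: algebra_simps)
qed

text \<open>The left side is the sum over the children of the derivatives of the recursion measured
  in the potential, where all factors cancel to square roots of \<open>sens\<close>. Equal children
  are the worst case: replacing all m child factors by their geometric mean keeps the output and, by
  concavity, can only raise the sum of the sensitivities. Then \<open>two_step_contraction\<close>
  applies.\<close>

lemma tree_contraction:
  fixes \<kappa> \<Lambda> c \<delta> :: real and m a :: nat and \<rho> :: "'b \<Rightarrow> real"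
  assumes \<kappa>: "0 \<le> \<kappa>" "\<kappa> < 1" and \<Lambda>: "\<Lambda> > 0"
    and c: "c > 0" "\<Lambda> * ((1 + \<kappa> * c) / (1 + c)) ^ m = c"
    and uniq: "m * sens \<kappa> c < 1 - \<delta>" "0 < \<delta>" and J: "finite J" "card J + a \<le> m"
    and \<rho>: "\<And>u. u \<in> J \<Longrightarrow> \<rho> u \<ge> 0"
  shows "sqrt (sens \<kappa> (\<Lambda> * \<kappa> ^ a * (\<Prod>u\<in>J. (1 + \<kappa> * \<rho> u) / (1 + \<rho> u)))) *
    (\<Sum>u\<in>J. sqrt (sens \<kappa> (\<rho> u))) \<le> sqrt (1 - \<delta>)"
proof -
  define t where "t = (\<lambda>u. (1 + \<kappa> * \<rho> u) / (1 + \<rho> u))"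
  define y where "y = \<Lambda> * \<kappa> ^ a * (\<Prod>u\<in>J. t u)"
  define S where "S = (\<Sum>u\<in>J. sqrt (sens \<kappa> (\<rho> u)))"
  have \<delta>: "0 \<le> 1 - \<delta>" using uniq sens_nonneg[OF \<kappa>, of c] c
    by (smt (verit, best) mult_nonneg_nonneg of_nat_0_le_iff)
  have t_pos: "t u > 0" if "u \<in> J" for u
    unfolding t_def using \<rho>[OF that] \<kappa> by (intro divide_pos_pos add_pos_nonneg) auto
  have S_nonneg: "S \<ge> 0" unfolding S_def by (intro sum_nonneg) (simp add: sens_nonneg \<kappa> \<rho>)
  have y_nonneg: "y \<ge> 0" unfolding y_def using \<Lambda> \<kappa> t_pos
    by (intro mult_nonneg_nonneg prod_nonneg) (auto simp: less_imp_le)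
  have "sens \<kappa> y * S\<^sup>2 \<le> 1 - \<delta>"
  proof (cases "(a > 0 \<and> \<kappa> = 0) \<or> m = 0")
    case True
    then show ?thesis
    proof
      assume "a > 0 \<and> \<kappa> = 0"
      then have "y = 0" by (simp add: y_def)
      then show ?thesis using \<delta> by (simp add: sens_def)
    next
      assume "m = 0"
      then have "J = {}" using J by simp
      then show ?thesis using \<delta> by (simp add: S_def)
    qed
  next
    case False
    then have m: "m > 0" and a\<kappa>: "a > 0 \<Longrightarrow> \<kappa> > 0" using \<kappa> by auto
    \<comment> \<open>The geometric mean of m factors: \<open>t u\<close> for u in J, \<kappa> for
      each of the a children pinned to 1, and 1 for each of the b empty slots.\<close>
    define \<tau> where "\<tau> = exp ((a * ln \<kappa> + (\<Sum>u\<in>J. ln (t u))) / m)"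
    define b where "b = m - card J - a"
    have b: "real m = card J + a + b" using J unfolding b_def by simp
    have \<tau>: "\<tau> > 0" "m * ln \<tau> = a * ln \<kappa> + (\<Sum>u\<in>J. ln (t u))"
      unfolding \<tau>_def using m by auto
    have "\<tau> ^ m = exp (m * ln \<tau>)" using \<tau>(1) by (simp add: exp_of_nat_mult)
    also have "\<dots> = exp (a * ln \<kappa>) * (\<Prod>u\<in>J. t u)"
      unfolding \<tau>(2) exp_add using t_pos J by (simp add: exp_sum)
    also have "exp (a * ln \<kappa>) = \<kappa> ^ a" using a\<kappa> by (cases "a = 0") (simp_all add: exp_of_nat_mult)
    finally have y_\<tau>: "y = \<Lambda> * \<tau> ^ m" unfolding y_def by simp
    \<comment> \<open>Jensen by tangent lines. Summed with \<tau> in the denominator it gives A,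
      that the arithmetic mean is at least \<tau>; summed with \<tau> in the numerator it gives B,
      the same for the reciprocals times \<kappa>.\<close>
    have ln_ge: "1 + ln p - ln r \<le> p / r" if "p > 0" "r > 0" for p r :: real
      using ln_le_minus_one[of "p / r"] that by (simp add: ln_div)
    have "m * (1::real) = (\<Sum>u\<in>J. 1 + ln (t u) - ln \<tau>) + a * (1 + ln \<kappa> - ln \<tau>) + b * (1 + ln 1 - ln \<tau>)"
      using \<tau>(2) unfolding b by (simp add: sum.distrib sum_subtractf algebra_simps)
    also have "\<dots> \<le> (\<Sum>u\<in>J. t u / \<tau>) + a * (\<kappa> / \<tau>) + b * (1 / \<tau>)"
    proof (intro add_mono sum_mono)
      show "a * (1 + ln \<kappa> - ln \<tau>) \<le> a * (\<kappa> / \<tau>)"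
        using a\<kappa> \<tau> by (cases "a = 0") (auto intro!: mult_left_mono ln_ge simp del: times_divide_eq_right)
      show "b * (1 + ln 1 - ln \<tau>) \<le> b * (1 / \<tau>)"
        using \<tau> by (intro mult_left_mono ln_ge) auto
    qed (use ln_ge \<tau> t_pos in auto)
    also have "\<dots> = ((\<Sum>u\<in>J. t u) + a * \<kappa> + b) / \<tau>"
      by (simp add: sum_divide_distrib add_divide_distrib)
    finally have A: "m * \<tau> \<le> (\<Sum>u\<in>J. t u) + a * \<kappa> + b" using \<tau> by (simp add: field_simps)
    have "m * (1::real) = (\<Sum>u\<in>J. 1 + ln \<tau> - ln (t u)) + a * (1 + ln \<tau> - ln \<kappa>) + b * (1 + ln \<tau> - ln 1)"
      using \<tau>(2) unfolding b by (simp add: sum.distrib sum_subtractf algebra_simps)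
    also have "\<dots> \<le> (\<Sum>u\<in>J. \<tau> / t u) + a * (\<tau> / \<kappa>) + b * (\<tau> / 1)"
    proof (intro add_mono sum_mono)
      show "a * (1 + ln \<tau> - ln \<kappa>) \<le> a * (\<tau> / \<kappa>)"
        using a\<kappa> \<tau> by (cases "a = 0") (auto intro!: mult_left_mono ln_ge simp del: times_divide_eq_right)
      show "b * (1 + ln \<tau> - ln 1) \<le> b * (\<tau> / 1)"
        using \<tau> by (intro mult_left_mono ln_ge) auto
    qed (use ln_ge \<tau> t_pos in auto)
    also have "\<dots> = \<tau> * ((\<Sum>u\<in>J. 1 / t u) + a / \<kappa> + b)"
      by (simp add: sum_distrib_left algebra_simps)
    finally have "m / \<tau> \<le> (\<Sum>u\<in>J. 1 / t u) + a / \<kappa> + b" using \<tau> by (simp add: field_simps)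
    then have "\<kappa> * (m / \<tau>) \<le> \<kappa> * ((\<Sum>u\<in>J. 1 / t u) + a / \<kappa> + b)" using \<kappa> by (intro mult_left_mono)
    also have "\<dots> = \<kappa> * (\<Sum>u\<in>J. 1 / t u) + a + \<kappa> * b"
      using a\<kappa> by (cases "a = 0") (auto simp: algebra_simps)
    finally have B: "m * (\<kappa> / \<tau>) \<le> (\<Sum>u\<in>J. \<kappa> / t u) + a + \<kappa> * b"
      by (simp add: sum_distrib_left algebra_simps)
    define \<sigma> where "\<sigma> = (1 + \<kappa> - \<tau> - \<kappa> / \<tau>) / (1 - \<kappa>)"
    have "(1 - \<kappa>) * (\<Sum>u\<in>J. sens \<kappa> (\<rho> u)) = (\<Sum>u\<in>J. 1 + \<kappa> - t u - \<kappa> / t u)"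
      unfolding sum_distrib_left using \<kappa> \<rho> by (intro sum.cong refl sens_eq) (auto simp: t_def)
    also have "\<dots> = card J * (1 + \<kappa>) - (\<Sum>u\<in>J. t u) - (\<Sum>u\<in>J. \<kappa> / t u)"
      by (simp add: sum_subtractf)
    also have "\<dots> \<le> m * (1 + \<kappa>) - m * \<tau> - m * (\<kappa> / \<tau>)"
      using A B unfolding b by (simp add: algebra_simps)
    also have "\<dots> = (1 - \<kappa>) * (m * \<sigma>)"
    proof -
      have "(1 - \<kappa>) * \<sigma> = 1 + \<kappa> - \<tau> - \<kappa> / \<tau>" using \<kappa> by (simp add: \<sigma>_def)
      then have "(1 - \<kappa>) * (m * \<sigma>) = m * (1 + \<kappa> - \<tau> - \<kappa> / \<tau>)" by (simp add: mult_ac)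
      then show ?thesis by (simp add: right_diff_distrib)
    qed
    finally have sum_le: "(\<Sum>u\<in>J. sens \<kappa> (\<rho> u)) \<le> m * \<sigma>" using \<kappa> by simp
    have "0 \<le> (\<Sum>u\<in>J. sens \<kappa> (\<rho> u))" by (intro sum_nonneg) (simp add: sens_nonneg \<kappa> \<rho>)
    with sum_le have "0 \<le> m * \<sigma>" by linarith
    then have \<sigma>0: "\<sigma> \<ge> 0" using m by (simp add: zero_le_mult_iff)
    have "S\<^sup>2 \<le> (\<Sum>u\<in>J. (sqrt (sens \<kappa> (\<rho> u)))\<^sup>2) * card J"
      unfolding S_def by (rule sum_squared_le_sum_of_squares)
    also have "(\<Sum>u\<in>J. (sqrt (sens \<kappa> (\<rho> u)))\<^sup>2) = (\<Sum>u\<in>J. sens \<kappa> (\<rho> u))"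
      by (intro sum.cong) (auto simp: sens_nonneg \<kappa> \<rho>)
    also have "(\<Sum>u\<in>J. sens \<kappa> (\<rho> u)) * card J \<le> (m * \<sigma>) * m"
      using sum_le b \<sigma>0 by (intro mult_mono) auto
    finally have S2: "S\<^sup>2 \<le> m * \<sigma> * m" .
    have "sens \<kappa> y * (m * \<sigma> * m) \<le> 1 - \<delta>"
    proof (cases "\<sigma> = 0")
      case False
      have "(1 - \<tau>) * (\<tau> - \<kappa>) = \<tau> * (1 - \<kappa>) * \<sigma>"
        unfolding \<sigma>_def using \<tau> \<kappa> by (simp add: field_simps)
      also have "\<dots> > 0" using False \<sigma>0 \<tau> \<kappa> by simp
      finally have \<tau>\<kappa>: "\<kappa> < \<tau>" "\<tau> < 1" using \<kappa> by (auto simp: zero_less_mult_iff)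
      \<comment> \<open>As \<sigma> > 0 forces \<kappa> < \<tau> < 1, \<tau> is the factor of a
        genuine ratio x. Then m children of ratio x have sensitivity \<sigma> each and the same
        output y.\<close>
      define x where "x = (1 - \<tau>) / (\<tau> - \<kappa>)"
      have x: "x > 0" using \<tau>\<kappa> by (simp add: x_def)
      have x\<tau>: "\<tau> = (1 + \<kappa> * x) / (1 + x)"
      proof -
        have "x * (\<tau> - \<kappa>) = 1 - \<tau>" using \<tau>\<kappa> by (simp add: x_def)
        then have "\<tau> * (1 + x) = 1 + \<kappa> * x" by (simp add: algebra_simps)
        then show ?thesis using x by (simp add: field_simps)
      qed
      have "sens \<kappa> x = \<sigma>" using sens_eq[OF \<kappa>(1) _ x\<tau>] x \<kappa> unfolding \<sigma>_def by (simp add: field_simps)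
      moreover have "(m * sens \<kappa> x) * (m * sens \<kappa> (\<Lambda> * ((1 + \<kappa> * x) / (1 + x)) ^ m)) \<le> m * sens \<kappa> c"
        using uniq by (intro two_step_contraction \<kappa> \<Lambda> c x) auto
      ultimately show ?thesis using uniq unfolding y_\<tau> x\<tau>[symmetric] by (simp add: mult_ac)
    qed (use \<delta> in simp)
    moreover have "sens \<kappa> y * S\<^sup>2 \<le> sens \<kappa> y * (m * \<sigma> * m)"
      using S2 sens_nonneg[OF \<kappa> y_nonneg] by (intro mult_left_mono)
    ultimately show ?thesis by linarith
  qed
  then have "sqrt (sens \<kappa> y * S\<^sup>2) \<le> sqrt (1 - \<delta>)" by simp
  then show ?thesis using S_nonneg by (simp add: real_sqrt_mult y_def S_def t_def)
qed

section \<open>Soft hard-core models\<close>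

locale finite_graph =
  fixes V :: "'a set" and E :: "'a set set"
  assumes simple: "simple_graph V E"
begin

definition N :: "'a \<Rightarrow> 'a set" where
  "N v = {u. {v, u} \<in> E}"

lemma finite_V: "finite V"
  using simple by (simp add: simple_graph_def)

lemma edge_subset: "e \<in> E \<Longrightarrow> e \<subseteq> V" and edge_card: "e \<in> E \<Longrightarrow> card e = 2"
  using simple by (auto simp: simple_graph_def)

lemma finite_E: "finite E"
  using finite_subset[of E "Pow V"] edge_subset finite_V by auto

lemma N_subset: "N v \<subseteq> V"
  using edge_subset by (force simp: N_def)

lemma finite_N: "finite (N v)"
  using N_subset finite_V finite_subset by blast

lemma N_irrefl: "v \<notin> N v"
  using edge_card by (fastforce simp: N_def)

lemma N_sym: "u \<in> N v \<longleftrightarrow> v \<in> N u"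
  by (simp add: N_def insert_commute)

lemma edges_at: "{e \<in> E. v \<in> e} = (\<lambda>u. {v, u}) ` N v"
proof (intro set_eqI iffI)
  fix e assume e: "e \<in> {e \<in> E. v \<in> e}"
  then obtain x y where "e = {x, y}" using edge_card[of e] by (auto simp: card_2_iff)
  then show "e \<in> (\<lambda>u. {v, u}) ` N v" using e by (auto simp: N_def insert_commute)
qed (auto simp: N_def)

lemma degree_eq: "degree E v = card (N v)"
  unfolding degree_def edges_at by (intro card_image inj_onI) (auto simp: doubleton_eq_iff)

definition edges_in :: "'a set \<Rightarrow> nat" where
  "edges_in A = card {e \<in> E. e \<subseteq> A}"

lemma edges_in_empty: "edges_in {} = 0"
proof -
  have "{e \<in> E. e \<subseteq> {}} = {}" using edge_card[of "{}"] by auto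
  then show ?thesis unfolding edges_in_def by (simp only: card.empty)
qed

lemma edges_in_insert:
  assumes "v \<notin> A"
  shows "edges_in (insert v A) = edges_in A + card (N v \<inter> A)"
proof -
  have "{e \<in> E. e \<subseteq> insert v A} = {e \<in> E. e \<subseteq> A} \<union> (\<lambda>u. {v, u}) ` (N v \<inter> A)" (is "_ = ?B \<union> ?C")
  proof (intro set_eqI iffI)
    fix e assume e: "e \<in> {e \<in> E. e \<subseteq> insert v A}"
    show "e \<in> ?B \<union> ?C"
    proof (cases "v \<in> e")
      case True
      then have "e \<in> {e \<in> E. v \<in> e}" using e by simp
      then have "e \<in> (\<lambda>u. {v, u}) ` N v" unfolding edges_at .
      then obtain u where u: "e = {v, u}" "u \<in> N v" by auto
      then have "u \<in> A" using e N_irrefl[of v] by auto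
      then show ?thesis using u by auto
    qed (use e in auto)
  qed (auto simp: N_def)
  moreover have "?B \<inter> ?C = {}" using assms by blast
  moreover have "card ?C = card (N v \<inter> A)"
    by (intro card_image inj_onI) (auto simp: doubleton_eq_iff)
  ultimately show ?thesis
    unfolding edges_in_def using finite_E finite_N by (simp add: card_Un_disjoint)
qed

end

text \<open>Normalised by \<open>\<gamma> ^ card E\<close>, a 2-spin system becomes a soft hard-core model: the weight of a set
  of ones carries a factor \<open>\<kappa> = \<beta> * \<gamma>\<close> per inner edge. Pinning a vertex to 1 multiplies the fields
  of its neighbours by \<open>\<kappa>\<close>, pinning it to 0 has no effect.\<close>

locale soft_hardcore = finite_graph V E for V :: "'a set" and E +
  fixes \<kappa> :: real
  assumes \<kappa>_nonneg: "0 \<le> \<kappa>" and \<kappa>_less: "\<kappa> < 1"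
begin

definition wt :: "('a \<Rightarrow> real) \<Rightarrow> 'a set \<Rightarrow> real" where
  "wt \<phi> A = (\<Prod>v\<in>A. \<phi> v) * \<kappa> ^ edges_in A"

definition scale :: "'a set \<Rightarrow> ('a \<Rightarrow> real) \<Rightarrow> 'a \<Rightarrow> real" where
  "scale T \<phi> v = (if v \<in> T then \<kappa> * \<phi> v else \<phi> v)"

definition Z :: "'a set \<Rightarrow> ('a \<Rightarrow> real) \<Rightarrow> real" where
  "Z S \<phi> = (\<Sum>A\<in>Pow S. wt \<phi> A)"

definition Z1 :: "'a set \<Rightarrow> ('a \<Rightarrow> real) \<Rightarrow> 'a \<Rightarrow> real" where
  "Z1 S \<phi> v = (\<Sum>A\<in>Pow S. of_bool (v \<in> A) * wt \<phi> A)"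

definition marg :: "'a set \<Rightarrow> ('a \<Rightarrow> real) \<Rightarrow> 'a \<Rightarrow> real" where
  "marg S \<phi> v = Z1 S \<phi> v / Z S \<phi>"

text \<open>The odds that r is 1: the weight with r pinned to 1 over the weight with r pinned to
  0.\<close>

definition ratio :: "'a set \<Rightarrow> ('a \<Rightarrow> real) \<Rightarrow> 'a \<Rightarrow> real" where
  "ratio S \<phi> r = \<phi> r * Z (S - {r}) (scale (N r) \<phi>) / Z (S - {r}) \<phi>"

text \<open>The influence of \<open>r\<close> on \<open>v\<close>, written so that it is meaningful even if \<open>r\<close> is never 1.\<close>

definition infl :: "'a set \<Rightarrow> ('a \<Rightarrow> real) \<Rightarrow> 'a \<Rightarrow> 'a \<Rightarrow> real" where
  "infl S \<phi> r v = (if v = r then 1 else marg (S - {r}) (scale (N r) \<phi>) v - marg (S - {r}) \<phi> v)"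

section \<open>Recursions for partition functions and marginals\<close>

lemma wt_cong: "(\<And>v. v \<in> A \<Longrightarrow> \<phi> v = \<psi> v) \<Longrightarrow> wt \<phi> A = wt \<psi> A"
  unfolding wt_def by (simp cong: prod.cong)

lemma Z_cong: "(\<And>v. v \<in> S \<Longrightarrow> \<phi> v = \<psi> v) \<Longrightarrow> Z S \<phi> = Z S \<psi>"
  unfolding Z_def by (intro sum.cong wt_cong) auto

lemma marg_cong: "(\<And>v. v \<in> S \<Longrightarrow> \<phi> v = \<psi> v) \<Longrightarrow> marg S \<phi> v = marg S \<psi> v"
proof -
  assume *: "\<And>v. v \<in> S \<Longrightarrow> \<phi> v = \<psi> v"
  have "Z1 S \<phi> v = Z1 S \<psi> v"
    unfolding Z1_def using * by (intro sum.cong refl arg_cong2[of _ _ _ _ "(*)"] wt_cong) auto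
  then show ?thesis unfolding marg_def using Z_cong[OF *] by simp
qed

lemma wt_empty: "wt \<phi> {} = 1"
  by (simp add: wt_def edges_in_empty)

lemma prod_scale:
  "finite A \<Longrightarrow> (\<Prod>v\<in>A. scale T \<phi> v) = \<kappa> ^ card (T \<inter> A) * (\<Prod>v\<in>A. \<phi> v)"
proof (induction A rule: finite_induct)
  case (insert v A)
  then show ?case by (cases "v \<in> T") (simp_all add: scale_def Int_insert_right)
qed simp

lemma wt_insert:
  assumes "finite A" "v \<notin> A"
  shows "wt \<phi> (insert v A) = \<phi> v * wt (scale (N v) \<phi>) A"
  using assms by (simp add: wt_def edges_in_insert power_add prod_scale)

lemma wt_nonneg:
  assumes "\<forall>v\<in>A. \<phi> v \<ge> 0"
  shows "wt \<phi> A \<ge> 0"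
  unfolding wt_def using assms \<kappa>_nonneg by (intro mult_nonneg_nonneg prod_nonneg) auto

lemma scale_nonneg: "\<phi> v \<ge> 0 \<Longrightarrow> scale T \<phi> v \<ge> 0"
  using \<kappa>_nonneg by (simp add: scale_def)

lemma sum_Pow_insert:
  assumes "finite S" "v \<notin> S"
  shows "(\<Sum>A\<in>Pow (insert v S). g A) = (\<Sum>A\<in>Pow S. g A) + (\<Sum>A\<in>Pow S. g (insert v A))"
proof -
  have "inj_on (insert v) (Pow S)" using assms(2) by (auto intro!: inj_onI)
  moreover have "Pow S \<inter> insert v ` Pow S = {}" using assms(2) by auto
  ultimately show ?thesis using assms(1)
    by (simp add: Pow_insert sum.union_disjoint sum.reindex)
qed

lemma wt_insert_Pow:
  assumes "finite S" "u \<notin> S" "A \<in> Pow S"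
  shows "wt \<phi> (insert u A) = \<phi> u * wt (scale (N u) \<phi>) A"
  using assms finite_subset[of A S] by (intro wt_insert) auto

lemma Z_pos:
  assumes "finite S" "\<forall>v\<in>S. \<phi> v \<ge> 0"
  shows "Z S \<phi> > 0"
  unfolding Z_def using assms wt_empty[of \<phi>]
  by (intro sum_pos2[of _ "{}"]) (auto intro!: wt_nonneg)

lemma Z_insert:
  assumes "finite S" "u \<notin> S"
  shows "Z (insert u S) \<phi> = Z S \<phi> + \<phi> u * Z S (scale (N u) \<phi>)"
proof -
  have "(\<Sum>A\<in>Pow S. wt \<phi> (insert u A)) = \<phi> u * Z S (scale (N u) \<phi>)"
    unfolding Z_def sum_distrib_left using wt_insert_Pow[OF assms] by (intro sum.cong refl) simp
  then show ?thesis using assms unfolding Z_def by (simp add: sum_Pow_insert)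
qed

lemma Z1_insert:
  assumes "finite S" "u \<notin> S" "v \<noteq> u"
  shows "Z1 (insert u S) \<phi> v = Z1 S \<phi> v + \<phi> u * Z1 S (scale (N u) \<phi>) v"
proof -
  have "(\<Sum>A\<in>Pow S. of_bool (v \<in> insert u A) * wt \<phi> (insert u A)) = \<phi> u * Z1 S (scale (N u) \<phi>) v"
    unfolding Z1_def sum_distrib_left using assms(3) wt_insert_Pow[OF assms(1,2)]
    by (intro sum.cong refl) simp
  then show ?thesis unfolding Z1_def sum_Pow_insert[OF assms(1,2)] by (simp only:)
qed

lemma Z1_insert_self:
  assumes "finite S" "u \<notin> S"
  shows "Z1 (insert u S) \<phi> u = \<phi> u * Z S (scale (N u) \<phi>)"
proof -
  have "(\<Sum>A\<in>Pow S. of_bool (u \<in> insert u A) * wt \<phi> (insert u A)) = \<phi> u * Z S (scale (N u) \<phi>)"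
    unfolding Z_def sum_distrib_left using wt_insert_Pow[OF assms] by (intro sum.cong refl) simp
  moreover have "(\<Sum>A\<in>Pow S. of_bool (u \<in> A) * wt \<phi> A) = 0"
    using assms by (intro sum.neutral) auto
  ultimately show ?thesis unfolding Z1_def sum_Pow_insert[OF assms] by (simp only: add_0)
qed

lemma ratio_nonneg:
  assumes "finite S" "\<forall>v\<in>S. \<phi> v \<ge> 0" "r \<in> S"
  shows "ratio S \<phi> r \<ge> 0"
proof -
  have "Z (S - {r}) \<phi> > 0" "Z (S - {r}) (scale (N r) \<phi>) > 0"
    using assms by (auto intro!: Z_pos simp: scale_nonneg)
  then show ?thesis unfolding ratio_def using assms by simp
qed

lemma Z_ratio:
  assumes "finite S" "\<forall>v\<in>S. \<phi> v \<ge> 0" "r \<in> S"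
  shows "Z S \<phi> = Z (S - {r}) \<phi> * (1 + ratio S \<phi> r)"
proof -
  have "Z (S - {r}) \<phi> > 0" using assms by (intro Z_pos) auto
  then show ?thesis using Z_insert[of "S - {r}" r \<phi>] assms
    by (simp add: insert_absorb ratio_def algebra_simps)
qed

text \<open>Total probability over the spin of r: R / (1 + R) is the probability that r is 1, and
  \<open>infl\<close> is the change of the marginal that this causes. For v = r the base value 0 and
  the influence 1 give that probability itself.\<close>

lemma marg_ratio:
  assumes "finite S" "\<forall>v\<in>S. \<phi> v \<ge> 0" "r \<in> S"
  shows "marg S \<phi> v = (if v = r then 0 else marg (S - {r}) \<phi> v)
    + ratio S \<phi> r / (1 + ratio S \<phi> r) * infl S \<phi> r v"
proof -
  let ?S = "S - {r}" and ?\<psi> = "scale (N r) \<phi>"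
  let ?R = "ratio S \<phi> r"
  have pos: "Z ?S \<phi> > 0" "Z ?S ?\<psi> > 0" using assms by (auto intro!: Z_pos simp: scale_nonneg)
  have R: "1 + ?R > 0" using ratio_nonneg[OF assms] by linarith
  have ZZ: "\<phi> r * Z ?S ?\<psi> = ?R * Z ?S \<phi>" using pos by (simp add: ratio_def)
  have ins: "insert r ?S = S" using assms by auto
  show ?thesis
  proof (cases "v = r")
    case True
    have "marg S \<phi> r = ?R * Z ?S \<phi> / (Z ?S \<phi> * (1 + ?R))"
      unfolding marg_def using Z1_insert_self[of ?S r \<phi>] assms ins ZZ Z_ratio[OF assms] by simp
    also have "\<dots> = ?R / (1 + ?R)" using pos by simp
    finally show ?thesis using True by (simp add: infl_def)
  next
    case False
    have "Z1 S \<phi> v = Z1 ?S \<phi> v + \<phi> r * Z1 ?S ?\<psi> v"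
      using Z1_insert[of ?S r v \<phi>] assms False ins by simp
    also have "\<dots> = Z ?S \<phi> * (marg ?S \<phi> v + ?R * marg ?S ?\<psi> v)"
      unfolding marg_def using pos by (simp add: ratio_def algebra_simps)
    finally have "marg S \<phi> v = (marg ?S \<phi> v + ?R * marg ?S ?\<psi> v) / (1 + ?R)"
      unfolding marg_def[of S] Z_ratio[OF assms] using pos by simp
    then show ?thesis using False R by (simp add: infl_def field_simps)
  qed
qed

text \<open>Scaling the field of r alone multiplies its odds by \<kappa> and leaves the laws given r
  = 0 and given r = 1 untouched. So a marginal moves by the influence times the change of the
  probability of r, and \<kappa> R / (1 + \<kappa> R) - R / (1 + R) is minus the
  sensitivity.\<close>

lemma
  assumes "finite S" "\<forall>v\<in>S. \<phi> v \<ge> 0" "r \<in> S"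
  shows marg_scale_single: "marg S (scale {r} \<phi>) v - marg S \<phi> v
      = - sens \<kappa> (ratio S \<phi> r) * infl S \<phi> r v"
    and Z_scale_single: "Z S (scale {r} \<phi>)
      = Z S \<phi> * ((1 + \<kappa> * ratio S \<phi> r) / (1 + ratio S \<phi> r))"
proof -
  let ?S = "S - {r}" and ?\<phi> = "scale {r} \<phi>" and ?R = "ratio S \<phi> r"
  have R: "?R \<ge> 0" using ratio_nonneg[OF assms] .
  have p: "1 + ?R > 0" "1 + \<kappa> * ?R > 0" using R \<kappa>_nonneg by (auto intro: add_pos_nonneg)
  have nn: "\<forall>v\<in>S. ?\<phi> v \<ge> 0" using assms by (auto simp: scale_nonneg)
  have c1: "Z ?S ?\<phi> = Z ?S \<phi>" "Z ?S (scale (N r) ?\<phi>) = Z ?S (scale (N r) \<phi>)"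
    by (intro Z_cong; simp add: scale_def)+
  have c2: "marg ?S ?\<phi> v = marg ?S \<phi> v" "marg ?S (scale (N r) ?\<phi>) v = marg ?S (scale (N r) \<phi>) v"
    by (intro marg_cong; simp add: scale_def)+
  have rat: "ratio S ?\<phi> r = \<kappa> * ?R" unfolding ratio_def c1 by (simp add: scale_def)
  have inf: "infl S ?\<phi> r v = infl S \<phi> r v" unfolding infl_def c2 ..
  have "marg S ?\<phi> v - marg S \<phi> v = (\<kappa> * ?R / (1 + \<kappa> * ?R) - ?R / (1 + ?R)) * infl S \<phi> r v"
    using marg_ratio[OF assms(1) nn assms(3), of v] marg_ratio[OF assms, of v] c2 rat inf
    by (simp add: left_diff_distrib)
  also have "\<kappa> * ?R / (1 + \<kappa> * ?R) - ?R / (1 + ?R) = - sens \<kappa> ?R"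
    unfolding sens_def using p by (simp add: divide_simps) (simp add: algebra_simps)
  finally show "marg S ?\<phi> v - marg S \<phi> v = - sens \<kappa> ?R * infl S \<phi> r v" .
  show "Z S ?\<phi> = Z S \<phi> * ((1 + \<kappa> * ?R) / (1 + ?R))"
    using Z_ratio[OF assms(1) nn assms(3)] Z_ratio[OF assms] c1 rat p by simp
qed

text \<open>The self-avoiding walk recursion: the neighbours of a vertex are pinned one at a time.\<close>

lemma pin_one_by_one:
  assumes "finite S" "\<forall>v\<in>S. \<phi> v \<ge> 0" "finite T" "T \<subseteq> S"
  shows "\<exists>Q. (\<forall>u\<in>T. Q u \<subseteq> T - {u}) \<and>
    Z S (scale T \<phi>) = Z S \<phi> *
      (\<Prod>u\<in>T. (1 + \<kappa> * ratio S (scale (Q u) \<phi>) u) / (1 + ratio S (scale (Q u) \<phi>) u)) \<and>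
    (\<forall>v. \<bar>marg S (scale T \<phi>) v - marg S \<phi> v\<bar> \<le>
      (\<Sum>u\<in>T. sens \<kappa> (ratio S (scale (Q u) \<phi>) u) * \<bar>infl S (scale (Q u) \<phi>) u v\<bar>))"
  using assms(3,4)
proof (induction T rule: finite_induct)
  case empty
  have "scale {} \<phi> = \<phi>" by (auto simp: scale_def)
  then show ?case by simp
next
  case (insert x T)
  let ?\<rho> = "\<lambda>Q u. ratio S (scale (Q u) \<phi>) u"
  from insert obtain Q where Q: "\<forall>u\<in>T. Q u \<subseteq> T - {u}"
    "Z S (scale T \<phi>) = Z S \<phi> * (\<Prod>u\<in>T. (1 + \<kappa> * ?\<rho> Q u) / (1 + ?\<rho> Q u))"
    "\<And>v. \<bar>marg S (scale T \<phi>) v - marg S \<phi> v\<bar> \<le> (\<Sum>u\<in>T. sens \<kappa> (?\<rho> Q u) * \<bar>infl S (scale (Q u) \<phi>) u v\<bar>)"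
    by auto
  \<comment> \<open>\<open>Q u\<close> collects the neighbours scaled before u; the new vertex x
    comes after all of T. Earlier neighbours thus see the common parent as a 1, later ones as a
    0.\<close>
  define Q' where "Q' = Q(x := T)"
  have Q': "Q' x = T" "\<And>u. u \<in> T \<Longrightarrow> Q' u = Q u" using insert by (auto simp: Q'_def)
  have sc: "scale (insert x T) \<phi> = scale {x} (scale T \<phi>)" using insert by (auto simp: scale_def)
  have nn: "\<forall>v\<in>S. scale T \<phi> v \<ge> 0" using assms by (auto simp: scale_nonneg)
  have xS: "x \<in> S" using insert by auto
  note step = marg_scale_single[OF assms(1) nn xS] Z_scale_single[OF assms(1) nn xS]
  have s0: "sens \<kappa> (ratio S (scale T \<phi>) x) \<ge> 0"
    using ratio_nonneg[OF assms(1) nn xS] \<kappa>_nonneg \<kappa>_less by (intro sens_nonneg) auto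
  show ?case
  proof (intro exI[of _ Q'] conjI allI)
    show "\<forall>u\<in>insert x T. Q' u \<subseteq> insert x T - {u}" using Q(1) Q' insert by auto
    have "(\<Prod>u\<in>T. (1 + \<kappa> * ?\<rho> Q' u) / (1 + ?\<rho> Q' u)) = (\<Prod>u\<in>T. (1 + \<kappa> * ?\<rho> Q u) / (1 + ?\<rho> Q u))"
      by (intro prod.cong) (simp_all add: Q')
    then show "Z S (scale (insert x T) \<phi>) =
      Z S \<phi> * (\<Prod>u\<in>insert x T. (1 + \<kappa> * ?\<rho> Q' u) / (1 + ?\<rho> Q' u))"
      unfolding sc step(2) Q(2) prod.insert[OF insert(1,2)] Q'(1) by simp
    fix v
    have "(\<Sum>u\<in>T. sens \<kappa> (?\<rho> Q' u) * \<bar>infl S (scale (Q' u) \<phi>) u v\<bar>) =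
      (\<Sum>u\<in>T. sens \<kappa> (?\<rho> Q u) * \<bar>infl S (scale (Q u) \<phi>) u v\<bar>)"
      by (intro sum.cong) (simp_all add: Q')
    moreover have "\<bar>marg S (scale (insert x T) \<phi>) v - marg S (scale T \<phi>) v\<bar> =
      sens \<kappa> (?\<rho> Q' x) * \<bar>infl S (scale (Q' x) \<phi>) x v\<bar>"
      unfolding sc step(1) Q'(1) using s0 by (simp add: abs_mult)
    ultimately show "\<bar>marg S (scale (insert x T) \<phi>) v - marg S \<phi> v\<bar> \<le>
      (\<Sum>u\<in>insert x T. sens \<kappa> (?\<rho> Q' u) * \<bar>infl S (scale (Q' u) \<phi>) u v\<bar>)"
      using Q(3)[of v] unfolding sum.insert[OF insert(1,2)] by linarith
  qed
qed

end

section \<open>Total influence\<close>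

text \<open>\<open>contraction\<close> is demanded only for card J + a < card (N v), the situation
  below the root of the recursion: the parent is a neighbour that is used up without contributing a
  factor \<kappa>.\<close>

locale contracting = soft_hardcore V E \<kappa> for V :: "'a set" and E \<kappa> +
  fixes fld :: "'a \<Rightarrow> real" and q :: real
  assumes fld_pos: "\<And>v. fld v > 0" and q_nonneg: "0 \<le> q" and q_less: "q < 1"
    and contraction: "\<And>v a J (\<rho> :: 'a \<Rightarrow> real). v \<in> V \<Longrightarrow> finite J \<Longrightarrow> card J + a < card (N v) \<Longrightarrow>
      (\<forall>u\<in>J. \<rho> u \<ge> 0) \<Longrightarrow>
      sqrt (sens \<kappa> (fld v * \<kappa> ^ a * (\<Prod>u\<in>J. (1 + \<kappa> * \<rho> u) / (1 + \<rho> u)))) *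
        (\<Sum>u\<in>J. sqrt (sens \<kappa> (\<rho> u))) \<le> q"
begin

text \<open>Fields arising from pinning neighbours to 1; \<open>slack\<close> says that a neighbour has also been
  pinned to 0, which leaves at most \<open>\<Delta> - 1\<close> children in the recursion.\<close>

definition admissible :: "'a set \<Rightarrow> ('a \<Rightarrow> real) \<Rightarrow> bool" where
  "admissible S \<phi> \<longleftrightarrow> (\<forall>v\<in>S. \<exists>a. \<phi> v = fld v * \<kappa> ^ a \<and> a + card (N v \<inter> S) \<le> card (N v))"

definition slack :: "'a set \<Rightarrow> ('a \<Rightarrow> real) \<Rightarrow> 'a \<Rightarrow> bool" where
  "slack S \<phi> v \<longleftrightarrow> (\<exists>a. \<phi> v = fld v * \<kappa> ^ a \<and> a + card (N v \<inter> S) < card (N v))"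

lemma admissible_nonneg: "admissible S \<phi> \<Longrightarrow> \<forall>v\<in>S. \<phi> v \<ge> 0"
  unfolding admissible_def using fld_pos \<kappa>_nonneg
  by (metis less_imp_le mult_nonneg_nonneg zero_le_power)

lemma card_N_remove:
  assumes "r \<in> S" "r \<in> N v"
  shows "card (N v \<inter> S) = Suc (card (N v \<inter> (S - {r})))"
proof -
  have "N v \<inter> S = insert r (N v \<inter> (S - {r}))" using assms by auto
  moreover have "r \<notin> N v \<inter> (S - {r})" by simp
  ultimately show ?thesis using finite_N by (metis card_insert_disjoint finite_Int)
qed

text \<open>A removed neighbour accounts for at most one factor \<kappa>. When r leaves S, the
  neighbour count inside S drops by one at each neighbour of r, which pays for the factor received
  there.\<close>

lemma admissible_scale:
  assumes "admissible S \<phi>" "r \<in> S" "Q \<subseteq> N r"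
  shows "admissible (S - {r}) (scale Q \<phi>)"
  unfolding admissible_def
proof
  fix v assume v: "v \<in> S - {r}"
  obtain a where a: "\<phi> v = fld v * \<kappa> ^ a" "a + card (N v \<inter> S) \<le> card (N v)"
    using assms(1) v unfolding admissible_def by blast
  show "\<exists>a. scale Q \<phi> v = fld v * \<kappa> ^ a \<and> a + card (N v \<inter> (S - {r})) \<le> card (N v)"
  proof (cases "v \<in> Q")
    case True
    then have "r \<in> N v" using assms(3) N_sym by blast
    then show ?thesis using True a card_N_remove[OF assms(2), of v]
      by (intro exI[of _ "Suc a"]) (simp add: scale_def)
  next
    case False
    have "card (N v \<inter> (S - {r})) \<le> card (N v \<inter> S)" using finite_N by (intro card_mono) auto
    then show ?thesis using False a by (intro exI[of _ a]) (simp add: scale_def)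
  qed
qed

text \<open>If r is removed while its neighbour u gets no factor \<kappa>, then r acts on u as a 0,
  and the count drops without compensation.\<close>

lemma slack_scale:
  assumes "admissible S \<phi>" "r \<in> S" "u \<in> S" "u \<in> N r" "u \<notin> Q"
  shows "slack (S - {r}) (scale Q \<phi>) u"
proof -
  obtain a where a: "\<phi> u = fld u * \<kappa> ^ a" "a + card (N u \<inter> S) \<le> card (N u)"
    using assms unfolding admissible_def by blast
  have "r \<in> N u" using assms(4) N_sym by blast
  then show ?thesis using a card_N_remove[OF assms(2), of u] assms(5)
    unfolding slack_def by (intro exI[of _ a]) (simp add: scale_def)
qed

lemma influence_recursion:
  assumes "finite S" "r \<in> S" "admissible S \<phi>"
  obtains \<rho> \<psi> where "\<forall>u\<in>N r \<inter> S. \<rho> u \<ge> 0"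
    "ratio S \<phi> r = \<phi> r * (\<Prod>u\<in>N r \<inter> S. (1 + \<kappa> * \<rho> u) / (1 + \<rho> u))"
    "\<forall>u\<in>N r \<inter> S. admissible (S - {r}) (\<psi> u) \<and> slack (S - {r}) (\<psi> u) u \<and>
      \<rho> u = ratio (S - {r}) (\<psi> u) u"
    "(\<Sum>v\<in>S. \<bar>infl S \<phi> r v\<bar>) \<le>
      1 + (\<Sum>u\<in>N r \<inter> S. sens \<kappa> (\<rho> u) * (\<Sum>v\<in>S - {r}. \<bar>infl (S - {r}) (\<psi> u) u v\<bar>))"
proof -
  let ?S = "S - {r}" and ?T = "N r \<inter> S"
  have T: "finite ?T" "?T \<subseteq> ?S" using finite_N N_irrefl by auto
  have nn: "\<forall>v\<in>?S. \<phi> v \<ge> 0" using admissible_nonneg[OF assms(3)] by auto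
  have c: "scale (N r) \<phi> v = scale ?T \<phi> v" if "v \<in> ?S" for v using that by (auto simp: scale_def)
  obtain Q where Q: "\<forall>u\<in>?T. Q u \<subseteq> ?T - {u}"
    "Z ?S (scale ?T \<phi>) = Z ?S \<phi> *
      (\<Prod>u\<in>?T. (1 + \<kappa> * ratio ?S (scale (Q u) \<phi>) u) / (1 + ratio ?S (scale (Q u) \<phi>) u))"
    "\<And>v. \<bar>marg ?S (scale ?T \<phi>) v - marg ?S \<phi> v\<bar> \<le>
      (\<Sum>u\<in>?T. sens \<kappa> (ratio ?S (scale (Q u) \<phi>) u) * \<bar>infl ?S (scale (Q u) \<phi>) u v\<bar>)"
    using pin_one_by_one[OF _ nn T] assms(1) by auto
  define \<psi> where "\<psi> u = scale (Q u) \<phi>" for u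
  define \<rho> where "\<rho> u = ratio ?S (\<psi> u) u" for u
  have adm: "admissible ?S (\<psi> u)" "slack ?S (\<psi> u) u" if "u \<in> ?T" for u
    unfolding \<psi>_def using admissible_scale[OF assms(3,2), of "Q u"] Q(1) that
      slack_scale[OF assms(3,2), of u "Q u"] by blast+
  show ?thesis
  proof (rule that[of \<rho> \<psi>])
    show "\<forall>u\<in>?T. \<rho> u \<ge> 0"
    proof
      fix u assume u: "u \<in> ?T"
      show "\<rho> u \<ge> 0" unfolding \<rho>_def
        using ratio_nonneg[OF _ admissible_nonneg[OF adm(1)[OF u]]] assms(1) u T by blast
    qed
    have "Z ?S \<phi> > 0" using Z_pos[OF _ nn] assms(1) by simp
    moreover have "Z ?S (scale (N r) \<phi>) = Z ?S (scale ?T \<phi>)" by (rule Z_cong) (rule c)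
    ultimately show "ratio S \<phi> r = \<phi> r * (\<Prod>u\<in>?T. (1 + \<kappa> * \<rho> u) / (1 + \<rho> u))"
      unfolding ratio_def[of S] Q(2) \<rho>_def \<psi>_def by simp
    show "\<forall>u\<in>?T. admissible ?S (\<psi> u) \<and> slack ?S (\<psi> u) u \<and> \<rho> u = ratio ?S (\<psi> u) u"
      using adm by (simp add: \<rho>_def)
    have "(\<Sum>v\<in>S. \<bar>infl S \<phi> r v\<bar>) = 1 + (\<Sum>v\<in>?S. \<bar>infl S \<phi> r v\<bar>)"
      using assms(1,2) by (simp add: sum.remove infl_def)
    also have "(\<Sum>v\<in>?S. \<bar>infl S \<phi> r v\<bar>) \<le> (\<Sum>v\<in>?S. \<Sum>u\<in>?T. sens \<kappa> (\<rho> u) * \<bar>infl ?S (\<psi> u) u v\<bar>)"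
    proof (intro sum_mono)
      fix v assume "v \<in> ?S"
      then have "infl S \<phi> r v = marg ?S (scale ?T \<phi>) v - marg ?S \<phi> v"
        using marg_cong[of ?S "scale (N r) \<phi>" "scale ?T \<phi>" v] c by (simp add: infl_def)
      then show "\<bar>infl S \<phi> r v\<bar> \<le> (\<Sum>u\<in>?T. sens \<kappa> (\<rho> u) * \<bar>infl ?S (\<psi> u) u v\<bar>)"
        using Q(3)[of v] by (simp add: \<rho>_def \<psi>_def)
    qed
    also have "\<dots> = (\<Sum>u\<in>?T. sens \<kappa> (\<rho> u) * (\<Sum>v\<in>?S. \<bar>infl ?S (\<psi> u) u v\<bar>))"
      unfolding sum_distrib_left by (rule sum.swap)
    finally show "(\<Sum>v\<in>S. \<bar>infl S \<phi> r v\<bar>) \<le>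
      1 + (\<Sum>u\<in>?T. sens \<kappa> (\<rho> u) * (\<Sum>v\<in>?S. \<bar>infl ?S (\<psi> u) u v\<bar>))" by simp
  qed
qed

text \<open>The potential function argument: weighting the total influence of a vertex by the square root
  of its sensitivity turns the recursion into a contraction.\<close>

lemma weighted_influence_le:
  assumes "finite S" "S \<subseteq> V" "r \<in> S" "admissible S \<phi>" "slack S \<phi> r"
  shows "sqrt (sens \<kappa> (ratio S \<phi> r)) * (\<Sum>v\<in>S. \<bar>infl S \<phi> r v\<bar>) \<le> 1 / (1 - q)"
  using assms
proof (induction "card S" arbitrary: S \<phi> r rule: less_induct)
  case less
  let ?S = "S - {r}" and ?T = "N r \<inter> S" and ?K = "1 / (1 - q)"
  obtain \<rho> \<psi> where \<rho>: "\<forall>u\<in>?T. \<rho> u \<ge> 0"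
    "ratio S \<phi> r = \<phi> r * (\<Prod>u\<in>?T. (1 + \<kappa> * \<rho> u) / (1 + \<rho> u))"
    "\<forall>u\<in>?T. admissible ?S (\<psi> u) \<and> slack ?S (\<psi> u) u \<and> \<rho> u = ratio ?S (\<psi> u) u"
    "(\<Sum>v\<in>S. \<bar>infl S \<phi> r v\<bar>) \<le>
      1 + (\<Sum>u\<in>?T. sens \<kappa> (\<rho> u) * (\<Sum>v\<in>?S. \<bar>infl ?S (\<psi> u) u v\<bar>))"
    by (rule influence_recursion[OF less.prems(1,3,4)]) (rule that)
  obtain a where a: "\<phi> r = fld r * \<kappa> ^ a" "a + card ?T < card (N r)"
    using less.prems(5) unfolding slack_def by blast
  let ?w = "sqrt (sens \<kappa> (ratio S \<phi> r))"
  have R: "ratio S \<phi> r \<ge> 0"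
    using ratio_nonneg[OF less.prems(1) admissible_nonneg[OF less.prems(4)] less.prems(3)] .
  have w: "0 \<le> ?w" "?w \<le> 1" using sens_nonneg[OF \<kappa>_nonneg \<kappa>_less R] sens_le_1[OF \<kappa>_nonneg \<kappa>_less R] by auto
  \<comment> \<open>\<open>sens\<close> is split into two equal square roots: one is the weight in
    the induction hypothesis, the other is left for \<open>contraction\<close>.\<close>
  have "sens \<kappa> (\<rho> u) * (\<Sum>v\<in>?S. \<bar>infl ?S (\<psi> u) u v\<bar>) \<le> sqrt (sens \<kappa> (\<rho> u)) * ?K" if u: "u \<in> ?T" for u
  proof -
    have s: "sens \<kappa> (\<rho> u) \<ge> 0" using sens_nonneg[OF \<kappa>_nonneg \<kappa>_less] \<rho>(1) u by auto
    have "u \<in> ?S" using u N_irrefl by auto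
    moreover have "card ?S < card S" using less.prems by (intro psubset_card_mono) auto
    ultimately have "sqrt (sens \<kappa> (ratio ?S (\<psi> u) u)) * (\<Sum>v\<in>?S. \<bar>infl ?S (\<psi> u) u v\<bar>) \<le> ?K"
      using less.hyps[of ?S u "\<psi> u"] bspec[OF \<rho>(3) u] less.prems by auto
    then have "sqrt (sens \<kappa> (\<rho> u)) * (sqrt (sens \<kappa> (\<rho> u)) * (\<Sum>v\<in>?S. \<bar>infl ?S (\<psi> u) u v\<bar>))
        \<le> sqrt (sens \<kappa> (\<rho> u)) * ?K"
      using bspec[OF \<rho>(3) u] s by (intro mult_left_mono) auto
    then show ?thesis using s by (simp flip: mult.assoc)
  qed
  then have "(\<Sum>u\<in>?T. sens \<kappa> (\<rho> u) * (\<Sum>v\<in>?S. \<bar>infl ?S (\<psi> u) u v\<bar>)) \<le>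
      (\<Sum>u\<in>?T. sqrt (sens \<kappa> (\<rho> u)) * ?K)"
    by (rule sum_mono)
  then have "(\<Sum>v\<in>S. \<bar>infl S \<phi> r v\<bar>) \<le> 1 + (\<Sum>u\<in>?T. sqrt (sens \<kappa> (\<rho> u)) * ?K)"
    using \<rho>(4) by linarith
  then have "?w * (\<Sum>v\<in>S. \<bar>infl S \<phi> r v\<bar>) \<le> ?w * (1 + (\<Sum>u\<in>?T. sqrt (sens \<kappa> (\<rho> u)) * ?K))"
    using w by (intro mult_left_mono)
  also have "\<dots> = ?w + (?w * (\<Sum>u\<in>?T. sqrt (sens \<kappa> (\<rho> u)))) * ?K"
    by (simp add: sum_distrib_right sum_distrib_left algebra_simps)
  \<comment> \<open>The bound 1 / (1 - q) is the solution of K = 1 + q K, so the induction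
    closes.\<close>
  also have "\<dots> \<le> 1 + q * ?K"
  proof (intro add_mono mult_right_mono)
    have "r \<in> V" using less.prems by auto
    then show "?w * (\<Sum>u\<in>?T. sqrt (sens \<kappa> (\<rho> u))) \<le> q"
      using contraction[of r ?T a \<rho>] a \<rho>(1) finite_N unfolding \<rho>(2) a(1) by (simp add: add.commute)
  qed (use w q_less in auto)
  also have "\<dots> = ?K" using q_less by (simp add: field_simps)
  finally show ?case .
qed

text \<open>The root itself may lack slack, so its first level is unfolded without contraction. Each
  of its at most \<Delta> children has slack and costs at most 1 / (1 - q), because
  \<open>sens\<close> is at most 1.\<close>

lemma total_influence_le:
  assumes "S \<subseteq> V" "r \<in> S" "admissible S \<phi>" "card (N r) \<le> \<Delta>"
  shows "(\<Sum>v\<in>S. \<bar>infl S \<phi> r v\<bar>) \<le> 1 + \<Delta> / (1 - q)"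
proof -
  have fin: "finite S" using assms finite_V finite_subset by blast
  let ?S = "S - {r}" and ?T = "N r \<inter> S" and ?K = "1 / (1 - q)"
  obtain \<rho> \<psi> where \<rho>: "\<forall>u\<in>?T. \<rho> u \<ge> 0"
    "ratio S \<phi> r = \<phi> r * (\<Prod>u\<in>?T. (1 + \<kappa> * \<rho> u) / (1 + \<rho> u))"
    "\<forall>u\<in>?T. admissible ?S (\<psi> u) \<and> slack ?S (\<psi> u) u \<and> \<rho> u = ratio ?S (\<psi> u) u"
    "(\<Sum>v\<in>S. \<bar>infl S \<phi> r v\<bar>) \<le>
      1 + (\<Sum>u\<in>?T. sens \<kappa> (\<rho> u) * (\<Sum>v\<in>?S. \<bar>infl ?S (\<psi> u) u v\<bar>))"
    by (rule influence_recursion[OF fin assms(2,3)]) (rule that)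
  have "sens \<kappa> (\<rho> u) * (\<Sum>v\<in>?S. \<bar>infl ?S (\<psi> u) u v\<bar>) \<le> ?K" if u: "u \<in> ?T" for u
  proof -
    have s: "0 \<le> sens \<kappa> (\<rho> u)" "sens \<kappa> (\<rho> u) \<le> 1"
      using sens_nonneg[OF \<kappa>_nonneg \<kappa>_less] sens_le_1[OF \<kappa>_nonneg \<kappa>_less] \<rho>(1) u by auto
    have "u \<in> ?S" using u N_irrefl by auto
    then have "sqrt (sens \<kappa> (\<rho> u)) * (\<Sum>v\<in>?S. \<bar>infl ?S (\<psi> u) u v\<bar>) \<le> ?K"
      using weighted_influence_le[of ?S u "\<psi> u"] bspec[OF \<rho>(3) u] fin assms by auto
    then have "sqrt (sens \<kappa> (\<rho> u)) * (sqrt (sens \<kappa> (\<rho> u)) * (\<Sum>v\<in>?S. \<bar>infl ?S (\<psi> u) u v\<bar>))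
        \<le> 1 * ?K"
      using s by (intro mult_mono) (simp_all add: sum_nonneg)
    then show ?thesis using s by (simp flip: mult.assoc)
  qed
  then have "(\<Sum>u\<in>?T. sens \<kappa> (\<rho> u) * (\<Sum>v\<in>?S. \<bar>infl ?S (\<psi> u) u v\<bar>)) \<le> card ?T * ?K"
    by (intro sum_bounded_above)
  also have "\<dots> \<le> \<Delta> * ?K"
  proof (intro mult_right_mono)
    have "card ?T \<le> card (N r)" using finite_N by (intro card_mono) auto
    then show "real (card ?T) \<le> \<Delta>" using assms by simp
  qed (use q_less in simp)
  finally show ?thesis using \<rho>(4) by simp
qed

end

section \<open>Weighted variances\<close>

text \<open>The variance multiplied by the total mass, so that variances over fibres add up without
  reweighting. For nonnegative weights of total mass 0 the convention x / 0 = 0 yields the value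
  0.\<close>

definition wvar :: "'b set \<Rightarrow> ('b \<Rightarrow> real) \<Rightarrow> ('b \<Rightarrow> real) \<Rightarrow> real" where
  "wvar X w f = (\<Sum>x\<in>X. w x * (f x)\<^sup>2) - (\<Sum>x\<in>X. w x * f x)\<^sup>2 / (\<Sum>x\<in>X. w x)"

lemma sum_weights_zero:
  fixes w :: "'b \<Rightarrow> real"
  assumes "finite X" "\<forall>x\<in>X. w x \<ge> 0" "(\<Sum>x\<in>X. w x) = 0"
  shows "(\<Sum>x\<in>X. w x * g x) = 0"
  using assms by (intro sum.neutral ballI) (simp add: sum_nonneg_eq_0_iff)

lemma sum_sq_shift:
  fixes w :: "'b \<Rightarrow> real"
  shows "(\<Sum>x\<in>X. w x * (f x - c)\<^sup>2)
    = (\<Sum>x\<in>X. w x * (f x)\<^sup>2) - 2 * c * (\<Sum>x\<in>X. w x * f x) + c\<^sup>2 * (\<Sum>x\<in>X. w x)"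
  by (simp add: power2_diff sum_distrib_left sum_distrib_right sum_subtractf sum.distrib algebra_simps)

lemma wvar_le:
  assumes "finite X" "\<forall>x\<in>X. w x \<ge> 0"
  shows "wvar X w f \<le> (\<Sum>x\<in>X. w x * (f x - c)\<^sup>2)"
proof (cases "(\<Sum>x\<in>X. w x) = 0")
  case True
  then show ?thesis unfolding wvar_def using sum_weights_zero[OF assms] by simp
next
  case False
  let ?W = "\<Sum>x\<in>X. w x" and ?m = "\<Sum>x\<in>X. w x * f x"
  have W: "?W > 0" using False sum_nonneg[of X w] assms by fastforce
  have "0 \<le> (?m - c * ?W)\<^sup>2 / ?W" using W by simp
  also have "(?m - c * ?W)\<^sup>2 / ?W = ?m\<^sup>2 / ?W - 2 * c * ?m + c\<^sup>2 * ?W"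
    using W by (simp add: field_simps power2_eq_square)
  finally show ?thesis unfolding sum_sq_shift wvar_def by linarith
qed

lemma wvar_eq:
  assumes "finite X" "\<forall>x\<in>X. w x \<ge> 0"
  shows "wvar X w f = (\<Sum>x\<in>X. w x * (f x - (\<Sum>x\<in>X. w x * f x) / (\<Sum>x\<in>X. w x))\<^sup>2)"
proof (cases "(\<Sum>x\<in>X. w x) = 0")
  case True
  then show ?thesis unfolding wvar_def using sum_weights_zero[OF assms] by simp
next
  case False
  then show ?thesis unfolding sum_sq_shift wvar_def by (simp add: field_simps power2_eq_square)
qed

lemma wvar_nonneg:
  assumes "finite X" "\<forall>x\<in>X. w x \<ge> 0"
  shows "wvar X w f \<ge> 0"
  unfolding wvar_eq[OF assms] using assms by (intro sum_nonneg) auto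

lemma wvar_cmult: "wvar X (\<lambda>x. c * w x) f = c * wvar X w f"
  unfolding wvar_def by (simp add: sum_distrib_left[symmetric] mult.assoc power_mult_distrib
      right_diff_distrib power2_eq_square)

lemma wvar_reindex:
  assumes "inj_on h X"
  shows "wvar (h ` X) w f = wvar X (\<lambda>x. w (h x)) (\<lambda>x. f (h x))"
  unfolding wvar_def by (simp add: sum.reindex[OF assms])

lemma wvar_cong:
  assumes "\<And>x. x \<in> X \<Longrightarrow> w x = w' x" "\<And>x. x \<in> X \<Longrightarrow> f x = f' x"
  shows "wvar X w f = wvar X w' f'"
  unfolding wvar_def using assms by (simp cong: sum.cong)

text \<open>The law of total variance for two blocks. The variance between the block means is the
  squared length of the projection of f onto the centred indicator of Y; in this form it can be
  summed over many different splittings.\<close>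

lemma wvar_split:
  fixes w f :: "'b \<Rightarrow> real"
  assumes "finite X" "finite Y" "X \<inter> Y = {}" "\<forall>x\<in>X \<union> Y. w x \<ge> 0"
  defines "\<xi> \<equiv> \<lambda>x. of_bool (x \<in> Y) - (\<Sum>x\<in>Y. w x) / (\<Sum>x\<in>X \<union> Y. w x)"
  shows "wvar (X \<union> Y) w f - wvar X w f - wvar Y w f
    = (\<Sum>x\<in>X \<union> Y. w x * f x * \<xi> x)\<^sup>2 / (\<Sum>x\<in>X \<union> Y. w x * \<xi> x * \<xi> x)"
proof -
  let ?P = "\<Sum>x\<in>X. w x" and ?Q = "\<Sum>x\<in>Y. w x"
  let ?x = "\<Sum>x\<in>X. w x * f x" and ?y = "\<Sum>x\<in>Y. w x * f x"
  let ?W = "?P + ?Q" and ?p = "?Q / (?P + ?Q)"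
  have un: "sum g (X \<union> Y) = sum g X + sum g Y" for g :: "'b \<Rightarrow> real"
    using assms by (simp add: sum.union_disjoint)
  have W01: "?P \<ge> 0" "?Q \<ge> 0" using assms(4) by (intro sum_nonneg; simp)+
  define p where "p = ?p"
  have \<xi>: "\<xi> x = - p" if "x \<in> X" for x using that assms(3) unfolding \<xi>_def un p_def by auto
  have \<xi>': "\<xi> x = 1 - p" if "x \<in> Y" for x using that unfolding \<xi>_def un p_def by auto
  have f\<xi>: "(\<Sum>x\<in>X \<union> Y. w x * f x * \<xi> x) = - p * ?x + (1 - p) * ?y"
    unfolding un sum_distrib_left by (intro arg_cong2[of _ _ _ _ "(+)"] sum.cong refl) (simp_all add: \<xi> \<xi>' mult_ac)
  have \<xi>\<xi>: "(\<Sum>x\<in>X \<union> Y. w x * \<xi> x * \<xi> x) = p * p * ?P + (1 - p) * (1 - p) * ?Q"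
    unfolding un sum_distrib_left by (intro arg_cong2[of _ _ _ _ "(+)"] sum.cong refl) (simp_all add: \<xi> \<xi>' mult_ac)
  have L: "wvar (X \<union> Y) w f - wvar X w f - wvar Y w f
    = ?x\<^sup>2 / ?P + ?y\<^sup>2 / ?Q - (?x + ?y)\<^sup>2 / ?W"
    unfolding wvar_def un by simp
  show ?thesis
  proof (cases "?P = 0 \<or> ?Q = 0")
    case True
    have "?x = 0" if "?P = 0" using sum_weights_zero[OF assms(1) _ that] assms(4) by blast
    moreover have "?y = 0" if "?Q = 0" using sum_weights_zero[OF assms(2) _ that] assms(4) by blast
    ultimately show ?thesis unfolding L f\<xi> \<xi>\<xi> p_def using True by auto
  next
    case False
    then have pos: "?P > 0" "?Q > 0" using W01 by auto
    obtain s t a b where eqs: "?P = s" "?Q = t" "?x = a" "?y = b" by blast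
    have st: "s > 0" "t > 0" using pos eqs by auto
    have "a\<^sup>2 / s + b\<^sup>2 / t - (a + b)\<^sup>2 / (s + t) = (b * s - a * t)\<^sup>2 / (s * t * (s + t))"
      using st by (simp add: divide_simps add_pos_pos) (simp add: algebra_simps power2_eq_square)
    moreover have "- (t / (s + t)) * a + (1 - t / (s + t)) * b = (b * s - a * t) / (s + t)"
    proof -
      have "1 - t / (s + t) = s / (s + t)" using st by (simp add: field_simps)
      then show ?thesis by (simp add: diff_divide_distrib mult.commute)
    qed
    moreover have "t / (s + t) * (t / (s + t)) * s + (1 - t / (s + t)) * (1 - t / (s + t)) * t
        = s * t / (s + t)"
    proof -
      have "1 - t / (s + t) = s / (s + t)" using st by (simp add: field_simps)
      then show ?thesis using st by (simp add: divide_simps) (simp add: algebra_simps)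
    qed
    moreover have "((b * s - a * t) / (s + t))\<^sup>2 / (s * t / (s + t)) = (b * s - a * t)\<^sup>2 / (s * t * (s + t))"
      using st by (simp add: power_divide power2_eq_square)
    ultimately show ?thesis unfolding L f\<xi> \<xi>\<xi> p_def eqs by simp
  qed
qed

text \<open>Bessel's inequality with loss H, for vectors whose Gram matrix has row sums at most H
  times the diagonal. Let g be the sum of the projections of f onto the single vectors. The row
  bound gives |g|^2 \<le> H <f, g>, and then 0 \<le> |H f - g|^2 gives <f, g> \<le> H |f|^2, where
  <f, g> is the sum to be bounded.\<close>

lemma almost_orthogonal:
  fixes w f :: "'b \<Rightarrow> real" and \<xi> :: "'a \<Rightarrow> 'b \<Rightarrow> real"
  assumes "finite I" "finite X" "\<forall>x\<in>X. w x \<ge> 0" "H > 0"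
    and rows: "\<And>u. u \<in> I \<Longrightarrow>
      (\<Sum>v\<in>I. \<bar>\<Sum>x\<in>X. w x * \<xi> u x * \<xi> v x\<bar>) \<le> H * (\<Sum>x\<in>X. w x * \<xi> u x * \<xi> u x)"
  shows "(\<Sum>v\<in>I. (\<Sum>x\<in>X. w x * f x * \<xi> v x)\<^sup>2 / (\<Sum>x\<in>X. w x * \<xi> v x * \<xi> v x))
    \<le> H * (\<Sum>x\<in>X. w x * (f x)\<^sup>2)"
proof -
  define ip where "ip = (\<lambda>g h. \<Sum>x\<in>X. w x * g x * h x)"
  define c where "c = (\<lambda>v. ip f (\<xi> v) / ip (\<xi> v) (\<xi> v))"
  define g where "g = (\<lambda>x. \<Sum>v\<in>I. c v * \<xi> v x)"
  define L where "L = (\<Sum>v\<in>I. c v * ip f (\<xi> v))"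
  have ip_nonneg: "ip h h \<ge> 0" for h
    unfolding ip_def using assms(3) by (intro sum_nonneg) (simp add: mult.assoc)
  have sym: "ip h k = ip k h" for h k unfolding ip_def by (simp add: mult_ac)
  have zero: "ip f (\<xi> v) = 0" if "ip (\<xi> v) (\<xi> v) = 0" for v
  proof -
    have "w x * \<xi> v x * \<xi> v x = 0" if "x \<in> X" for x
      using \<open>ip (\<xi> v) (\<xi> v) = 0\<close> that assms(2,3) unfolding ip_def
      by (subst (asm) sum_nonneg_eq_0_iff) (auto simp: mult.assoc)
    then show ?thesis unfolding ip_def by (intro sum.neutral) auto
  qed
  have cc: "(c v)\<^sup>2 * ip (\<xi> v) (\<xi> v) = c v * ip f (\<xi> v)" for v
    using zero[of v] unfolding c_def by (cases "ip (\<xi> v) (\<xi> v) = 0") (simp_all add: power2_eq_square)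
  have ipg: "ip h g = (\<Sum>v\<in>I. c v * ip h (\<xi> v))" for h
    unfolding ip_def g_def sum_distrib_left by (subst sum.swap) (simp add: mult_ac)
  have "ip g g = (\<Sum>u\<in>I. \<Sum>v\<in>I. c u * c v * ip (\<xi> u) (\<xi> v))"
    unfolding ipg[of g] sym[of g] ipg sum_distrib_left by (simp add: mult_ac sym)
  also have "\<dots> \<le> (\<Sum>u\<in>I. \<Sum>v\<in>I. ((c u)\<^sup>2 / 2 + (c v)\<^sup>2 / 2) * \<bar>ip (\<xi> u) (\<xi> v)\<bar>)"
  proof (intro sum_mono)
    fix u v
    have "c u * c v * ip (\<xi> u) (\<xi> v) \<le> \<bar>c u * c v\<bar> * \<bar>ip (\<xi> u) (\<xi> v)\<bar>"
      by (metis abs_ge_self abs_mult)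
    also have "\<bar>c u * c v\<bar> \<le> (c u)\<^sup>2 / 2 + (c v)\<^sup>2 / 2"
      using sum_squares_bound[of "\<bar>c u\<bar>" "\<bar>c v\<bar>"] by (simp add: abs_mult)
    finally show "c u * c v * ip (\<xi> u) (\<xi> v) \<le> ((c u)\<^sup>2 / 2 + (c v)\<^sup>2 / 2) * \<bar>ip (\<xi> u) (\<xi> v)\<bar>"
      by (simp add: mult_right_mono)
  qed
  also have "\<dots> = (\<Sum>u\<in>I. \<Sum>v\<in>I. (c u)\<^sup>2 / 2 * \<bar>ip (\<xi> u) (\<xi> v)\<bar>)
      + (\<Sum>u\<in>I. \<Sum>v\<in>I. (c v)\<^sup>2 / 2 * \<bar>ip (\<xi> u) (\<xi> v)\<bar>)"
    by (simp add: distrib_right sum.distrib)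
  also have "(\<Sum>u\<in>I. \<Sum>v\<in>I. (c v)\<^sup>2 / 2 * \<bar>ip (\<xi> u) (\<xi> v)\<bar>)
      = (\<Sum>u\<in>I. \<Sum>v\<in>I. (c u)\<^sup>2 / 2 * \<bar>ip (\<xi> u) (\<xi> v)\<bar>)"
    by (subst sum.swap) (simp add: sym)
  also have "(\<Sum>u\<in>I. \<Sum>v\<in>I. (c u)\<^sup>2 / 2 * \<bar>ip (\<xi> u) (\<xi> v)\<bar>) + \<dots>
      = (\<Sum>u\<in>I. (c u)\<^sup>2 * (\<Sum>v\<in>I. \<bar>ip (\<xi> u) (\<xi> v)\<bar>))"
    by (simp add: sum_distrib_left mult.commute flip: sum.distrib)
  also have "\<dots> \<le> (\<Sum>u\<in>I. (c u)\<^sup>2 * (H * ip (\<xi> u) (\<xi> u)))"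
    using rows by (intro sum_mono mult_left_mono) (auto simp: ip_def)
  also have "\<dots> = (\<Sum>u\<in>I. H * ((c u)\<^sup>2 * ip (\<xi> u) (\<xi> u)))" by (simp add: mult_ac)
  also have "\<dots> = H * L" unfolding L_def sum_distrib_left cc ..
  finally have gg: "ip g g \<le> H * L" .
  have "0 \<le> ip (\<lambda>x. H * f x - g x) (\<lambda>x. H * f x - g x)" by (rule ip_nonneg)
  also have "\<dots> = H * H * ip f f - 2 * H * ip f g + ip g g"
    unfolding ip_def by (simp add: algebra_simps sum.distrib sum_subtractf sum_distrib_left)
  also have "ip f g = L" unfolding ipg L_def ..
  finally have "H * L \<le> H * (H * ip f f)" using gg by (simp add: algebra_simps)
  then have "L \<le> H * ip f f" using assms(4) by simp
  moreover have "L = (\<Sum>v\<in>I. (ip f (\<xi> v))\<^sup>2 / ip (\<xi> v) (\<xi> v))"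
    unfolding L_def c_def by (simp add: power2_eq_square)
  ultimately show ?thesis unfolding ip_def by (simp add: power2_eq_square mult.assoc)
qed

lemma sum_Pow_Un:
  fixes h :: "'b set \<Rightarrow> real"
  assumes "finite P" "finite Q" "P \<inter> Q = {}"
  shows "(\<Sum>A\<in>Pow (P \<union> Q). h A) = (\<Sum>C\<in>Pow P. \<Sum>B\<in>Pow Q. h (C \<union> B))"
proof -
  have "(\<Sum>A\<in>Pow (P \<union> Q). h A) = (\<Sum>x\<in>Pow P \<times> Pow Q. h (fst x \<union> snd x))"
    using assms(3)
    by (intro sum.reindex_bij_witness[of _ "\<lambda>x. fst x \<union> snd x" "\<lambda>A. (A \<inter> P, A \<inter> Q)"])
      (auto simp flip: Int_Un_distrib intro!: arg_cong[of _ _ h])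
  then show ?thesis by (simp add: sum.cartesian_product case_prod_beta)
qed

lemma wvar_shift:
  assumes "finite X" "\<forall>x\<in>X. w x \<ge> 0" "(\<Sum>x\<in>X. w x) > 0"
  shows "(\<Sum>x\<in>X. w x * (f x - c)\<^sup>2)
    = wvar X w f + ((\<Sum>x\<in>X. w x * f x) - c * (\<Sum>x\<in>X. w x))\<^sup>2 / (\<Sum>x\<in>X. w x)"
  unfolding sum_sq_shift wvar_def using assms(3) by (simp add: field_simps power2_eq_square)

text \<open>The Efron-Stein inequality for two independent blocks. For fixed y, the spread of f
  around the overall mean c is the variance in x plus the squared distance of the x-mean from c.
  This distance is the x-average of f x y - m x, so Jensen bounds its square by the deviations
  within the Y-fibres.\<close>

lemma wvar_product:
  assumes "finite X" "finite Y" "\<forall>x\<in>X. w1 x \<ge> 0" "\<forall>y\<in>Y. w2 y \<ge> 0"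
  shows "wvar (X \<times> Y) (\<lambda>p. w1 (fst p) * w2 (snd p)) (\<lambda>p. f (fst p) (snd p))
    \<le> (\<Sum>y\<in>Y. w2 y * wvar X w1 (\<lambda>x. f x y)) + (\<Sum>x\<in>X. w1 x * wvar Y w2 (f x))"
proof (cases "(\<Sum>x\<in>X. w1 x) = 0")
  case True
  then have "\<forall>x\<in>X. w1 x = 0" using assms by (simp add: sum_nonneg_eq_0_iff)
  then have "(\<Sum>p\<in>X \<times> Y. w1 (fst p) * h p) = 0" for h
    by (intro sum.neutral) auto
  then have "wvar (X \<times> Y) (\<lambda>p. w1 (fst p) * w2 (snd p)) (\<lambda>p. f (fst p) (snd p)) = 0"
    by (simp add: wvar_def mult.assoc)
  also have "0 \<le> (\<Sum>y\<in>Y. w2 y * wvar X w1 (\<lambda>x. f x y)) + (\<Sum>x\<in>X. w1 x * wvar Y w2 (f x))"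
    using assms by (intro add_nonneg_nonneg sum_nonneg mult_nonneg_nonneg wvar_nonneg) auto
  finally show ?thesis .
next
  case False
  define W1 where "W1 = (\<Sum>x\<in>X. w1 x)"
  have W1: "W1 > 0" using False sum_nonneg[of X w1] assms unfolding W1_def by fastforce
  define m where "m = (\<lambda>x. (\<Sum>y\<in>Y. w2 y * f x y) / (\<Sum>y\<in>Y. w2 y))"
  define c where "c = (\<Sum>x\<in>X. w1 x * m x) / W1"
  have 1: "(\<Sum>x\<in>X. w1 x * (f x y - c)\<^sup>2) \<le> wvar X w1 (\<lambda>x. f x y) + (\<Sum>x\<in>X. w1 x * (f x y - m x)\<^sup>2)" for y
  proof -
    have "(\<Sum>x\<in>X. w1 x * (f x y - c)\<^sup>2) = wvar X w1 (\<lambda>x. f x y) + ((\<Sum>x\<in>X. w1 x * f x y) - c * W1)\<^sup>2 / W1"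
      using wvar_shift[OF assms(1,3)] W1 unfolding W1_def by simp
    also have "(\<Sum>x\<in>X. w1 x * f x y) - c * W1 = (\<Sum>x\<in>X. w1 x * (f x y - m x))"
      using W1 by (simp add: c_def right_diff_distrib sum_subtractf)
    also have "(\<Sum>x\<in>X. w1 x * (f x y - m x))\<^sup>2 / W1 \<le> (\<Sum>x\<in>X. w1 x * (f x y - m x)\<^sup>2)"
      using wvar_nonneg[OF assms(1,3), of "\<lambda>x. f x y - m x"] unfolding wvar_def W1_def by simp
    finally show ?thesis by simp
  qed
  have "wvar (X \<times> Y) (\<lambda>p. w1 (fst p) * w2 (snd p)) (\<lambda>p. f (fst p) (snd p))
      \<le> (\<Sum>p\<in>X \<times> Y. w1 (fst p) * w2 (snd p) * (f (fst p) (snd p) - c)\<^sup>2)"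
    using assms by (intro wvar_le) auto
  also have "\<dots> = (\<Sum>x\<in>X. \<Sum>y\<in>Y. w1 x * w2 y * (f x y - c)\<^sup>2)"
    by (simp add: sum.cartesian_product case_prod_beta)
  also have "\<dots> = (\<Sum>y\<in>Y. w2 y * (\<Sum>x\<in>X. w1 x * (f x y - c)\<^sup>2))"
    unfolding sum_distrib_left by (subst sum.swap) (simp add: mult_ac)
  also have "\<dots> \<le> (\<Sum>y\<in>Y. w2 y * (wvar X w1 (\<lambda>x. f x y) + (\<Sum>x\<in>X. w1 x * (f x y - m x)\<^sup>2)))"
    using 1 assms by (intro sum_mono mult_left_mono) auto
  also have "\<dots> = (\<Sum>y\<in>Y. w2 y * wvar X w1 (\<lambda>x. f x y)) + (\<Sum>y\<in>Y. \<Sum>x\<in>X. w2 y * (w1 x * (f x y - m x)\<^sup>2))"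
    by (simp add: distrib_left sum.distrib sum_distrib_left)
  also have "(\<Sum>y\<in>Y. \<Sum>x\<in>X. w2 y * (w1 x * (f x y - m x)\<^sup>2)) = (\<Sum>x\<in>X. w1 x * (\<Sum>y\<in>Y. w2 y * (f x y - m x)\<^sup>2))"
    unfolding sum_distrib_left by (subst sum.swap) (simp add: mult_ac)
  also have "\<dots> = (\<Sum>x\<in>X. w1 x * wvar Y w2 (f x))"
    unfolding wvar_eq[OF assms(2,4)] m_def ..
  finally show ?thesis .
qed

section \<open>Conditioning and spectral independence\<close>

context soft_hardcore
begin

text \<open>Ones in C act on the rest only by a factor \<kappa> per neighbour in C, so conditioning
  stays within the class of models.\<close>

lemma wt_Un:
  assumes "finite C" "finite B" "C \<inter> B = {}"
  shows "wt \<phi> (C \<union> B) = wt \<phi> C * wt (\<lambda>v. \<phi> v * \<kappa> ^ card (N v \<inter> C)) B"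
  using assms(1,3)
proof (induction C arbitrary: \<phi> rule: finite_induct)
  case empty
  then show ?case by (simp add: wt_empty)
next
  case (insert c C)
  have "scale (N c) \<phi> v * \<kappa> ^ card (N v \<inter> C) = \<phi> v * \<kappa> ^ card (N v \<inter> insert c C)" for v
    using insert N_sym[of v c] finite_N by (auto simp: scale_def Int_insert_right)
  then have "wt (scale (N c) \<phi>) (C \<union> B) = wt (scale (N c) \<phi>) C * wt (\<lambda>v. \<phi> v * \<kappa> ^ card (N v \<inter> insert c C)) B"
    using insert by simp
  then show ?case using insert assms(2) by (simp add: wt_insert)
qed

text \<open>Each summand is a variance between the blocks v = 0 and v = 1, hence a squared
  projection onto the centred spin of v. The covariances of these spins have row sums governed by
  the total influence, which is the hypothesis of \<open>almost_orthogonal\<close>.\<close>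

lemma spectral_independence:
  assumes "finite S" "\<forall>v\<in>S. \<phi> v \<ge> 0" "H > 0"
    and infl: "\<And>u. u \<in> S \<Longrightarrow> (\<Sum>v\<in>S. \<bar>infl S \<phi> u v\<bar>) \<le> H"
  shows "(\<Sum>v\<in>S. wvar (Pow S) (wt \<phi>) g - wvar (Pow (S - {v})) (wt \<phi>) g
      - wvar (insert v ` Pow (S - {v})) (wt \<phi>) g) \<le> H * wvar (Pow S) (wt \<phi>) g"
proof -
  let ?X = "Pow S" and ?w = "wt \<phi>"
  have fin: "finite ?X" using assms by simp
  have w: "\<forall>x\<in>?X. ?w x \<ge> 0" using assms by (auto intro!: wt_nonneg)
  have Z: "Z S \<phi> > 0" using Z_pos assms by blast
  define \<xi> where "\<xi> = (\<lambda>v A. of_bool (v \<in> A) - marg S \<phi> v)"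
  define m where "m = (\<Sum>x\<in>?X. ?w x * g x) / (\<Sum>x\<in>?X. ?w x)"
  define ip where "ip = (\<lambda>u v. \<Sum>x\<in>?X. ?w x * \<xi> u x * \<xi> v x)"
  have \<xi>0: "(\<Sum>x\<in>?X. ?w x * \<xi> v x) = 0" for v
  proof -
    have "(\<Sum>x\<in>?X. ?w x * \<xi> v x) = Z1 S \<phi> v - marg S \<phi> v * Z S \<phi>"
      unfolding \<xi>_def Z1_def Z_def
      by (simp add: right_diff_distrib sum_subtractf sum_distrib_left mult_ac)
    then show ?thesis using Z by (simp add: marg_def)
  qed
  \<comment> \<open>Covariance is the variance of u times the influence of u on v. Stated without
    division, this also covers a vertex u whose spin is deterministic.\<close>
  have ip_eq: "ip u v = ip u u * infl S \<phi> u v" if "u \<in> S" "v \<in> S" for u v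
  proof (cases "v = u")
    case False
    let ?S = "S - {u}" and ?R = "ratio S \<phi> u"
    have S: "S = insert u ?S" using that by auto
    have R: "1 + ?R > 0" using ratio_nonneg[OF assms(1,2) that(1)] by linarith
    have Z': "Z ?S \<phi> > 0" "Z ?S (scale (N u) \<phi>) > 0" using assms by (auto intro!: Z_pos simp: scale_nonneg)
    have ip1: "ip u v' = (\<Sum>x\<in>?X. of_bool (u \<in> x) * (of_bool (v' \<in> x) * ?w x)) - marg S \<phi> v' * Z1 S \<phi> u" for v'
    proof -
      have "ip u v' = (\<Sum>x\<in>?X. of_bool (u \<in> x) * (of_bool (v' \<in> x) * ?w x)) - marg S \<phi> v' * Z1 S \<phi> u
          - marg S \<phi> u * (\<Sum>x\<in>?X. ?w x * \<xi> v' x)"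
        unfolding ip_def Z1_def \<xi>_def sum_distrib_left sum_subtractf[symmetric]
        by (intro sum.cong refl) (simp only: algebra_simps)
      then show ?thesis using \<xi>0 by simp
    qed
    have Z1u: "Z1 S \<phi> u = ?R * Z ?S \<phi>"
      using Z1_insert_self[of ?S u \<phi>] assms(1) S Z' by (simp add: ratio_def)
    have "(\<Sum>x\<in>?X. of_bool (u \<in> x) * (of_bool (v \<in> x) * ?w x))
        = (\<Sum>x\<in>Pow ?S. of_bool (v \<in> insert u x) * ?w (insert u x))"
    proof -
      have "(\<Sum>x\<in>Pow ?S. of_bool (u \<in> x) * (of_bool (v \<in> x) * ?w x)) = 0"
        by (intro sum.neutral) auto
      moreover have "(\<Sum>x\<in>Pow ?S. of_bool (u \<in> insert u x) * (of_bool (v \<in> insert u x) * ?w (insert u x)))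
          = (\<Sum>x\<in>Pow ?S. of_bool (v \<in> insert u x) * ?w (insert u x))" by simp
      moreover have "(\<Sum>x\<in>Pow (insert u ?S). of_bool (u \<in> x) * (of_bool (v \<in> x) * ?w x)) =
          (\<Sum>x\<in>Pow ?S. of_bool (u \<in> x) * (of_bool (v \<in> x) * ?w x)) +
          (\<Sum>x\<in>Pow ?S. of_bool (u \<in> insert u x) * (of_bool (v \<in> insert u x) * ?w (insert u x)))"
        using assms(1) by (intro sum_Pow_insert) auto
      ultimately show ?thesis using S by (simp only: add_0)
    qed
    also have "\<dots> = \<phi> u * Z1 ?S (scale (N u) \<phi>) v"
      unfolding Z1_def sum_distrib_left using False wt_insert_Pow[of ?S u] assms(1)
      by (intro sum.cong refl) simp
    also have "\<dots> = ?R * Z ?S \<phi> * marg ?S (scale (N u) \<phi>) v"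
      using Z' by (simp add: ratio_def marg_def)
    finally have Z11: "(\<Sum>x\<in>?X. of_bool (u \<in> x) * (of_bool (v \<in> x) * ?w x)) = \<dots>" .
    have Z1uu: "(\<Sum>x\<in>?X. of_bool (u \<in> x) * (of_bool (u \<in> x) * ?w x)) = ?R * Z ?S \<phi>"
      unfolding Z1u[symmetric] Z1_def by (intro sum.cong) auto
    have mu: "marg S \<phi> u = ?R / (1 + ?R)" and mv: "marg S \<phi> v = marg ?S \<phi> v + ?R / (1 + ?R) * infl S \<phi> u v"
      using marg_ratio[OF assms(1,2) that(1), of u] marg_ratio[OF assms(1,2) that(1), of v] False
      by (simp_all add: infl_def)
    have iu: "marg ?S (scale (N u) \<phi>) v = infl S \<phi> u v + marg ?S \<phi> v" using False by (simp add: infl_def)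
    have one: "1 - ?R / (1 + ?R) = 1 / (1 + ?R)" using R by (simp add: field_simps)
    have "ip u u = ?R * Z ?S \<phi> * (1 - ?R / (1 + ?R))"
      unfolding ip1 Z1uu Z1u mu by (simp add: algebra_simps)
    moreover have "ip u v = ?R * Z ?S \<phi> * (infl S \<phi> u v * (1 - ?R / (1 + ?R)))"
      unfolding ip1 Z11 Z1u mv iu by (simp add: algebra_simps)
    ultimately show ?thesis by simp
  qed (simp add: infl_def)
  have ip_nonneg: "ip u u \<ge> 0" for u
    unfolding ip_def using w by (intro sum_nonneg) (simp add: mult.assoc)
  have "wvar ?X ?w g - wvar (Pow (S - {v})) ?w g - wvar (insert v ` Pow (S - {v})) ?w g
    = (\<Sum>x\<in>?X. ?w x * (g x - m) * \<xi> v x)\<^sup>2 / (\<Sum>x\<in>?X. ?w x * \<xi> v x * \<xi> v x)" if v: "v \<in> S" for v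
  proof -
    let ?P = "Pow (S - {v})" and ?Q = "insert v ` Pow (S - {v})"
    have X: "?X = ?P \<union> ?Q" using v by (metis Pow_insert insert_Diff)
    have disj: "?P \<inter> ?Q = {}" by auto
    have inj: "inj_on (insert v) ?P" by (auto intro!: inj_onI)
    have "(\<Sum>x\<in>?Q. ?w x) = (\<Sum>x\<in>?P. \<phi> v * wt (scale (N v) \<phi>) x)"
      unfolding sum.reindex[OF inj] comp_def using wt_insert_Pow[of "S - {v}" v] assms(1)
      by (intro sum.cong) auto
    also have "\<dots> = Z1 S \<phi> v"
      using Z1_insert_self[of "S - {v}" v \<phi>] assms(1) v
      by (simp add: insert_absorb Z_def sum_distrib_left)
    finally have "(\<Sum>x\<in>?Q. ?w x) / (\<Sum>x\<in>?P \<union> ?Q. ?w x) = marg S \<phi> v"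
      unfolding marg_def Z_def X by simp
    moreover have "of_bool (x \<in> ?Q) = (of_bool (v \<in> x) :: real)" if "x \<in> ?P \<union> ?Q" for x
      using that by auto
    moreover define \<eta> where
      "\<eta> x = of_bool (x \<in> ?Q) - (\<Sum>x\<in>?Q. ?w x) / (\<Sum>x\<in>?P \<union> ?Q. ?w x)" for x
    ultimately have \<xi>_eq: "\<eta> x = \<xi> v x" if "x \<in> ?X" for x
      using that unfolding \<xi>_def \<eta>_def X by simp
    have "wvar ?X ?w g - wvar ?P ?w g - wvar ?Q ?w g
      = (\<Sum>x\<in>?X. ?w x * g x * \<xi> v x)\<^sup>2 / (\<Sum>x\<in>?X. ?w x * \<xi> v x * \<xi> v x)"
      using wvar_split[of ?P ?Q ?w g, folded \<eta>_def] disj w assms(1)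
      unfolding X[symmetric] by (simp add: \<xi>_eq cong: sum.cong_simp)
    \<comment> \<open>As \<xi> v has mean 0, g may be centred here; this turns the second moment in
      the final bound into a variance.\<close>
    also have "(\<Sum>x\<in>?X. ?w x * g x * \<xi> v x) = (\<Sum>x\<in>?X. ?w x * (g x - m) * \<xi> v x)
        + m * (\<Sum>x\<in>?X. ?w x * \<xi> v x)"
      unfolding sum_distrib_left sum.distrib[symmetric]
      by (intro sum.cong refl) (simp only: algebra_simps)
    finally show ?thesis unfolding \<xi>0 by simp
  qed
  then have "(\<Sum>v\<in>S. wvar ?X ?w g - wvar (Pow (S - {v})) ?w g - wvar (insert v ` Pow (S - {v})) ?w g)
    = (\<Sum>v\<in>S. (\<Sum>x\<in>?X. ?w x * (g x - m) * \<xi> v x)\<^sup>2 / (\<Sum>x\<in>?X. ?w x * \<xi> v x * \<xi> v x))"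
    by (rule sum.cong[OF refl])
  also have "\<dots> \<le> H * (\<Sum>x\<in>?X. ?w x * (g x - m)\<^sup>2)"
  proof (rule almost_orthogonal[OF assms(1) fin w assms(3)])
    fix u assume u: "u \<in> S"
    have "(\<Sum>v\<in>S. \<bar>ip u v\<bar>) = (\<Sum>v\<in>S. ip u u * \<bar>infl S \<phi> u v\<bar>)"
      by (intro sum.cong refl) (metis ip_eq[OF u] abs_mult abs_of_nonneg ip_nonneg)
    also have "\<dots> \<le> ip u u * H"
      unfolding sum_distrib_left[symmetric] by (intro mult_left_mono infl u ip_nonneg)
    finally show "(\<Sum>v\<in>S. \<bar>\<Sum>x\<in>?X. ?w x * \<xi> u x * \<xi> v x\<bar>) \<le> H * (\<Sum>x\<in>?X. ?w x * \<xi> u x * \<xi> u x)"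
      unfolding ip_def by (simp add: mult.commute)
  qed
  also have "(\<Sum>x\<in>?X. ?w x * (g x - m)\<^sup>2) = wvar ?X ?w g"
    unfolding wvar_eq[OF fin w] m_def ..
  finally show ?thesis .
qed

end

section \<open>Local variances\<close>

locale energy = contracting V E \<kappa> fld q for V :: "'a set" and E \<kappa> fld q +
  fixes \<Delta> :: nat and M :: real
  assumes degree_le: "\<And>v. v \<in> V \<Longrightarrow> card (N v) \<le> \<Delta>" and fld_le: "\<And>v. fld v \<le> M"
begin

definition H :: real where "H = 1 + \<Delta> / (1 - q)"

lemma H_pos: "H > 0"
  unfolding H_def using q_less by (simp add: add_pos_nonneg)

lemma M_pos: "M > 0"
  using fld_pos fld_le less_le_trans by blast

definition W :: "'a set \<Rightarrow> real" where "W = wt fld"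

definition cond_fld :: "'a set \<Rightarrow> 'a \<Rightarrow> real" where
  "cond_fld C v = fld v * \<kappa> ^ card (N v \<inter> C)"

text \<open>Up to the partition function, the mean variance of \<open>f\<close> given the spins outside \<open>S\<close>.\<close>

definition en :: "'a set \<Rightarrow> ('a set \<Rightarrow> real) \<Rightarrow> real" where
  "en S f = (\<Sum>C\<in>Pow (V - S). wvar (Pow S) (\<lambda>B. W (C \<union> B)) (\<lambda>B. f (C \<union> B)))"

lemma W_nonneg: "W A \<ge> 0"
  unfolding W_def using fld_pos by (intro wt_nonneg) (auto intro: less_imp_le)

lemma cond_fld_nonneg: "cond_fld C v \<ge> 0"
  unfolding cond_fld_def using fld_pos \<kappa>_nonneg by (simp add: less_imp_le)

lemma W_Un: "finite C \<Longrightarrow> finite B \<Longrightarrow> C \<inter> B = {} \<Longrightarrow> W (C \<union> B) = W C * wt (cond_fld C) B"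
  unfolding W_def cond_fld_def by (rule wt_Un)

lemma fin: "S \<subseteq> V \<Longrightarrow> finite S"
  using finite_V finite_subset by blast

lemma wvar_W_nonneg: "S \<subseteq> V \<Longrightarrow> wvar (Pow S) (\<lambda>B. W (h B)) f \<ge> 0"
  using fin W_nonneg by (intro wvar_nonneg) auto

lemma en_nonneg: "S \<subseteq> V \<Longrightarrow> en S f \<ge> 0"
  unfolding en_def by (intro sum_nonneg wvar_W_nonneg)

lemma en_empty: "en {} f = 0"
  unfolding en_def by (intro sum.neutral) (simp add: wvar_def power2_eq_square)

lemma en_V: "en V f = wvar (Pow V) W f"
  unfolding en_def by simp

lemma en_remove:
  assumes "S \<subseteq> V" "v \<in> S"
  shows "en (S - {v}) f = (\<Sum>C\<in>Pow (V - S).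
    wvar (Pow (S - {v})) (\<lambda>B. W (C \<union> B)) (\<lambda>B. f (C \<union> B)) +
    wvar (insert v ` Pow (S - {v})) (\<lambda>B. W (C \<union> B)) (\<lambda>B. f (C \<union> B)))"
proof -
  have "V - (S - {v}) = insert v (V - S)" using assms by auto
  moreover have "v \<notin> V - S" using assms by auto
  moreover have "inj_on (insert v) (Pow (S - {v}))" by (auto intro!: inj_onI)
  moreover have "finite (V - S)" using finite_V by simp
  ultimately show ?thesis unfolding en_def
    by (simp add: sum_Pow_insert sum.distrib wvar_reindex)
qed

lemma admissible_cond_fld:
  assumes "S \<subseteq> V" "C \<subseteq> V - S"
  shows "admissible S (cond_fld C)"
  unfolding admissible_def
proof
  fix v assume "v \<in> S"
  have "card (N v \<inter> C) + card (N v \<inter> S) = card ((N v \<inter> C) \<union> (N v \<inter> S))"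
    using assms finite_N by (intro card_Un_disjoint[symmetric]) auto
  also have "\<dots> \<le> card (N v)" using finite_N by (intro card_mono) auto
  finally show "\<exists>a. cond_fld C v = fld v * \<kappa> ^ a \<and> a + card (N v \<inter> S) \<le> card (N v)"
    by (auto simp: cond_fld_def)
qed

lemma wvar_W_eq:
  assumes "S \<subseteq> V" "C \<subseteq> V - S" "X \<subseteq> Pow S"
  shows "wvar X (\<lambda>B. W (C \<union> B)) f = W C * wvar X (wt (cond_fld C)) f"
proof -
  have "wvar X (\<lambda>B. W (C \<union> B)) f = wvar X (\<lambda>B. W C * wt (cond_fld C) B) f"
    using assms fin by (intro wvar_cong W_Un refl) blast+
  then show ?thesis by (simp add: wvar_cmult)
qed

text \<open>Every pinning C outside S leaves admissible fields, so spectral independence holds with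
  the same H in each fibre, and the fibres are summed.\<close>

lemma local_to_global:
  assumes "S \<subseteq> V"
  shows "(\<Sum>v\<in>S. en S f - en (S - {v}) f) \<le> H * en S f"
proof -
  define g where "g = (\<lambda>C B. f (C \<union> B))"
  define D where "D = (\<lambda>C v. wvar (Pow S) (wt (cond_fld C)) (g C)
    - wvar (Pow (S - {v})) (wt (cond_fld C)) (g C)
    - wvar (insert v ` Pow (S - {v})) (wt (cond_fld C)) (g C))"
  have en: "en S f = (\<Sum>C\<in>Pow (V - S). W C * wvar (Pow S) (wt (cond_fld C)) (g C))"
    unfolding en_def g_def using assms by (intro sum.cong refl wvar_W_eq) auto
  have "en S f - en (S - {v}) f = (\<Sum>C\<in>Pow (V - S). W C * D C v)" if v: "v \<in> S" for v
  proof -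
    have "en (S - {v}) f = (\<Sum>C\<in>Pow (V - S).
        W C * wvar (Pow (S - {v})) (wt (cond_fld C)) (g C) +
        W C * wvar (insert v ` Pow (S - {v})) (wt (cond_fld C)) (g C))"
      unfolding en_remove[OF assms v] g_def using assms v
      by (intro sum.cong refl arg_cong2[of _ _ _ _ "(+)"] wvar_W_eq) auto
    then show ?thesis unfolding en D_def
      by (simp add: sum_subtractf[symmetric] right_diff_distrib distrib_left diff_diff_eq)
  qed
  then have "(\<Sum>v\<in>S. en S f - en (S - {v}) f) = (\<Sum>C\<in>Pow (V - S). W C * (\<Sum>v\<in>S. D C v))"
    unfolding sum_distrib_left by (subst sum.swap) simp
  also have "\<dots> \<le> (\<Sum>C\<in>Pow (V - S). W C * (H * wvar (Pow S) (wt (cond_fld C)) (g C)))"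
  proof (intro sum_mono mult_left_mono W_nonneg)
    fix C assume C: "C \<in> Pow (V - S)"
    show "(\<Sum>v\<in>S. D C v) \<le> H * wvar (Pow S) (wt (cond_fld C)) (g C)"
      unfolding D_def
    proof (rule spectral_independence[OF fin[OF assms] _ H_pos])
      fix u assume u: "u \<in> S"
      show "(\<Sum>v\<in>S. \<bar>infl S (cond_fld C) u v\<bar>) \<le> H"
        unfolding H_def using assms u C
        by (intro total_influence_le admissible_cond_fld degree_le) auto
    qed (simp add: cond_fld_nonneg)
  qed
  also have "\<dots> = H * en S f" unfolding en sum_distrib_left by (simp add: mult_ac)
  finally show ?thesis .
qed

section \<open>Comparison of block variances with single-site variances\<close>

lemma W_insert_le:
  assumes "finite A" "v \<notin> A"
  shows "W (insert v A) \<le> M * W A"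
proof -
  have "W (insert v A) = fld v * (\<kappa> ^ card (N v \<inter> A) * W A)"
    using assms finite_N by (simp add: W_def wt_def edges_in_insert power_add)
  also have "\<dots> \<le> M * (1 * W A)"
    using fld_le fld_pos[of v] W_nonneg[of A] \<kappa>_nonneg \<kappa>_less M_pos
    by (intro mult_mono power_le_one) (auto intro!: mult_nonneg_nonneg less_imp_le[OF fld_pos])
  finally show ?thesis by simp
qed

text \<open>Under hard constraints only the passage from v = 1 to v = 0 is safe. The value of f at
  \<open>insert v B\<close> is compared with its value at B, at the price of the variance at v, and
  the latter with the mean c over the configurations having v = 0.\<close>

lemma en_two_blocks:
  assumes "K \<subseteq> V" "v \<in> K"
  shows "en K f \<le> (2 + 2 * M) * (en (K - {v}) f + en {v} f)"
proof -
  let ?X = "Pow (K - {v})" and ?ev = "\<lambda>A. wvar (Pow {v}) (\<lambda>B. W (A \<union> B)) (\<lambda>B. f (A \<union> B))"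
  have finK: "finite K" using fin assms by auto
  have ev: "en {v} f = (\<Sum>C\<in>Pow (V - K). \<Sum>B\<in>?X. ?ev (C \<union> B))"
  proof -
    have "V - {v} = (V - K) \<union> (K - {v})" using assms by auto
    then show ?thesis unfolding en_def using finK finite_V by (simp only:) (subst sum_Pow_Un, auto)
  qed
  have fibre: "wvar (Pow K) (\<lambda>B. W (C \<union> B)) (\<lambda>B. f (C \<union> B))
    \<le> (2 + 2 * M) * (wvar ?X (\<lambda>B. W (C \<union> B)) (\<lambda>B. f (C \<union> B)) + (\<Sum>B\<in>?X. ?ev (C \<union> B)))"
    if C: "C \<in> Pow (V - K)" for C
  proof -
    define w where "w = (\<lambda>B. W (C \<union> B))"
    define g where "g = (\<lambda>B. f (C \<union> B))"
    define c where "c = (\<Sum>B\<in>?X. w B * g B) / (\<Sum>B\<in>?X. w B)"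
    have w0: "w B \<ge> 0" for B by (simp add: w_def W_nonneg)
    have K: "K = insert v (K - {v})" using assms by auto
    have ins: "w (insert v B) * (g (insert v B) - c)\<^sup>2
      \<le> 2 * (1 + M) * ?ev (C \<union> B) + 2 * M * (w B * (g B - c)\<^sup>2)" if B: "B \<in> ?X" for B
    proof -
      define s where "s = w B"
      define t where "t = w (insert v B)"
      define a where "a = g B"
      define b where "b = g (insert v B)"
      have "finite (C \<union> B)" "v \<notin> C \<union> B"
        using B C assms fin[of "C \<union> B"] by auto
      from W_insert_le[OF this] have t_le: "t \<le> M * s" by (simp add: s_def t_def w_def)
      have st: "s \<ge> 0" "t \<ge> 0" using w0 by (auto simp: s_def t_def)
      have X: "Pow {v} = {{}, {v}}" by auto
      have e: "?ev (C \<union> B) = (s * a\<^sup>2 + t * b\<^sup>2) - (s * a + t * b)\<^sup>2 / (s + t)"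
        unfolding wvar_def X by (simp add: s_def t_def a_def b_def w_def g_def)
      have t1: "t * (b - a)\<^sup>2 \<le> (1 + M) * ?ev (C \<union> B)"
      proof (cases "s = 0")
        case True
        then have "t = 0" using t_le st by simp
        then show ?thesis using True e by simp
      next
        case False
        then have s: "s > 0" "s + t > 0" using st by auto
        \<comment> \<open>The variance of a two-point law; t \<le> M s makes s / (s + t) at least 1
          / (1 + M).\<close>
        have "?ev (C \<union> B) = s * t * (b - a)\<^sup>2 / (s + t)"
          unfolding e using s by (simp add: field_simps power2_eq_square)
        moreover have "t * (b - a)\<^sup>2 \<le> (1 + M) * (s * t * (b - a)\<^sup>2 / (s + t))"
        proof -
          have "(s + t) * (t * (b - a)\<^sup>2) \<le> ((1 + M) * s) * (t * (b - a)\<^sup>2)"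
            using t_le st by (intro mult_right_mono) (auto simp: algebra_simps)
          then show ?thesis using s by (simp add: field_simps)
        qed
        ultimately show ?thesis by simp
      qed
      have "(b - c)\<^sup>2 \<le> 2 * (b - a)\<^sup>2 + 2 * (a - c)\<^sup>2"
        using sum_squares_bound[of "b - a" "a - c"] by (simp add: power2_eq_square algebra_simps)
      then have "t * (b - c)\<^sup>2 \<le> t * (2 * (b - a)\<^sup>2 + 2 * (a - c)\<^sup>2)"
        using st by (intro mult_left_mono)
      also have "\<dots> = 2 * (t * (b - a)\<^sup>2) + 2 * (t * (a - c)\<^sup>2)" by (simp add: algebra_simps)
      also have "\<dots> \<le> 2 * ((1 + M) * ?ev (C \<union> B)) + 2 * (M * s * (a - c)\<^sup>2)"
        using t1 t_le by (intro add_mono mult_left_mono mult_right_mono) auto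
      finally show ?thesis by (simp add: s_def t_def a_def b_def algebra_simps)
    qed
    have "wvar (Pow K) w g \<le> (\<Sum>B\<in>Pow K. w B * (g B - c)\<^sup>2)"
      using finK w0 by (intro wvar_le) auto
    also have "\<dots> = (\<Sum>B\<in>?X. w B * (g B - c)\<^sup>2) + (\<Sum>B\<in>?X. w (insert v B) * (g (insert v B) - c)\<^sup>2)"
      using finK by (subst K, subst sum_Pow_insert) auto
    also have "\<dots> \<le> (\<Sum>B\<in>?X. w B * (g B - c)\<^sup>2) +
        (\<Sum>B\<in>?X. 2 * (1 + M) * ?ev (C \<union> B) + 2 * M * (w B * (g B - c)\<^sup>2))"
      by (intro add_left_mono sum_mono ins)
    also have "\<dots> = (1 + 2 * M) * (\<Sum>B\<in>?X. w B * (g B - c)\<^sup>2) + (2 + 2 * M) * (\<Sum>B\<in>?X. ?ev (C \<union> B))"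
      by (simp add: sum.distrib sum_distrib_left algebra_simps)
    also have "(\<Sum>B\<in>?X. w B * (g B - c)\<^sup>2) = wvar ?X w g"
      unfolding c_def using finK w0 by (intro wvar_eq[symmetric]) auto
    also have "(1 + 2 * M) * wvar ?X w g \<le> (2 + 2 * M) * wvar ?X w g"
      using finK w0 by (intro mult_right_mono wvar_nonneg) auto
    finally show ?thesis by (simp add: w_def g_def distrib_left)
  qed
  have "en K f \<le> (\<Sum>C\<in>Pow (V - K). (2 + 2 * M) *
      (wvar ?X (\<lambda>B. W (C \<union> B)) (\<lambda>B. f (C \<union> B)) + (\<Sum>B\<in>?X. ?ev (C \<union> B))))"
    unfolding en_def[of K] by (intro sum_mono fibre)
  also have "\<dots> = (2 + 2 * M) * ((\<Sum>C\<in>Pow (V - K). wvar ?X (\<lambda>B. W (C \<union> B)) (\<lambda>B. f (C \<union> B))) + en {v} f)"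
    unfolding ev by (simp add: sum_distrib_left sum.distrib distrib_left)
  also have "\<dots> \<le> (2 + 2 * M) * (en (K - {v}) f + en {v} f)"
  proof (intro mult_left_mono add_right_mono)
    have "0 \<le> wvar (insert v ` ?X) (\<lambda>B. W (C \<union> B)) (\<lambda>B. f (C \<union> B))" for C
      using finK W_nonneg by (intro wvar_nonneg) auto
    then show "(\<Sum>C\<in>Pow (V - K). wvar ?X (\<lambda>B. W (C \<union> B)) (\<lambda>B. f (C \<union> B))) \<le> en (K - {v}) f"
      unfolding en_remove[OF assms] by (intro sum_mono) simp
  qed (use M_pos in simp)
  finally show ?thesis .
qed

text \<open>Vertices are split off one at a time, each at the cost of a factor 2 + 2 M. The
  exponential loss is affordable only because it will be applied to small components.\<close>

lemma en_crude:
  assumes "K \<subseteq> V"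
  shows "en K f \<le> (2 + 2 * M) ^ card K * (\<Sum>v\<in>K. en {v} f)"
proof -
  have "finite K" using fin assms by auto
  then show ?thesis using assms
  proof (induction K rule: finite_induct)
    case empty
    then show ?case by (simp add: en_empty)
  next
    case (insert v K)
    let ?B = "2 + 2 * M"
    have B: "?B \<ge> 1" using M_pos by simp
    have nn: "en {v} f \<ge> 0" using insert en_nonneg by simp
    have "en (insert v K) f \<le> ?B * (en K f + en {v} f)"
      using en_two_blocks[of "insert v K" v f] insert by simp
    also have "\<dots> \<le> ?B * (?B ^ card K * (\<Sum>v\<in>K. en {v} f) + ?B ^ card K * en {v} f)"
    proof (intro mult_left_mono add_mono)
      show "en {v} f \<le> ?B ^ card K * en {v} f"
        using mult_right_mono[OF one_le_power[OF B, of "card K"] nn] by simp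
    qed (use insert B in auto)
    also have "\<dots> = ?B ^ card (insert v K) * (\<Sum>v\<in>insert v K. en {v} f)"
      using insert by (simp add: algebra_simps)
    finally show ?case .
  qed
qed

text \<open>Without edges between S and T, the spins on S and on T are independent given all others,
  and \<open>wvar_product\<close> applies in each fibre.\<close>

lemma en_Un:
  assumes "S \<subseteq> V" "T \<subseteq> V" "S \<inter> T = {}" and no_edge: "\<And>s. s \<in> S \<Longrightarrow> N s \<inter> T = {}"
  shows "en (S \<union> T) f \<le> en S f + en T f"
proof -
  let ?U = "V - (S \<union> T)"
  have fins: "finite S" "finite T" "finite ?U" using fin assms finite_V by auto
  have sumS: "en S f = (\<Sum>C\<in>Pow ?U. \<Sum>D\<in>Pow T. wvar (Pow S) (\<lambda>B. W (C \<union> D \<union> B)) (\<lambda>B. f (C \<union> D \<union> B)))"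
  proof -
    have "V - S = ?U \<union> T" using assms by auto
    then show ?thesis unfolding en_def using fins by (simp only:) (subst sum_Pow_Un, auto)
  qed
  have sumT: "en T f = (\<Sum>C\<in>Pow ?U. \<Sum>B\<in>Pow S. wvar (Pow T) (\<lambda>D. W (C \<union> B \<union> D)) (\<lambda>D. f (C \<union> B \<union> D)))"
  proof -
    have "V - T = ?U \<union> S" using assms by auto
    then show ?thesis unfolding en_def using fins by (simp only:) (subst sum_Pow_Un, auto)
  qed
  have "wvar (Pow (S \<union> T)) (\<lambda>B. W (C \<union> B)) (\<lambda>B. f (C \<union> B)) \<le>
      (\<Sum>D\<in>Pow T. wvar (Pow S) (\<lambda>B. W (C \<union> D \<union> B)) (\<lambda>B. f (C \<union> D \<union> B))) +
      (\<Sum>B\<in>Pow S. wvar (Pow T) (\<lambda>D. W (C \<union> B \<union> D)) (\<lambda>D. f (C \<union> B \<union> D)))"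
    if C: "C \<in> Pow ?U" for C
  proof -
    let ?w = "wt (cond_fld C)"
    have finC: "finite C" using C fins finite_subset by blast
    have w: "\<forall>B\<in>X. ?w B \<ge> 0" for X using cond_fld_nonneg by (auto intro!: wt_nonneg)
    have prod: "W (C \<union> (B \<union> D)) = W C * (?w B * ?w D)" if "B \<in> Pow S" "D \<in> Pow T" for B D
    proof -
      have fBD: "finite B" "finite D" using that fins finite_subset by blast+
      have "N d \<inter> B = {}" if "d \<in> D" for d
        using no_edge N_sym \<open>d \<in> D\<close> \<open>B \<in> Pow S\<close> \<open>D \<in> Pow T\<close> by blast
      then have "wt (\<lambda>v. cond_fld C v * \<kappa> ^ card (N v \<inter> B)) D = ?w D"
        by (intro wt_cong) simp
      moreover have "wt (cond_fld C) (B \<union> D) = ?w B * wt (\<lambda>v. cond_fld C v * \<kappa> ^ card (N v \<inter> B)) D"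
        using that assms by (intro wt_Un fBD) auto
      moreover have "W (C \<union> (B \<union> D)) = W C * ?w (B \<union> D)"
        using that C finC fBD by (intro W_Un) auto
      ultimately show ?thesis by simp
    qed
    have inj: "inj_on (\<lambda>p. fst p \<union> snd p) (Pow S \<times> Pow T)"
      using assms(3) by (intro inj_on_inverseI[of _ "\<lambda>A. (A \<inter> S, A \<inter> T)"]) auto
    have img: "(\<lambda>p. fst p \<union> snd p) ` (Pow S \<times> Pow T) = Pow (S \<union> T)"
    proof (intro set_eqI iffI)
      fix A assume "A \<in> Pow (S \<union> T)"
      then have "A = fst (A \<inter> S, A \<inter> T) \<union> snd (A \<inter> S, A \<inter> T)" by auto
      then show "A \<in> (\<lambda>p. fst p \<union> snd p) ` (Pow S \<times> Pow T)" by blast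
    qed auto
    have "wvar (Pow (S \<union> T)) (\<lambda>B. W (C \<union> B)) (\<lambda>B. f (C \<union> B))
      = wvar (Pow S \<times> Pow T) (\<lambda>p. W C * (?w (fst p) * ?w (snd p))) (\<lambda>p. f (C \<union> (fst p \<union> snd p)))"
      unfolding img[symmetric] wvar_reindex[OF inj] by (intro wvar_cong prod) auto
    also have "\<dots> = W C * wvar (Pow S \<times> Pow T) (\<lambda>p. ?w (fst p) * ?w (snd p)) (\<lambda>p. f (C \<union> (fst p \<union> snd p)))"
      by (rule wvar_cmult)
    also have "\<dots> \<le> W C * ((\<Sum>D\<in>Pow T. ?w D * wvar (Pow S) ?w (\<lambda>B. f (C \<union> (B \<union> D)))) +
        (\<Sum>B\<in>Pow S. ?w B * wvar (Pow T) ?w (\<lambda>D. f (C \<union> (B \<union> D)))))"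
      using fins w by (intro mult_left_mono W_nonneg wvar_product[where f = "\<lambda>B D. f (C \<union> (B \<union> D))"]) auto
    also have "\<dots> = (\<Sum>D\<in>Pow T. wvar (Pow S) (\<lambda>B. W C * ?w D * ?w B) (\<lambda>B. f (C \<union> (B \<union> D)))) +
        (\<Sum>B\<in>Pow S. wvar (Pow T) (\<lambda>D. W C * ?w B * ?w D) (\<lambda>D. f (C \<union> (B \<union> D))))"
      unfolding wvar_cmult by (simp add: distrib_left sum_distrib_left mult.assoc)
    also have "(\<Sum>D\<in>Pow T. wvar (Pow S) (\<lambda>B. W C * ?w D * ?w B) (\<lambda>B. f (C \<union> (B \<union> D)))) =
        (\<Sum>D\<in>Pow T. wvar (Pow S) (\<lambda>B. W (C \<union> D \<union> B)) (\<lambda>B. f (C \<union> D \<union> B)))"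
    proof (intro sum.cong refl wvar_cong)
      fix B D assume "D \<in> Pow T" "B \<in> Pow S"
      moreover have "C \<union> D \<union> B = C \<union> (B \<union> D)" by auto
      ultimately show "W C * ?w D * ?w B = W (C \<union> D \<union> B)" using prod by (simp add: mult_ac)
    qed (simp add: Un_ac)
    also have "(\<Sum>B\<in>Pow S. wvar (Pow T) (\<lambda>D. W C * ?w B * ?w D) (\<lambda>D. f (C \<union> (B \<union> D)))) =
        (\<Sum>B\<in>Pow S. wvar (Pow T) (\<lambda>D. W (C \<union> B \<union> D)) (\<lambda>D. f (C \<union> B \<union> D)))"
      by (intro sum.cong refl wvar_cong) (simp_all add: prod Un_assoc)
    finally show ?thesis .
  qed
  then have "en (S \<union> T) f \<le> (\<Sum>C\<in>Pow ?U.
      (\<Sum>D\<in>Pow T. wvar (Pow S) (\<lambda>B. W (C \<union> D \<union> B)) (\<lambda>B. f (C \<union> D \<union> B))) +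
      (\<Sum>B\<in>Pow S. wvar (Pow T) (\<lambda>D. W (C \<union> B \<union> D)) (\<lambda>D. f (C \<union> B \<union> D))))"
    unfolding en_def[of "S \<union> T"] by (intro sum_mono)
  also have "\<dots> = en S f + en T f" unfolding sumS sumT by (simp add: sum.distrib)
  finally show ?thesis .
qed

section \<open>Connected components of the free set\<close>

definition component :: "'a set \<Rightarrow> 'a \<Rightarrow> 'a set" where
  "component S v = {u. (v, u) \<in> {(a, b). a \<in> S \<and> b \<in> S \<and> b \<in> N a}\<^sup>*}"

lemma component_refl: "v \<in> component S v"
  by (simp add: component_def)

lemma component_subset: "v \<in> S \<Longrightarrow> component S v \<subseteq> S"
proof
  fix u assume "v \<in> S" "u \<in> component S v"
  then have "(v, u) \<in> {(a, b). a \<in> S \<and> b \<in> S \<and> b \<in> N a}\<^sup>*" by (simp add: component_def)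
  then show "u \<in> S" using \<open>v \<in> S\<close> by (induction rule: rtrancl_induct) auto
qed

lemma component_mono: "S \<subseteq> T \<Longrightarrow> component S v \<subseteq> component T v"
  unfolding component_def
  using rtrancl_mono[of "{(a, b). a \<in> S \<and> b \<in> S \<and> b \<in> N a}" "{(a, b). a \<in> T \<and> b \<in> T \<and> b \<in> N a}"]
  by auto

lemma component_closed:
  "v \<in> S \<Longrightarrow> u \<in> component S v \<Longrightarrow> w \<in> N u \<Longrightarrow> w \<in> S \<Longrightarrow> w \<in> component S v"
  using component_subset[of v S] unfolding component_def
  by (auto intro: rtrancl_into_rtrancl)

lemma component_sym:
  assumes "u \<in> component S v"
  shows "component S v \<subseteq> component S u"
proof -
  let ?r = "{(a, b). a \<in> S \<and> b \<in> S \<and> b \<in> N a}"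
  have "sym ?r" using N_sym by (auto simp: sym_def)
  then have "(u, v) \<in> ?r\<^sup>*" using assms sym_rtrancl unfolding component_def by (auto dest: symD)
  then show ?thesis unfolding component_def by (auto intro: rtrancl_trans)
qed

text \<open>Components do not interact, so \<open>en_Un\<close> peels them off and the exponential
  loss is paid per component. After a component is removed, the components of what remains can only
  be smaller than those of S.\<close>

lemma en_components:
  assumes "S \<subseteq> V"
  shows "en S f \<le> (\<Sum>v\<in>S. (2 + 2 * M) ^ card (component S v) * en {v} f)"
  using assms
proof (induction "card S" arbitrary: S rule: less_induct)
  case less
  let ?B = "2 + 2 * M"
  have B: "?B \<ge> 1" using M_pos by simp
  have finS: "finite S" using fin less by auto
  have nn: "en {v} f \<ge> 0" if "v \<in> S" for v using that less.prems by (intro en_nonneg) auto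
  have pow: "?B ^ card X * en {v} f \<le> ?B ^ card (component S v) * en {v} f"
    if "v \<in> S" "X \<subseteq> component S v" for v X
  proof -
    have "finite (component S v)" using component_subset[OF that(1)] finS finite_subset by blast
    then have "card X \<le> card (component S v)" using that by (intro card_mono)
    then show ?thesis using nn[OF that(1)] B by (intro mult_right_mono power_increasing)
  qed
  show ?case
  proof (cases "S = {}")
    case True
    then show ?thesis by (simp add: en_empty)
  next
    case False
    then obtain v where v: "v \<in> S" by auto
    define K where "K = component S v"
    have K: "K \<subseteq> S" "v \<in> K" using component_subset[OF v] component_refl by (auto simp: K_def)
    have "en S f \<le> en K f + en (S - K) f"
    proof -
      have "N s \<inter> (S - K) = {}" if "s \<in> K" for s
        using component_closed[OF v] that unfolding K_def by blast
      then have "en (K \<union> (S - K)) f \<le> en K f + en (S - K) f"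
        using K less by (intro en_Un) auto
      moreover have "K \<union> (S - K) = S" using K by auto
      ultimately show ?thesis by simp
    qed
    also have "en K f \<le> (\<Sum>u\<in>K. ?B ^ card (component S u) * en {u} f)"
    proof -
      have "en K f \<le> (\<Sum>u\<in>K. ?B ^ card K * en {u} f)"
        using en_crude[of K f] K less by (simp add: sum_distrib_left)
      also have "\<dots> \<le> (\<Sum>u\<in>K. ?B ^ card (component S u) * en {u} f)"
        using K component_sym unfolding K_def by (intro sum_mono pow) auto
      finally show ?thesis .
    qed
    also have "en (S - K) f \<le> (\<Sum>u\<in>S - K. ?B ^ card (component (S - K) u) * en {u} f)"
    proof -
      have "S - K \<subset> S" using K by auto
      then show ?thesis using less.hyps[of "S - K"] psubset_card_mono[OF finS, of "S - K"] less.prems by auto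
    qed
    also have "\<dots> \<le> (\<Sum>u\<in>S - K. ?B ^ card (component S u) * en {u} f)"
      by (intro sum_mono pow component_mono) auto
    finally have "en S f \<le> (\<Sum>u\<in>K. ?B ^ card (component S u) * en {u} f) +
        (\<Sum>u\<in>S - K. ?B ^ card (component S u) * en {u} f)" by simp
    also have "\<dots> = (\<Sum>u\<in>S. ?B ^ card (component S u) * en {u} f)"
      using sum.subset_diff[OF K(1) finS, of "\<lambda>u. ?B ^ card (component S u) * en {u} f"] by simp
    finally show ?thesis .
  qed
qed

end

section \<open>Random free sets and the Poincare inequality\<close>

context energy
begin

definition bern :: "real \<Rightarrow> 'a set \<Rightarrow> real" where
  "bern \<theta> S = \<theta> ^ card S * (1 - \<theta>) ^ card (V - S)"

lemma bern_nonneg: "0 \<le> \<theta> \<Longrightarrow> \<theta> \<le> 1 \<Longrightarrow> bern \<theta> S \<ge> 0"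
  by (simp add: bern_def)

lemma bern_superset:
  assumes "T \<subseteq> V"
  shows "(\<Sum>S\<in>Pow V. bern \<theta> S * of_bool (T \<subseteq> S)) = \<theta> ^ card T"
proof -
  let ?Q = "V - T"
  have fins: "finite T" "finite ?Q" using fin assms finite_V by auto
  have V: "V = T \<union> ?Q" using assms by auto
  have inner: "(\<Sum>R\<in>Pow ?Q. bern \<theta> (C \<union> R) * of_bool (T \<subseteq> C \<union> R)) = (if C = T then \<theta> ^ card T else 0)"
    if "C \<in> Pow T" for C
  proof (cases "C = T")
    case True
    have "bern \<theta> (T \<union> R) = \<theta> ^ card T * ((\<Prod>x\<in>R. \<theta>) * (\<Prod>x\<in>?Q - R. 1 - \<theta>))" if "R \<in> Pow ?Q" for R
    proof -
      have "finite R" "T \<inter> R = {}" using that fins finite_subset by auto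
      moreover have "V - (T \<union> R) = ?Q - R" by auto
      ultimately show ?thesis using fins by (simp add: bern_def card_Un_disjoint power_add)
    qed
    then have "(\<Sum>R\<in>Pow ?Q. bern \<theta> (T \<union> R)) = \<theta> ^ card T * (\<Prod>x\<in>?Q. \<theta> + (1 - \<theta>))"
      unfolding prod_add[OF fins(2)] by (simp add: sum_distrib_left)
    then show ?thesis using True by simp
  next
    case False
    have "\<not> T \<subseteq> C \<union> R" if "R \<in> Pow ?Q" for R using False that \<open>C \<in> Pow T\<close> by auto
    then show ?thesis using False by (intro trans[OF sum.neutral]) auto
  qed
  have "(\<Sum>S\<in>Pow V. bern \<theta> S * of_bool (T \<subseteq> S)) =
      (\<Sum>C\<in>Pow T. \<Sum>R\<in>Pow ?Q. bern \<theta> (C \<union> R) * of_bool (T \<subseteq> C \<union> R))"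
    using fins by (subst V, subst sum_Pow_Un) auto
  also have "\<dots> = (\<Sum>C\<in>Pow T. if C = T then \<theta> ^ card T else 0)"
    by (intro sum.cong refl inner)
  also have "\<dots> = \<theta> ^ card T" using fins by (simp add: sum.delta)
  finally show ?thesis .
qed

definition mean_en :: "('a set \<Rightarrow> real) \<Rightarrow> real \<Rightarrow> real" where
  "mean_en f \<theta> = (\<Sum>S\<in>Pow V. bern \<theta> S * en S f)"

lemma mean_en_1: "mean_en f 1 = en V f"
proof -
  have "bern 1 S * en S f = (if S = V then en V f else 0)" if "S \<in> Pow V" for S
  proof (cases "S = V")
    case False
    then have "card (V - S) > 0" using that finite_V by (auto simp: card_gt_0_iff)
    then show ?thesis using False by (simp add: bern_def)
  qed (simp add: bern_def)
  then have "mean_en f 1 = (\<Sum>S\<in>Pow V. if S = V then en V f else 0)"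
    unfolding mean_en_def by (intro sum.cong) auto
  then show ?thesis using finite_V by (simp add: sum.delta)
qed

text \<open>Russo's formula turns the local-to-global inequality into a differential inequality.\<close>

lemma mean_en_deriv:
  "\<exists>d. (mean_en f has_real_derivative d) (at \<theta>) \<and>
    \<theta> * d = (\<Sum>S\<in>Pow V. bern \<theta> S * (\<Sum>v\<in>S. en S f - en (S - {v}) f))"
proof (intro exI conjI)
  let ?d = "\<lambda>S. real (card S) * \<theta> ^ (card S - 1) * (1 - \<theta>) ^ card (V - S)
    - \<theta> ^ card S * (real (card (V - S)) * (1 - \<theta>) ^ (card (V - S) - 1))"
  show "(mean_en f has_real_derivative (\<Sum>S\<in>Pow V. ?d S * en S f)) (at \<theta>)"
    unfolding mean_en_def[abs_def] bern_def
    by (auto intro!: derivative_eq_intros sum.cong)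
  have a: "\<theta> * (real (card S) * \<theta> ^ (card S - 1) * (1 - \<theta>) ^ card (V - S)) = real (card S) * bern \<theta> S" for S
    unfolding bern_def by (cases "card S") auto
  \<comment> \<open>A pair (S, v) with v outside S is matched with (insert v S, v): the power of
    \<theta> raised by one and the power of 1 - \<theta> lowered by one form the \<open>bern\<close>
    weight of the larger set.\<close>
  have b: "(\<Sum>S\<in>Pow V. real (card (V - S)) * (\<theta> ^ Suc (card S) * (1 - \<theta>) ^ (card (V - S) - 1)) * en S f)
    = (\<Sum>S\<in>Pow V. \<Sum>v\<in>S. bern \<theta> S * en (S - {v}) f)"
  proof -
    have "(\<Sum>S\<in>Pow V. real (card (V - S)) * (\<theta> ^ Suc (card S) * (1 - \<theta>) ^ (card (V - S) - 1)) * en S f)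
      = (\<Sum>S\<in>Pow V. \<Sum>v\<in>V - S. \<theta> ^ Suc (card S) * (1 - \<theta>) ^ (card (V - S) - 1) * en S f)"
      by (simp add: mult.assoc)
    also have "\<dots> = (\<Sum>(S, v)\<in>Sigma (Pow V) (\<lambda>S. V - S). \<theta> ^ Suc (card S) * (1 - \<theta>) ^ (card (V - S) - 1) * en S f)"
      using finite_V by (intro sum.Sigma) auto
    also have "\<dots> = (\<Sum>(S, v)\<in>Sigma (Pow V) (\<lambda>S. S). bern \<theta> S * en (S - {v}) f)"
    proof (intro sum.reindex_bij_witness[of _ "\<lambda>(S, v). (S - {v}, v)" "\<lambda>(S, v). (insert v S, v)"])
      fix p assume "p \<in> Sigma (Pow V) (\<lambda>S. V - S)"
      then obtain S v where p: "p = (S, v)" "S \<subseteq> V" "v \<in> V" "v \<notin> S" by auto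
      have "V - insert v S = (V - S) - {v}" by auto
      then have "card (V - insert v S) = card (V - S) - 1" using p by simp
      moreover have "card (insert v S) = Suc (card S)" using p fin[of S] by simp
      moreover have "insert v S - {v} = S" using p by auto
      ultimately show "(case case p of (S, v) \<Rightarrow> (insert v S, v) of (S, v) \<Rightarrow> bern \<theta> S * en (S - {v}) f) =
         (case p of (S, v) \<Rightarrow> \<theta> ^ Suc (card S) * (1 - \<theta>) ^ (card (V - S) - 1) * en S f)"
        using p by (simp add: bern_def)
    qed auto
    also have "\<dots> = (\<Sum>S\<in>Pow V. \<Sum>v\<in>S. bern \<theta> S * en (S - {v}) f)"
      using finite_V finite_subset by (intro sum.Sigma[symmetric]) auto
    finally show ?thesis .
  qed
  have "\<theta> * (\<Sum>S\<in>Pow V. ?d S * en S f) =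
    (\<Sum>S\<in>Pow V. \<theta> * (real (card S) * \<theta> ^ (card S - 1) * (1 - \<theta>) ^ card (V - S)) * en S f)
    - (\<Sum>S\<in>Pow V. real (card (V - S)) * (\<theta> ^ Suc (card S) * (1 - \<theta>) ^ (card (V - S) - 1)) * en S f)"
    unfolding sum_distrib_left sum_subtractf[symmetric]
    by (intro sum.cong refl) (simp add: algebra_simps)
  also have "\<dots> = (\<Sum>S\<in>Pow V. real (card S) * bern \<theta> S * en S f) - (\<Sum>S\<in>Pow V. \<Sum>v\<in>S. bern \<theta> S * en (S - {v}) f)"
    unfolding a b ..
  also have "\<dots> = (\<Sum>S\<in>Pow V. bern \<theta> S * (\<Sum>v\<in>S. en S f - en (S - {v}) f))"
    unfolding sum_subtractf[symmetric] sum_distrib_left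
    by (intro sum.cong refl) (simp add: sum_subtractf right_diff_distrib)
  finally show "\<theta> * (\<Sum>S\<in>Pow V. ?d S * en S f) = (\<Sum>S\<in>Pow V. bern \<theta> S * (\<Sum>v\<in>S. en S f - en (S - {v}) f))" .
qed

text \<open>The differential inequality \<theta> * d \<le> H * \<open>mean_en f \<theta>\<close>
  says that \<open>mean_en f \<theta>\<close> times \<theta>^(-H) does not increase. At \<theta> = 1
  every vertex is free and the full variance appears.\<close>

lemma mean_en_ge:
  assumes "0 < \<theta>" "\<theta> \<le> 1"
  shows "en V f \<le> \<theta> powr - H * mean_en f \<theta>"
proof -
  have "mean_en f 1 * 1 powr - H \<le> mean_en f \<theta> * \<theta> powr - H"
  proof (rule DERIV_nonpos_imp_nonincreasing[OF assms(2)])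
    fix x :: real assume x: "\<theta> \<le> x" "x \<le> 1"
    then have x0: "x > 0" using assms by simp
    obtain d where d: "(mean_en f has_real_derivative d) (at x)"
      "x * d = (\<Sum>S\<in>Pow V. bern x S * (\<Sum>v\<in>S. en S f - en (S - {v}) f))"
      using mean_en_deriv by blast
    have "x * d \<le> (\<Sum>S\<in>Pow V. bern x S * (H * en S f))"
      unfolding d(2) using x x0 by (intro sum_mono mult_left_mono local_to_global bern_nonneg) auto
    also have "\<dots> = H * mean_en f x" unfolding mean_en_def sum_distrib_left by (simp add: mult_ac)
    finally have "d \<le> H * mean_en f x / x" using x0 by (simp add: field_simps)
    moreover have "((\<lambda>x. mean_en f x * x powr - H) has_real_derivative
        d * x powr - H + (- H * x powr (- H - 1)) * mean_en f x) (at x)"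
      by (rule DERIV_mult[OF d(1) has_real_derivative_powr[OF x0]])
    moreover have "d * x powr - H + (- H * x powr (- H - 1)) * mean_en f x = (d - H * mean_en f x / x) * x powr - H"
      using x0 by (simp add: powr_diff algebra_simps)
    ultimately show "\<exists>y. ((\<lambda>x. mean_en f x * x powr - H) has_real_derivative y) (at x) \<and> y \<le> 0"
      by (intro exI conjI) (assumption, simp add: mult_nonpos_nonneg)
  qed
  then show ?thesis by (simp add: mean_en_1 mult.commute)
qed

section \<open>Counting connected sets by walks\<close>

primrec walks :: "nat \<Rightarrow> 'a \<Rightarrow> 'a list set" where
  "walks 0 v = {[v]}"
| "walks (Suc n) v = (\<Union>u\<in>N v. (#) v ` walks n u)"

lemma finite_walks: "finite (walks n v)"
  by (induction n arbitrary: v) (auto simp: finite_N)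

lemma card_walks: "v \<in> V \<Longrightarrow> card (walks n v) \<le> \<Delta> ^ n"
proof (induction n arbitrary: v)
  case (Suc n)
  have "card (walks (Suc n) v) \<le> (\<Sum>u\<in>N v. card ((#) v ` walks n u))"
    using finite_N by (simp add: card_UN_le)
  also have "\<dots> \<le> (\<Sum>u\<in>N v. \<Delta> ^ n)"
  proof (intro sum_mono)
    fix u assume "u \<in> N v"
    then have "card (walks n u) \<le> \<Delta> ^ n" using Suc N_subset by blast
    then show "card ((#) v ` walks n u) \<le> \<Delta> ^ n"
      using card_image_le[OF finite_walks, of "(#) v" n u] by linarith
  qed
  also have "\<dots> \<le> \<Delta> ^ Suc n" using degree_le[OF Suc.prems] by simp
  finally show ?case .
qed simp

lemma walk_subset: "v \<in> V \<Longrightarrow> w \<in> walks n v \<Longrightarrow> set w \<subseteq> V"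
proof (induction n arbitrary: v w)
  case (Suc n)
  then obtain u w' where "u \<in> N v" "w = v # w'" "w' \<in> walks n u" by auto
  then show ?case using Suc N_subset by fastforce
qed simp

lemma hd_walk: "w \<in> walks n v \<Longrightarrow> v \<in> set w"
  by (cases n) auto

text \<open>At a visit to x the walk makes an excursion to u and back, which takes two steps and
  adds only the vertex u.\<close>

lemma walk_detour:
  "w \<in> walks n v \<Longrightarrow> x \<in> set w \<Longrightarrow> u \<in> N x \<Longrightarrow> \<exists>w'\<in>walks (Suc (Suc n)) v. set w' = insert u (set w)"
proof (induction n arbitrary: v w)
  case 0
  then have "v \<in> N u" "u \<in> N v" using N_sym[of v u] by auto
  then have "[u, v] \<in> walks (Suc 0) u" "u \<in> N v" by auto
  then have "[v, u, v] \<in> walks (Suc (Suc 0)) v" by (simp only: walks.simps(2)[of "Suc 0"]) blast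
  then show ?case using 0 by (intro bexI[of _ "[v, u, v]"]) auto
next
  case (Suc n)
  then obtain y w0 where w: "y \<in> N v" "w = v # w0" "w0 \<in> walks n y" by auto
  show ?case
  proof (cases "x = v")
    case True
    have "w \<in> walks (Suc n) v" "v \<in> N u" using Suc True N_sym by auto
    then have "u # w \<in> walks (Suc (Suc n)) u" by (simp only: walks.simps(2)[of "Suc n"]) blast
    then have "v # u # w \<in> walks (Suc (Suc (Suc n))) v"
      using Suc.prems(3) True by (simp only: walks.simps(2)[of "Suc (Suc n)"]) blast
    then show ?thesis using w by (intro bexI[of _ "v # u # w"]) auto
  next
    case False
    then have "x \<in> set w0" using Suc.prems(2) w by simp
    then obtain w' where "w' \<in> walks (Suc (Suc n)) y" "set w' = insert u (set w0)"
      using Suc.IH[OF w(3) _ Suc.prems(3)] by blast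
    moreover from this(1) have "v # w' \<in> walks (Suc (Suc (Suc n))) v"
      using w(1) by (simp only: walks.simps(2)[of "Suc (Suc n)"]) blast
    ultimately show ?thesis using w by (intro bexI[of _ "v # w'"]) auto
  qed
qed

text \<open>A connected set of \<open>j\<close> vertices is covered by a walk of length \<open>2 * (j - 1)\<close>, so there are at
  most \<open>\<Delta> ^ (2 * (j - 1))\<close> of them through a given vertex.\<close>

lemma component_walk:
  assumes "v \<in> S" "finite S"
  shows "Suc i \<le> card (component S v) \<Longrightarrow>
    \<exists>w\<in>walks (2 * i) v. set w \<subseteq> component S v \<and> card (set w) = Suc i"
proof (induction i)
  case 0
  then show ?case by (simp add: component_refl)
next
  case (Suc i)
  then obtain w where w: "w \<in> walks (2 * i) v" "set w \<subseteq> component S v" "card (set w) = Suc i" by auto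
  \<comment> \<open>Otherwise the vertices of the walk would be closed under adjacency in S and
    would contain the whole component, which is larger.\<close>
  have "\<exists>x\<in>set w. \<exists>u\<in>N x \<inter> S. u \<notin> set w"
  proof (rule ccontr)
    assume no: "\<not> ?thesis"
    have "component S v \<subseteq> set w"
    proof
      fix u assume "u \<in> component S v"
      then have "(v, u) \<in> {(a, b). a \<in> S \<and> b \<in> S \<and> b \<in> N a}\<^sup>*" by (simp add: component_def)
      then show "u \<in> set w"
        by (induction rule: rtrancl_induct) (use no hd_walk[OF w(1)] in auto)
    qed
    then have "card (component S v) \<le> card (set w)" by (intro card_mono) auto
    then show False using Suc.prems w(3) by simp
  qed
  then obtain x u where xu: "x \<in> set w" "u \<in> N x" "u \<in> S" "u \<notin> set w" by auto
  then have "u \<in> component S v" using component_closed[OF assms(1)] w(2) by blast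
  moreover obtain w' where "w' \<in> walks (Suc (Suc (2 * i))) v" "set w' = insert u (set w)"
    using walk_detour[OF w(1) xu(1,2)] by blast
  ultimately show ?case using w xu(4) by (intro bexI[of _ w']) auto
qed

text \<open>The left side is one term of the sum: for i + 1 the size of the component, some walk
  visits exactly its vertices. Prescribing the number of distinct vertices makes the probability
  that all of them are free a power of \<theta> known in advance.\<close>

lemma power_component_le:
  fixes B :: real
  assumes "S \<subseteq> V" "v \<in> S" "B \<ge> 0"
  shows "B ^ card (component S v) \<le>
    (\<Sum>i<card V. \<Sum>w\<in>walks (2 * i) v. of_bool (card (set w) = Suc i \<and> set w \<subseteq> S) * B ^ Suc i)"
proof -
  have finS: "finite S" using fin assms by simp
  have fc: "finite (component S v)" using component_subset[OF assms(2)] finS finite_subset by blast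
  define j where "j = card (component S v) - 1"
  have "card (component S v) > 0" using fc component_refl by (auto simp: card_gt_0_iff)
  then have j: "card (component S v) = Suc j" by (simp add: j_def)
  moreover have "card (component S v) \<le> card V"
    using component_subset[OF assms(2)] assms finite_V by (intro card_mono) auto
  ultimately have jV: "j < card V" by simp
  obtain w where w: "w \<in> walks (2 * j) v" "set w \<subseteq> component S v" "card (set w) = Suc j"
    using component_walk[OF assms(2) finS, of j] j by auto
  have "B ^ card (component S v) = of_bool (card (set w) = Suc j \<and> set w \<subseteq> S) * B ^ Suc j"
    using w component_subset[OF assms(2)] j by auto
  also have "\<dots> \<le> (\<Sum>w\<in>walks (2 * j) v. of_bool (card (set w) = Suc j \<and> set w \<subseteq> S) * B ^ Suc j)"
    using finite_walks assms(3) by (intro member_le_sum w(1)) auto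
  also have "\<dots> \<le> (\<Sum>i<card V. \<Sum>w\<in>walks (2 * i) v. of_bool (card (set w) = Suc i \<and> set w \<subseteq> S) * B ^ Suc i)"
    using jV assms(3)
    by (intro member_le_sum[of j "{..<card V}" "\<lambda>i. \<Sum>w\<in>walks (2 * i) v. of_bool (card (set w) = Suc i \<and> set w \<subseteq> S) * B ^ Suc i"])
      (auto intro!: sum_nonneg)
  finally show ?thesis .
qed

text \<open>A union bound over walks: at most \<Delta>^(2 i) walks, each contributing at most (B
  \<theta>)^(i + 1), give a series dominated by the powers (1/2)^(i + 1), whose sum is at most
  1.\<close>

lemma expected_component_le:
  assumes "v \<in> V" "B \<ge> 0" "\<theta> \<ge> 0" "\<theta> \<le> 1" "\<Delta> \<ge> 1" "real \<Delta> ^ 2 * (B * \<theta>) \<le> 1 / 2"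
  shows "(\<Sum>S\<in>Pow V. bern \<theta> S * (of_bool (v \<in> S) * B ^ card (component S v))) \<le> 1"
proof -
  have "(\<Sum>S\<in>Pow V. bern \<theta> S * (of_bool (v \<in> S) * B ^ card (component S v)))
    \<le> (\<Sum>S\<in>Pow V. bern \<theta> S * (\<Sum>i<card V. \<Sum>w\<in>walks (2 * i) v.
        of_bool (card (set w) = Suc i \<and> set w \<subseteq> S) * B ^ Suc i))"
  proof (intro sum_mono mult_left_mono bern_nonneg assms)
    fix S assume S: "S \<in> Pow V"
    show "of_bool (v \<in> S) * B ^ card (component S v) \<le> (\<Sum>i<card V. \<Sum>w\<in>walks (2 * i) v.
        of_bool (card (set w) = Suc i \<and> set w \<subseteq> S) * B ^ Suc i)"
    proof (cases "v \<in> S")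
      case True
      then show ?thesis using power_component_le[of S v B] S assms by simp
    next
      case False
      then show ?thesis using assms(2) by (auto intro!: sum_nonneg)
    qed
  qed
  also have "\<dots> = (\<Sum>i<card V. \<Sum>w\<in>walks (2 * i) v. of_bool (card (set w) = Suc i) * B ^ Suc i *
      (\<Sum>S\<in>Pow V. bern \<theta> S * of_bool (set w \<subseteq> S)))"
    unfolding sum_distrib_left
    by (subst sum.swap, intro sum.cong refl, subst sum.swap) (auto intro!: sum.cong simp: of_bool_conj)
  also have "\<dots> = (\<Sum>i<card V. \<Sum>w\<in>walks (2 * i) v. of_bool (card (set w) = Suc i) * B ^ Suc i * \<theta> ^ card (set w))"
    using walk_subset[OF assms(1)] by (intro sum.cong refl) (simp add: bern_superset)
  also have "\<dots> \<le> (\<Sum>i<card V. \<Sum>w\<in>walks (2 * i) v. (B * \<theta>) ^ Suc i)"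
    using assms by (intro sum_mono) (auto simp: power_mult_distrib)
  also have "\<dots> \<le> (\<Sum>i<card V. (1 / 2) ^ Suc i)"
  proof (intro sum_mono)
    fix i
    have "(\<Sum>w\<in>walks (2 * i) v. (B * \<theta>) ^ Suc i) = real (card (walks (2 * i) v)) * (B * \<theta>) ^ Suc i" by simp
    also have "\<dots> \<le> real (\<Delta> ^ (2 * i)) * (B * \<theta>) ^ Suc i"
      using card_walks[OF assms(1), of "2 * i"] assms by (intro mult_right_mono) (auto simp del: of_nat_power)
    \<comment> \<open>A spare factor \<Delta>^2 turns the term into a full power of the quantity
      assumed to be at most 1/2.\<close>
    also have "\<dots> \<le> real (\<Delta> ^ (2 * Suc i)) * (B * \<theta>) ^ Suc i"
      using assms(2,3,5) by (intro mult_right_mono of_nat_mono power_increasing) auto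
    also have "\<dots> = (real \<Delta> ^ 2 * (B * \<theta>)) ^ Suc i"
      by (simp only: power_mult_distrib power_mult of_nat_power)
    also have "\<dots> \<le> (1 / 2) ^ Suc i"
      using assms by (intro power_mono) auto
    finally show "(\<Sum>w\<in>walks (2 * i) v. (B * \<theta>) ^ Suc i) \<le> (1 / 2) ^ Suc i" .
  qed
  also have "(\<Sum>i<n. (1 / 2) ^ Suc i) = 1 - (1 / 2 :: real) ^ n" for n
    by (induction n) auto
  finally show ?thesis by (simp add: order_trans)
qed

text \<open>The loss \<theta>^(-H) at the largest \<theta> with \<Delta>^2 (2 + 2 M) \<theta> \<le>
  1/2, the condition of the component bound.\<close>

definition gap_const :: real where
  "gap_const = (1 / (2 * (2 + 2 * M) * real \<Delta> ^ 2)) powr - H"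

text \<open>The full variance is passed to a random free set, from there to its components and then
  to single sites. Each site receives the expected factor (2 + 2 M)^(component size), restricted to
  the event that the site is free, which is at most 1.\<close>

lemma poincare:
  assumes "\<Delta> \<ge> 1"
  shows "wvar (Pow V) W f \<le> gap_const * (\<Sum>v\<in>V. en {v} f)"
proof -
  let ?B = "2 + 2 * M"
  define \<theta> where "\<theta> = 1 / (2 * ?B * real \<Delta> ^ 2)"
  have B: "?B \<ge> 2" using M_pos by simp
  have D: "real \<Delta> ^ 2 \<ge> 1" using assms by (simp add: one_le_power)
  have "1 \<le> 2 * ?B * real \<Delta> ^ 2" using mult_mono[of 1 "2 * ?B" 1 "real \<Delta> ^ 2"] B D by simp
  then have \<theta>: "\<theta> > 0" "\<theta> \<le> 1" unfolding \<theta>_def using B D by (simp_all add: field_simps)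
  have half: "real \<Delta> ^ 2 * (?B * \<theta>) \<le> 1 / 2" unfolding \<theta>_def using B D assms by (simp add: field_simps)
  have "mean_en f \<theta> \<le> (\<Sum>S\<in>Pow V. bern \<theta> S * (\<Sum>v\<in>S. ?B ^ card (component S v) * en {v} f))"
    unfolding mean_en_def using \<theta> by (intro sum_mono mult_left_mono en_components bern_nonneg) auto
  also have "\<dots> = (\<Sum>S\<in>Pow V. bern \<theta> S * (\<Sum>v\<in>V. of_bool (v \<in> S) * ?B ^ card (component S v) * en {v} f))"
  proof -
    have "(\<Sum>v\<in>S. ?B ^ card (component S v) * en {v} f) =
        (\<Sum>v\<in>V. of_bool (v \<in> S) * ?B ^ card (component S v) * en {v} f)" if "S \<in> Pow V" for S
      using finite_V that by (intro sum.mono_neutral_cong_left) auto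
    then show ?thesis by (intro sum.cong refl) (simp only:)
  qed
  also have "\<dots> = (\<Sum>v\<in>V. en {v} f * (\<Sum>S\<in>Pow V. bern \<theta> S * (of_bool (v \<in> S) * ?B ^ card (component S v))))"
    unfolding sum_distrib_left by (subst sum.swap) (simp add: mult_ac)
  also have "\<dots> \<le> (\<Sum>v\<in>V. en {v} f * 1)"
    using B \<theta> half assms
    by (intro sum_mono mult_left_mono expected_component_le en_nonneg) auto
  finally have "mean_en f \<theta> \<le> (\<Sum>v\<in>V. en {v} f)" by simp
  then have "\<theta> powr - H * mean_en f \<theta> \<le> \<theta> powr - H * (\<Sum>v\<in>V. en {v} f)"
    by (intro mult_left_mono) auto
  then show ?thesis using mean_en_ge[OF \<theta>, of f] unfolding en_V gap_const_def \<theta>_def by linarith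
qed

end

section \<open>Convergence of the dynamics\<close>

context energy
begin

text \<open>The conditional expectation of f given the spins off v. Where both weights vanish,
  division by zero makes it 0, so constants are preserved only on the support.\<close>

definition update :: "'a \<Rightarrow> ('a set \<Rightarrow> real) \<Rightarrow> 'a set \<Rightarrow> real" where
  "update v f A = (W (A - {v}) * f (A - {v}) + W (insert v A) * f (insert v A))
    / (W (A - {v}) + W (insert v A))"

definition glauber_op :: "('a set \<Rightarrow> real) \<Rightarrow> 'a set \<Rightarrow> real" where
  "glauber_op f A = (\<Sum>v\<in>V. update v f A) / card V"

definition sq_norm :: "('a set \<Rightarrow> real) \<Rightarrow> real" where
  "sq_norm f = (\<Sum>A\<in>Pow V. W A * (f A)\<^sup>2)"

definition total :: "('a set \<Rightarrow> real) \<Rightarrow> real" where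
  "total f = (\<Sum>A\<in>Pow V. W A * f A)"

lemma sum_Pow_vertex:
  assumes "v \<in> V"
  shows "(\<Sum>A\<in>Pow V. h A) = (\<Sum>C\<in>Pow (V - {v}). h C + h (insert v C))"
  using sum_Pow_insert[of "V - {v}" v h] finite_V assms by (simp add: insert_absorb sum.distrib)

lemma update_eq:
  assumes "C \<in> Pow (V - {v})"
  shows "update v f C = (W C * f C + W (insert v C) * f (insert v C)) / (W C + W (insert v C))"
    and "update v f (insert v C) = update v f C"
proof -
  have "C - {v} = C" "insert v C - {v} = C" using assms by auto
  then show "update v f C = (W C * f C + W (insert v C) * f (insert v C)) / (W C + W (insert v C))"
    and "update v f (insert v C) = update v f C"
    by (simp_all add: update_def)
qed

lemma total_update:
  assumes "v \<in> V"
  shows "total (update v f) = total f"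
  unfolding total_def sum_Pow_vertex[OF assms]
proof (intro sum.cong refl)
  fix C assume C: "C \<in> Pow (V - {v})"
  have nn: "W C \<ge> 0" "W (insert v C) \<ge> 0" by (simp_all add: W_nonneg)
  have "W C * update v f C + W (insert v C) * update v f (insert v C)
    = (W C + W (insert v C)) * update v f C"
    by (simp add: update_eq(2)[OF C] distrib_right)
  also have "\<dots> = W C * f C + W (insert v C) * f (insert v C)"
    using nn unfolding update_eq(1)[OF C] by (cases "W C + W (insert v C) = 0") (auto simp: add_nonneg_eq_0_iff)
  finally show "W C * update v f C + W (insert v C) * update v f (insert v C)
    = W C * f C + W (insert v C) * f (insert v C)" .
qed

text \<open>\<open>update v\<close> is an orthogonal projection in the weighted inner product, and
  the local variance at v is what it removes.\<close>

lemma sq_norm_update: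
  assumes "v \<in> V"
  shows "sq_norm (update v f) = sq_norm f - en {v} f"
proof -
  have X: "Pow {v} = {{}, {v}}" by auto
  have "en {v} f = (\<Sum>C\<in>Pow (V - {v}). W C * (f C)\<^sup>2 + W (insert v C) * (f (insert v C))\<^sup>2
      - (W C * f C + W (insert v C) * f (insert v C))\<^sup>2 / (W C + W (insert v C)))"
    unfolding en_def wvar_def X by (intro sum.cong refl) simp
  moreover have "sq_norm (update v f) = (\<Sum>C\<in>Pow (V - {v}).
      (W C * f C + W (insert v C) * f (insert v C))\<^sup>2 / (W C + W (insert v C)))"
    unfolding sq_norm_def sum_Pow_vertex[OF assms]
  proof (intro sum.cong refl)
    fix C assume C: "C \<in> Pow (V - {v})"
    have "W C * (update v f C)\<^sup>2 + W (insert v C) * (update v f (insert v C))\<^sup>2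
      = (W C + W (insert v C)) * (update v f C)\<^sup>2"
      by (simp add: update_eq(2)[OF C] distrib_right)
    then show "W C * (update v f C)\<^sup>2 + W (insert v C) * (update v f (insert v C))\<^sup>2
      = (W C * f C + W (insert v C) * f (insert v C))\<^sup>2 / (W C + W (insert v C))"
      unfolding update_eq(1)[OF C] by (simp add: power_divide power2_eq_square)
  qed
  ultimately show ?thesis
    unfolding sq_norm_def[of f] sum_Pow_vertex[OF assms] by (simp add: sum_subtractf)
qed

lemma card_V_pos: "V \<noteq> {} \<Longrightarrow> card V > 0"
  using finite_V by (simp add: card_gt_0_iff)

lemma total_glauber_op:
  assumes "V \<noteq> {}"
  shows "total (glauber_op f) = total f"
proof -
  have "total (glauber_op f) = (\<Sum>v\<in>V. total (update v f)) / card V"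
    unfolding total_def glauber_op_def
    by (subst sum.swap) (simp add: sum_distrib_left sum_divide_distrib)
  then show ?thesis using card_V_pos[OF assms] by (simp add: total_update)
qed

text \<open>The square of the average over v is at most the average of the squares; each single
  update loses its own local variance.\<close>

lemma sq_norm_glauber_op:
  assumes "V \<noteq> {}"
  shows "sq_norm (glauber_op f) \<le> sq_norm f - (\<Sum>v\<in>V. en {v} f) / card V"
proof -
  have n: "card V > 0" using card_V_pos[OF assms] .
  have "(glauber_op f A)\<^sup>2 \<le> (\<Sum>v\<in>V. (update v f A)\<^sup>2) / card V" for A
  proof -
    have "(\<Sum>v\<in>V. update v f A)\<^sup>2 \<le> (\<Sum>v\<in>V. (update v f A)\<^sup>2) * card V"
      by (rule sum_squared_le_sum_of_squares)
    then have "(\<Sum>v\<in>V. update v f A)\<^sup>2 / (real (card V))\<^sup>2 \<le> ((\<Sum>v\<in>V. (update v f A)\<^sup>2) * card V) / (real (card V))\<^sup>2"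
      by (intro divide_right_mono) auto
    then show ?thesis using n by (simp add: glauber_op_def power_divide power2_eq_square)
  qed
  then have "sq_norm (glauber_op f) \<le> (\<Sum>A\<in>Pow V. W A * ((\<Sum>v\<in>V. (update v f A)\<^sup>2) / card V))"
    unfolding sq_norm_def by (intro sum_mono mult_left_mono W_nonneg)
  also have "\<dots> = (\<Sum>v\<in>V. sq_norm (update v f)) / card V"
    unfolding sq_norm_def by (subst sum.swap) (simp add: sum_distrib_left sum_divide_distrib)
  also have "\<dots> = (\<Sum>v\<in>V. sq_norm f - en {v} f) / card V"
    by (simp add: sq_norm_update)
  also have "\<dots> = sq_norm f - (\<Sum>v\<in>V. en {v} f) / card V"
    using n by (simp add: sum_subtractf diff_divide_distrib)
  finally show ?thesis .
qed

lemma gap_const_ge_1: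
  assumes "\<Delta> \<ge> 1"
  shows "gap_const \<ge> 1"
proof -
  have "real \<Delta> ^ 2 \<ge> 1" using assms by (simp add: one_le_power)
  then have "1 \<le> 2 * (2 + 2 * M) * real \<Delta> ^ 2"
    using mult_mono[of 1 "2 * (2 + 2 * M)" 1 "real \<Delta> ^ 2"] M_pos by simp
  then have "(1 / (2 * (2 + 2 * M) * real \<Delta> ^ 2)) powr - H = (2 * (2 + 2 * M) * real \<Delta> ^ 2) powr H"
    by (simp add: powr_minus powr_divide)
  then show ?thesis unfolding gap_const_def
    using ge_one_powr_ge_zero[OF \<open>1 \<le> 2 * (2 + 2 * M) * real \<Delta> ^ 2\<close>, of H] H_pos by simp
qed

text \<open>For mean 0 the squared norm is the variance, so \<open>poincare\<close> makes one step
  remove a fixed fraction of it; \<open>total_glauber_op\<close> keeps the mean at 0.\<close>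

lemma sq_norm_power:
  assumes "V \<noteq> {}" "\<Delta> \<ge> 1" "total f = 0"
  shows "sq_norm ((glauber_op ^^ t) f) \<le> (1 - 1 / (gap_const * card V)) ^ t * sq_norm f"
proof -
  let ?\<rho> = "1 - 1 / (gap_const * card V)"
  have n: "card V \<ge> 1" using card_V_pos[OF assms(1)] by simp
  have g: "gap_const \<ge> 1" using gap_const_ge_1 assms by simp
  have gn: "gap_const * card V \<ge> 1" using mult_mono[of 1 gap_const 1 "real (card V)"] g n by simp
  have \<rho>: "?\<rho> \<ge> 0" using gn by simp
  have "total ((glauber_op ^^ t) f) = 0 \<and> sq_norm ((glauber_op ^^ t) f) \<le> ?\<rho> ^ t * sq_norm f"
  proof (induction t)
    case (Suc t)
    let ?f = "(glauber_op ^^ t) f"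
    have "sq_norm ?f = wvar (Pow V) W ?f"
      using Suc by (simp add: wvar_def sq_norm_def total_def)
    also have "\<dots> \<le> gap_const * (\<Sum>v\<in>V. en {v} ?f)" using poincare assms(2) by simp
    finally have "sq_norm ?f / (gap_const * card V) \<le> gap_const * (\<Sum>v\<in>V. en {v} ?f) / (gap_const * card V)"
      using g n by (intro divide_right_mono) auto
    also have "\<dots> = (\<Sum>v\<in>V. en {v} ?f) / card V" using g by simp
    finally have "sq_norm (glauber_op ?f) \<le> sq_norm ?f - sq_norm ?f / (gap_const * card V)"
      using sq_norm_glauber_op[OF assms(1), of ?f] by simp
    also have "\<dots> = ?\<rho> * sq_norm ?f" by (simp add: algebra_simps)
    also have "\<dots> \<le> ?\<rho> * (?\<rho> ^ t * sq_norm f)" using Suc \<rho> by (intro mult_left_mono) auto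
    finally show ?case using Suc total_glauber_op[OF assms(1)] by (simp add: mult.assoc)
  qed (simp add: assms(3))
  then show ?thesis by simp
qed

text \<open>From a configuration of positive weight, an update averages only over configurations of
  positive weight, so values off the support never enter.\<close>

lemma glauber_op_shift:
  assumes "V \<noteq> {}" "\<And>B. B \<in> Pow V \<Longrightarrow> W B \<noteq> 0 \<Longrightarrow> g B = f B - m" "A \<in> Pow V" "W A \<noteq> 0"
  shows "glauber_op g A = glauber_op f A - m"
proof -
  have "update v g A = update v f A - m" if v: "v \<in> V" for v
  proof -
    let ?s = "W (A - {v})" and ?t = "W (insert v A)"
    have "A = A - {v} \<or> A = insert v A" by blast
    then have "?s \<noteq> 0 \<or> ?t \<noteq> 0" using assms(4) by metis
    then have st: "?s + ?t \<noteq> 0" using W_nonneg by (metis add_nonneg_eq_0_iff)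
    have "?s * g (A - {v}) = ?s * (f (A - {v}) - m)"
      using assms(2)[of "A - {v}"] assms(3) by (cases "?s = 0") auto
    moreover have "?t * g (insert v A) = ?t * (f (insert v A) - m)"
      using assms(2)[of "insert v A"] assms(3) v by (cases "?t = 0") auto
    ultimately show ?thesis unfolding update_def using st by (simp add: field_simps)
  qed
  then have "glauber_op g A = (\<Sum>v\<in>V. update v f A - m) / card V"
    unfolding glauber_op_def by simp
  then show ?thesis using card_V_pos[OF assms(1)]
    by (simp add: glauber_op_def sum_subtractf diff_divide_distrib)
qed

lemma glauber_op_power_shift:
  assumes "V \<noteq> {}" "A \<in> Pow V" "W A \<noteq> 0"
  shows "(glauber_op ^^ t) (\<lambda>B. f B - m) A = (glauber_op ^^ t) f A - m"
  using assms(2,3)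
proof (induction t arbitrary: A)
  case (Suc t)
  then show ?case using glauber_op_shift[OF assms(1) Suc.IH] by simp
qed simp

lemma W_pos_mass: "(\<Sum>A\<in>Pow V. W A) > 0"
  using Z_pos[of V fld] finite_V fld_pos unfolding Z_def W_def by (simp add: less_imp_le)

lemma convergence:
  assumes "V \<noteq> {}" "\<Delta> \<ge> 1" "\<And>A. f A \<in> {0, 1}" "A \<in> Pow V" "W A \<noteq> 0"
    and t: "(1 - 1 / (gap_const * card V)) ^ t \<le> W A / (\<Sum>A\<in>Pow V. W A) / 4"
  shows "\<bar>(glauber_op ^^ t) f A - total f / (\<Sum>A\<in>Pow V. W A)\<bar> \<le> 1 / 4"
proof -
  let ?Z = "\<Sum>A\<in>Pow V. W A" and ?\<rho> = "1 - 1 / (gap_const * card V)"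
  define m where "m = total f / ?Z"
  define g where "g = (\<lambda>B. f B - m)"
  have Z: "?Z > 0" by (rule W_pos_mass)
  have WA: "W A > 0" using assms(5) W_nonneg[of A] by simp
  have "total g = total f - m * ?Z"
    by (simp add: total_def g_def sum_subtractf sum_distrib_left algebra_simps)
  then have tg: "total g = 0" using Z by (simp add: m_def)
  have "sq_norm g = wvar (Pow V) W f"
    using finite_V W_nonneg by (simp add: wvar_eq g_def m_def sq_norm_def total_def)
  \<comment> \<open>Any centre bounds the variance from above, and 1/2 is at distance 1/2 from both
    values of f.\<close>
  also have "\<dots> \<le> (\<Sum>A\<in>Pow V. W A * (f A - 1 / 2)\<^sup>2)"
    using finite_V W_nonneg by (intro wvar_le) auto
  also have "\<dots> = ?Z / 4"
  proof -
    have "(f A - 1 / 2)\<^sup>2 = 1 / 4" for A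
      using assms(3)[of A] by (auto simp: power2_eq_square)
    then show ?thesis by (simp only: sum_divide_distrib) simp
  qed
  finally have g4: "sq_norm g \<le> ?Z / 4" .
  \<comment> \<open>The value at the starting state is read off from a single term of the norm. This
    costs the factor W A / Z, which the decay demanded in \<open>t\<close> makes up for.\<close>
  have "W A * ((glauber_op ^^ t) g A)\<^sup>2 \<le> sq_norm ((glauber_op ^^ t) g)"
    unfolding sq_norm_def using finite_V assms(4) W_nonneg
    by (intro member_le_sum[of A "Pow V" "\<lambda>A. W A * ((glauber_op ^^ t) g A)\<^sup>2"]) auto
  also have "\<dots> \<le> ?\<rho> ^ t * sq_norm g" by (rule sq_norm_power[OF assms(1,2) tg])
  also have "\<dots> \<le> (W A / ?Z / 4) * (?Z / 4)"
  proof (intro mult_mono t g4)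
    show "0 \<le> sq_norm g" unfolding sq_norm_def using W_nonneg by (intro sum_nonneg) simp
  qed (use WA Z in simp)
  also have "\<dots> = W A * (1 / 4)\<^sup>2" using Z by (simp add: power2_eq_square)
  finally have "((glauber_op ^^ t) g A)\<^sup>2 \<le> (1 / 4)\<^sup>2" using WA by simp
  then have "\<bar>(glauber_op ^^ t) g A\<bar> \<le> 1 / 4" by (simp add: abs_le_square_iff[symmetric])
  then show ?thesis using glauber_op_power_shift[OF assms(1,4,5), of t f m] unfolding g_def m_def by simp
qed

section \<open>Lower bounds on the probabilities of states\<close>

lemma W_le: "A \<subseteq> V \<Longrightarrow> W A \<le> (1 + M) ^ card V"
proof -
  assume A: "A \<subseteq> V"
  have "W A \<le> (1 + M) ^ card A"
    using fin[OF A]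
  proof (induction A rule: finite_induct)
    case empty
    then show ?case by (simp add: W_def wt_empty)
  next
    case (insert v A)
    have "W (insert v A) \<le> M * W A" using W_insert_le insert by blast
    also have "\<dots> \<le> (1 + M) * (1 + M) ^ card A"
      using insert W_nonneg M_pos by (intro mult_mono) auto
    finally show ?case using insert by simp
  qed
  also have "\<dots> \<le> (1 + M) ^ card V"
    using A finite_V M_pos by (intro power_increasing card_mono) auto
  finally show ?thesis .
qed

lemma edges_in_le:
  assumes "A \<subseteq> V"
  shows "edges_in A \<le> card A * \<Delta>"
  using fin[OF assms] assms
proof (induction A rule: finite_induct)
  case empty
  then show ?case by (simp add: edges_in_empty)
next
  case (insert v A)
  have "card (N v \<inter> A) \<le> card (N v)" using finite_N by (intro card_mono) auto
  also have "\<dots> \<le> \<Delta>" using degree_le insert by simp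
  finally show ?case using insert by (simp add: edges_in_insert)
qed

text \<open>For \<kappa> = 0, a set of nonzero weight spans no edge and the edge factor is 0^0 = 1,
  which is why \<kappa> is then replaced by 1.\<close>

lemma W_ge:
  assumes "A \<subseteq> V" "W A \<noteq> 0" "0 < b" "b \<le> 1" "\<And>v. b \<le> fld v"
  shows "W A \<ge> (b * (if \<kappa> = 0 then 1 else \<kappa>) ^ \<Delta>) ^ card V"
proof -
  let ?k = "if \<kappa> = 0 then 1 else \<kappa>"
  have k: "0 < ?k" "?k \<le> 1" using \<kappa>_nonneg \<kappa>_less by auto
  have cA: "card A \<le> card V" using assms finite_V by (intro card_mono) auto
  have "b ^ card V \<le> b ^ card A" using assms cA by (intro power_decreasing) auto
  also have "\<dots> = (\<Prod>v\<in>A. b)" by simp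
  also have "\<dots> \<le> (\<Prod>v\<in>A. fld v)" using assms by (intro prod_mono) auto
  finally have 1: "b ^ card V \<le> (\<Prod>v\<in>A. fld v)" .
  have "edges_in A \<le> card V * \<Delta>" using edges_in_le[OF assms(1)] cA by (meson le_trans mult_le_mono1)
  then have "?k ^ (card V * \<Delta>) \<le> ?k ^ edges_in A" using k by (intro power_decreasing) auto
  also have "\<dots> = \<kappa> ^ edges_in A"
    using assms(2) unfolding W_def wt_def by (cases "\<kappa> = 0"; cases "edges_in A = 0") auto
  finally have 2: "?k ^ (card V * \<Delta>) \<le> \<kappa> ^ edges_in A" .
  have "(b * ?k ^ \<Delta>) ^ card V = b ^ card V * ?k ^ (card V * \<Delta>)"
    by (simp only: power_mult_distrib power_mult[symmetric] mult.commute[of \<Delta>])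
  also have "\<dots> \<le> (\<Prod>v\<in>A. fld v) * \<kappa> ^ edges_in A"
    using 1 2 k assms fld_pos by (intro mult_mono prod_nonneg) (auto simp: less_imp_le)
  finally show ?thesis by (simp add: W_def wt_def)
qed

text \<open>The smallest probability is only exponentially small in the number of vertices, so its
  logarithm costs a single power of n.\<close>

lemma mass_ge:
  assumes "A \<subseteq> V" "W A \<noteq> 0" "0 < b" "b \<le> 1" "\<And>v. b \<le> fld v"
  shows "W A / (\<Sum>A\<in>Pow V. W A) \<ge> (b * (if \<kappa> = 0 then 1 else \<kappa>) ^ \<Delta> / (2 * (1 + M))) ^ card V"
proof -
  let ?x = "b * (if \<kappa> = 0 then 1 else \<kappa>) ^ \<Delta>"
  have x: "?x \<ge> 0" using assms \<kappa>_nonneg by auto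
  have "(\<Sum>A\<in>Pow V. W A) \<le> (\<Sum>A\<in>Pow V. (1 + M) ^ card V)" using W_le by (intro sum_mono) auto
  also have "\<dots> = (2 * (1 + M)) ^ card V" using finite_V
    by (simp only: sum_constant card_Pow power_mult_distrib of_nat_power of_nat_numeral)
  finally have "(\<Sum>A\<in>Pow V. W A) \<le> (2 * (1 + M)) ^ card V" .
  then have "?x ^ card V / (2 * (1 + M)) ^ card V \<le> W A / (\<Sum>A\<in>Pow V. W A)"
    using W_ge[OF assms] W_pos_mass x W_nonneg[of A] by (intro frac_le zero_le_power) auto
  then show ?thesis by (simp only: power_divide)
qed

end

section \<open>Two-spin systems\<close>

locale two_spin = energy V E \<kappa> fld q \<Delta> M
  for V :: "'a set" and E \<kappa> fld q \<Delta> M +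
  fixes \<beta> \<gamma> lam :: real
  assumes \<beta>_nonneg: "0 \<le> \<beta>" and \<gamma>_pos: "0 < \<gamma>" and lam_pos: "0 < lam"
    and \<kappa>_eq: "\<kappa> = \<beta> * \<gamma>" and fld_eq: "\<And>v. fld v = lam / \<gamma> ^ card (N v)"
    and V_nonempty: "V \<noteq> {}"
begin

abbreviation "\<mu> \<equiv> gibbs V E \<beta> \<gamma> lam"
abbreviation "step \<equiv> glauber_step V E \<beta> \<gamma> lam"

definition spins :: "('a \<Rightarrow> nat) \<Rightarrow> 'a set" where
  "spins \<sigma> = {v \<in> V. \<sigma> v = 1}"

definition state :: "'a set \<Rightarrow> 'a \<Rightarrow> nat" where
  "state A = (\<lambda>v\<in>V. if v \<in> A then 1 else 0)"

lemma state_config: "state A \<in> configs V"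
  by (auto simp: state_def configs_def)

lemma spins_state: "A \<subseteq> V \<Longrightarrow> spins (state A) = A"
  by (auto simp: spins_def state_def)

lemma state_spins: "\<sigma> \<in> configs V \<Longrightarrow> state (spins \<sigma>) = \<sigma>"
  by (intro extensionalityI[of _ V]) (auto simp: spins_def state_def configs_def PiE_iff)

lemma spins_subset: "spins \<sigma> \<subseteq> V"
  by (auto simp: spins_def)

lemma sum_configs: "(\<Sum>\<sigma>\<in>configs V. h \<sigma>) = (\<Sum>A\<in>Pow V. h (state A))"
  by (rule sum.reindex_bij_witness[of _ state spins])
    (use spins_subset in \<open>auto simp: state_spins spins_state state_config\<close>)

text \<open>Inclusion-exclusion: the degrees over A count an edge inside A twice and an edge leaving
  A once.\<close>

lemma edges_avoiding:
  assumes "A \<subseteq> V"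
  shows "card {e \<in> E. e \<inter> A = {}} + (\<Sum>v\<in>A. card (N v)) = card E + edges_in A"
  using fin[OF assms]
proof (induction A rule: finite_induct)
  case empty
  then show ?case by (simp add: edges_in_empty)
next
  case (insert v A)
  let ?X = "{e \<in> E. e \<inter> insert v A = {}}" and ?Y = "(\<lambda>u. {v, u}) ` (N v - A)"
  have "{e \<in> E. e \<inter> A = {}} = ?X \<union> ?Y"
  proof (intro set_eqI iffI)
    fix e assume e: "e \<in> {e \<in> E. e \<inter> A = {}}"
    show "e \<in> ?X \<union> ?Y"
    proof (cases "v \<in> e")
      case True
      then have "e \<in> {e \<in> E. v \<in> e}" using e by simp
      then obtain u where "u \<in> N v" "e = {v, u}" unfolding edges_at by auto
      then show ?thesis using e by auto
    qed (use e in auto)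
  next
    fix e assume "e \<in> ?X \<union> ?Y"
    then show "e \<in> {e \<in> E. e \<inter> A = {}}" using insert by (auto simp: N_def)
  qed
  moreover have "?X \<inter> ?Y = {}" by auto
  moreover have "card ?Y = card (N v - A)"
    by (intro card_image inj_onI) (auto simp: doubleton_eq_iff)
  ultimately have "card {e \<in> E. e \<inter> A = {}} = card ?X + card (N v - A)"
    using finite_E finite_N by (simp add: card_Un_disjoint)
  moreover have "card (N v) = card (N v \<inter> A) + card (N v - A)"
    using finite_N card_Int_Diff[of "N v" A] by simp
  ultimately show ?case using insert by (simp add: edges_in_insert)
qed

text \<open>Edges with both spins 0 avoid the set A of ones, so the exponent of \<gamma> is card E
  minus the degrees over A plus the inner edges. The degrees go into the fields, and each inner edge
  joins a \<gamma> to its \<beta>.\<close>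

lemma weight_eq:
  assumes "A \<subseteq> V"
  shows "weight V E \<beta> \<gamma> lam (state A) = \<gamma> ^ card E * W A"
proof -
  have "{e \<in> E. \<forall>v\<in>e. state A v = 1} = {e \<in> E. e \<subseteq> A}"
  proof (intro Collect_cong conj_cong refl)
    fix e assume "e \<in> E"
    then have "e \<subseteq> V" by (rule edge_subset)
    then show "(\<forall>v\<in>e. state A v = 1) = (e \<subseteq> A)" by (auto simp: state_def subset_iff split: if_splits)
  qed
  then have m1: "mono_edges E 1 (state A) = edges_in A" by (simp only: mono_edges_def edges_in_def)
  have "{e \<in> E. \<forall>v\<in>e. state A v = 0} = {e \<in> E. e \<inter> A = {}}"
  proof (intro Collect_cong conj_cong refl)
    fix e assume "e \<in> E"
    then have "e \<subseteq> V" by (rule edge_subset)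
    then show "(\<forall>v\<in>e. state A v = 0) = (e \<inter> A = {})" by (auto simp: state_def subset_iff split: if_splits)
  qed
  then have m0: "mono_edges E 0 (state A) + (\<Sum>v\<in>A. card (N v)) = card E + edges_in A"
    using edges_avoiding[OF assms] by (simp only: mono_edges_def)
  have n1: "ones V (state A) = card A"
    using spins_state[OF assms] by (simp add: ones_def spins_def)
  have "(\<Prod>v\<in>A. fld v) = (\<Prod>v\<in>A. lam / \<gamma> ^ card (N v))"
    by (intro prod.cong refl fld_eq)
  then have "W A = (\<Prod>v\<in>A. lam / \<gamma> ^ card (N v)) * (\<beta> * \<gamma>) ^ edges_in A"
    unfolding W_def wt_def by (simp only: \<kappa>_eq)
  also have "(\<Prod>v\<in>A. lam / \<gamma> ^ card (N v)) = lam ^ card A / \<gamma> ^ (\<Sum>v\<in>A. card (N v))"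
    by (simp add: prod_dividef power_sum)
  finally have "\<gamma> ^ card E * W A = \<gamma> ^ (card E + edges_in A) * lam ^ card A * \<beta> ^ edges_in A / \<gamma> ^ (\<Sum>v\<in>A. card (N v))"
    by (simp add: power_add power_mult_distrib)
  also have "\<dots> = \<gamma> ^ mono_edges E 0 (state A) * lam ^ card A * \<beta> ^ edges_in A"
    unfolding m0[symmetric] using \<gamma>_pos by (simp add: power_add)
  finally show ?thesis unfolding weight_def m1 n1 by simp
qed

abbreviation "mass \<equiv> \<Sum>A\<in>Pow V. W A"

lemma pmf_state:
  assumes "A \<subseteq> V"
  shows "pmf \<mu> (state A) = W A / mass"
proof -
  have "partition_function V E \<beta> \<gamma> lam = \<gamma> ^ card E * mass"
    unfolding partition_function_def sum_configs sum_distrib_left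
    by (intro sum.cong refl weight_eq) auto
  then show ?thesis
    using pmf_gibbs[OF simple \<beta>_nonneg \<gamma>_pos lam_pos, of "state A"] assms \<gamma>_pos
    by (simp add: state_config weight_eq)
qed

lemma support_configs: "set_pmf \<mu> \<subseteq> configs V"
  using pmf_gibbs[OF simple \<beta>_nonneg \<gamma>_pos lam_pos] by (auto simp: set_pmf_iff split: if_splits)

lemma finite_support: "finite (set_pmf \<mu>)"
  using support_configs finite_configs[OF finite_V] finite_subset by blast

lemma state_support_iff: "A \<subseteq> V \<Longrightarrow> state A \<in> set_pmf \<mu> \<longleftrightarrow> W A \<noteq> 0"
  using pmf_state[of A] W_pos_mass by (simp add: set_pmf_iff)

lemma prob_gibbs: "measure_pmf.prob \<mu> X = total (\<lambda>A. indicator X (state A)) / mass"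
proof -
  have "measure_pmf.prob \<mu> X = measure_pmf.expectation \<mu> (indicator X)" by simp
  also have "\<dots> = (\<Sum>\<sigma>\<in>configs V. indicator X \<sigma> * pmf \<mu> \<sigma>)"
    using support_configs finite_configs[OF finite_V] by (intro integral_measure_pmf_real) auto
  also have "\<dots> = (\<Sum>A\<in>Pow V. W A * indicator X (state A) / mass)"
    unfolding sum_configs by (intro sum.cong refl) (simp add: pmf_state)
  finally show ?thesis by (simp add: total_def sum_divide_distrib)
qed

section \<open>The Glauber chain as an averaging operator\<close>

lemma conditional_event:
  assumes "\<sigma> \<in> set_pmf \<mu>" "v \<in> V"
  defines "A \<equiv> spins \<sigma>"
  shows "configs V \<inter> {\<tau>. \<forall>u\<in>V - {v}. \<tau> u = \<sigma> u} = {state (A - {v}), state (insert v A)}"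
proof -
  have \<sigma>: "\<sigma> \<in> configs V" using assms(1) support_configs by blast
  have A: "state A = \<sigma>" unfolding A_def by (rule state_spins[OF \<sigma>])
  have off: "state B u = \<sigma> u" if "u \<in> V - {v}" "B - {v} = A - {v}" for B u
    unfolding A[symmetric] using that by (auto simp: state_def)
  show ?thesis
  proof (intro set_eqI iffI)
    fix \<tau> assume \<tau>: "\<tau> \<in> configs V \<inter> {\<tau>. \<forall>u\<in>V - {v}. \<tau> u = \<sigma> u}"
    then have c: "state (spins \<tau>) = \<tau>" using state_spins by simp
    have "spins \<tau> - {v} = A - {v}"
      using \<tau> unfolding A_def spins_def by fastforce
    then have "spins \<tau> = A - {v} \<or> spins \<tau> = insert v A" by blast
    then show "\<tau> \<in> {state (A - {v}), state (insert v A)}" by (metis c insertCI)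
  next
    fix \<tau> assume "\<tau> \<in> {state (A - {v}), state (insert v A)}"
    then show "\<tau> \<in> configs V \<inter> {\<tau>. \<forall>u\<in>V - {v}. \<tau> u = \<sigma> u}"
      using state_config off[of _ "A - {v}"] off[of _ "insert v A"] by auto
  qed
qed

lemma replace_spin:
  assumes "\<sigma> \<in> configs V" "\<tau> \<in> configs V" "\<forall>u\<in>V - {v}. \<tau> u = \<sigma> u"
  shows "\<sigma>(v := \<tau> v) = \<tau>"
proof
  fix u
  show "(\<sigma>(v := \<tau> v)) u = \<tau> u"
  proof (cases "u \<in> V")
    case True
    then show ?thesis using assms(3) by simp
  next
    case False
    then have "\<sigma> u = \<tau> u"
      using PiE_arb[OF assms(1)[unfolded configs_def] False] PiE_arb[OF assms(2)[unfolded configs_def] False]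
      by simp
    then show ?thesis by simp
  qed
qed

lemma expectation_update:
  fixes f :: "('a \<Rightarrow> nat) \<Rightarrow> real"
  assumes \<sigma>: "\<sigma> \<in> set_pmf \<mu>" and v: "v \<in> V"
  shows "measure_pmf.expectation (map_pmf (\<lambda>\<tau>. \<sigma>(v := \<tau> v)) (cond_pmf \<mu> {\<tau>. \<forall>u\<in>V - {v}. \<tau> u = \<sigma> u})) f
    = update v (\<lambda>A. f (state A)) (spins \<sigma>)"
proof -
  let ?s = "{\<tau>. \<forall>u\<in>V - {v}. \<tau> u = \<sigma> u}"
  define A0 where "A0 = spins \<sigma> - {v}"
  define A1 where "A1 = insert v (spins \<sigma>)"
  let ?T = "{state A0, state A1}"
  have ev: "configs V \<inter> ?s = ?T" using conditional_event[OF assms] by (simp add: A0_def A1_def)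
  have A: "A0 \<subseteq> V" "A1 \<subseteq> V" "A0 \<noteq> A1" using v spins_subset[of \<sigma>] by (auto simp: A0_def A1_def)
  then have ne: "state A0 \<noteq> state A1" by (metis spins_state)
  have in_T: "\<tau> \<in> ?T" if "\<tau> \<in> set_pmf \<mu>" "\<tau> \<in> ?s" for \<tau> using ev support_configs that by blast
  have cond: "set_pmf \<mu> \<inter> ?s \<noteq> {}" using \<sigma> by blast
  have T_s: "\<tau> \<in> ?s" if "\<tau> \<in> ?T" for \<tau> using ev that by blast
  have "measure_pmf.prob \<mu> ?s = measure_pmf.expectation \<mu> (indicator ?s)" by simp
  also have "\<dots> = (\<Sum>\<tau>\<in>?T. indicator ?s \<tau> * pmf \<mu> \<tau>)"
    by (intro integral_measure_pmf_real) (use in_T in \<open>auto simp: indicator_def split: if_splits\<close>)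
  also have "\<dots> = (\<Sum>\<tau>\<in>?T. pmf \<mu> \<tau>)" using T_s by (intro sum.cong) auto
  also have "\<dots> = (W A0 + W A1) / mass" using ne A by (simp add: pmf_state add_divide_distrib)
  finally have prob: "measure_pmf.prob \<mu> ?s = (W A0 + W A1) / mass" .
  have "measure_pmf.expectation (map_pmf (\<lambda>\<tau>. \<sigma>(v := \<tau> v)) (cond_pmf \<mu> ?s)) f
    = measure_pmf.expectation (cond_pmf \<mu> ?s) (\<lambda>\<tau>. f (\<sigma>(v := \<tau> v)))" by simp
  also have "\<dots> = (\<Sum>\<tau>\<in>?T. f (\<sigma>(v := \<tau> v)) * pmf (cond_pmf \<mu> ?s) \<tau>)"
  proof (rule integral_measure_pmf_real)
    fix \<tau> assume "\<tau> \<in> set_pmf (cond_pmf \<mu> ?s)"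
    then have "\<tau> \<in> set_pmf \<mu> \<inter> ?s" by (simp only: set_cond_pmf[OF cond])
    then show "\<tau> \<in> ?T" using in_T by blast
  qed simp
  also have "\<dots> = (\<Sum>\<tau>\<in>?T. f \<tau> * (pmf \<mu> \<tau> / ((W A0 + W A1) / mass)))"
  proof (intro sum.cong refl)
    fix \<tau> assume \<tau>: "\<tau> \<in> ?T"
    have "\<sigma>(v := \<tau> v) = \<tau>"
      using T_s[OF \<tau>] \<tau> \<sigma> support_configs state_config by (intro replace_spin) auto
    then show "f (\<sigma>(v := \<tau> v)) * pmf (cond_pmf \<mu> ?s) \<tau> = f \<tau> * (pmf \<mu> \<tau> / ((W A0 + W A1) / mass))"
      unfolding pmf_cond[OF cond] prob using T_s[OF \<tau>] by simp
  qed
  also have "\<dots> = (W A0 * f (state A0) + W A1 * f (state A1)) / (W A0 + W A1)"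
  proof -
    define D where "D = (W A0 + W A1) / mass"
    have D: "y * x / (mass * D) = x * y / (W A0 + W A1)" for x y
      using W_pos_mass by (simp add: D_def mult.commute)
    show ?thesis unfolding D_def[symmetric] using ne A(1,2)
      by (simp add: pmf_state D add_divide_distrib)
  qed
  finally show ?thesis by (simp add: update_def A0_def A1_def)
qed

lemma set_step:
  assumes "\<sigma> \<in> set_pmf \<mu>"
  shows "set_pmf (step \<sigma>) \<subseteq> set_pmf \<mu>"
proof
  fix \<tau> assume "\<tau> \<in> set_pmf (step \<sigma>)"
  moreover have "set_pmf \<mu> \<inter> {\<tau>. \<forall>u\<in>V - {v}. \<tau> u = \<sigma> u} \<noteq> {}" for v using assms by blast
  ultimately obtain v \<tau>' where "\<tau> = \<sigma>(v := \<tau>' v)" "\<tau>' \<in> set_pmf \<mu>" "\<forall>u\<in>V - {v}. \<tau>' u = \<sigma> u"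
    unfolding glauber_step_def using V_nonempty finite_V by auto
  then have "\<sigma>(v := \<tau>' v) = \<tau>'"
    using assms support_configs by (intro replace_spin) blast+
  then show "\<tau> \<in> set_pmf \<mu>"
    using \<open>\<tau> = \<sigma>(v := \<tau>' v)\<close> \<open>\<tau>' \<in> set_pmf \<mu>\<close> by simp
qed

lemma expectation_step:
  fixes f :: "('a \<Rightarrow> nat) \<Rightarrow> real"
  assumes "\<sigma> \<in> set_pmf \<mu>"
  shows "measure_pmf.expectation (step \<sigma>) f = glauber_op (\<lambda>A. f (state A)) (spins \<sigma>)"
proof -
  have cond: "set_pmf \<mu> \<inter> {\<tau>. \<forall>u\<in>V - {v}. \<tau> u = \<sigma> u} \<noteq> {}" for v using assms by blast
  have "measure_pmf.expectation (step \<sigma>) f = (\<Sum>v\<in>V. pmf (pmf_of_set V) v *\<^sub>R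
     measure_pmf.expectation (map_pmf (\<lambda>\<tau>. \<sigma>(v := \<tau> v)) (cond_pmf \<mu> {\<tau>. \<forall>u\<in>V - {v}. \<tau> u = \<sigma> u})) f)"
    unfolding glauber_step_def using V_nonempty finite_V finite_support
    by (intro pmf_expectation_bind) (simp_all add: set_cond_pmf[OF cond])
  also have "\<dots> = (\<Sum>v\<in>V. update v (\<lambda>A. f (state A)) (spins \<sigma>) / card V)"
    using V_nonempty finite_V by (intro sum.cong refl) (simp only: expectation_update[OF assms], simp)
  finally show ?thesis by (simp add: glauber_op_def sum_divide_distrib)
qed

lemma glauber_dist_Suc:
  "glauber_dist V E \<beta> \<gamma> lam (Suc t) x = bind_pmf (glauber_dist V E \<beta> \<gamma> lam t x) step"
  by (simp add: glauber_dist_def)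

lemma set_glauber_dist:
  "x \<in> set_pmf \<mu> \<Longrightarrow> set_pmf (glauber_dist V E \<beta> \<gamma> lam t x) \<subseteq> set_pmf \<mu>"
proof (induction t)
  case 0
  then show ?case by (simp add: glauber_dist_def)
next
  case (Suc t)
  then show ?case using set_step unfolding glauber_dist_Suc by (auto simp: set_bind_pmf)
qed

lemma expectation_glauber_dist:
  fixes f :: "('a \<Rightarrow> nat) \<Rightarrow> real"
  assumes "x \<in> set_pmf \<mu>"
  shows "measure_pmf.expectation (glauber_dist V E \<beta> \<gamma> lam t x) f
    = (glauber_op ^^ t) (\<lambda>A. f (state A)) (spins x)"
proof (induction t arbitrary: f)
  case 0
  then show ?case using state_spins support_configs assms by (auto simp: glauber_dist_def)
next
  case (Suc t)
  let ?p = "glauber_dist V E \<beta> \<gamma> lam t x"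
  let ?g = "\<lambda>\<sigma>. glauber_op (\<lambda>A. f (state A)) (spins \<sigma>)"
  have p: "set_pmf ?p \<subseteq> set_pmf \<mu>" by (rule set_glauber_dist[OF assms])
  have fp: "finite (set_pmf ?p)" using p finite_support finite_subset by blast
  have "measure_pmf.expectation (bind_pmf ?p step) f
      = (\<Sum>\<sigma>\<in>set_pmf ?p. pmf ?p \<sigma> *\<^sub>R measure_pmf.expectation (step \<sigma>) f)"
    using fp finite_subset[OF set_step finite_support] p by (intro pmf_expectation_bind) auto
  also have "\<dots> = (\<Sum>\<sigma>\<in>set_pmf ?p. ?g \<sigma> * pmf ?p \<sigma>)"
    using p by (intro sum.cong refl) (auto simp: expectation_step)
  also have "\<dots> = measure_pmf.expectation ?p ?g"
    using fp by (intro integral_measure_pmf_real[symmetric]) auto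
  also have "\<dots> = (glauber_op ^^ t) (\<lambda>A. ?g (state A)) (spins x)" by (rule Suc.IH)
  also have "\<dots> = (glauber_op ^^ Suc t) (\<lambda>A. f (state A)) (spins x)"
  proof -
    \<comment> \<open>\<open>spins\<close> inverts \<open>state\<close> only on subsets of V, so the
      two functions are compared there alone; an update at a vertex of V never leaves these
      sets.\<close>
    have agree: "(glauber_op ^^ t) g A = (glauber_op ^^ t) h A" if "\<And>B. B \<subseteq> V \<Longrightarrow> g B = h B" "A \<subseteq> V" for g h A
      using that(2)
    proof (induction t arbitrary: A)
      case (Suc t)
      then have "update v ((glauber_op ^^ t) g) A = update v ((glauber_op ^^ t) h) A" if "v \<in> V" for v
        using that Suc.IH[of "A - {v}"] Suc.IH[of "insert v A"] Suc.prems by (simp add: update_def subset_insertI2 Diff_subset[THEN subset_trans])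
      then have "glauber_op ((glauber_op ^^ t) g) A = glauber_op ((glauber_op ^^ t) h) A"
        unfolding glauber_op_def[of "(glauber_op ^^ t) g"] glauber_op_def[of "(glauber_op ^^ t) h"]
        by simp
      then show ?case by simp
    qed (simp add: that(1))
    have "(glauber_op ^^ t) (\<lambda>A. ?g (state A)) (spins x) = (glauber_op ^^ t) (glauber_op (\<lambda>A. f (state A))) (spins x)"
      by (intro agree) (simp_all add: spins_state spins_subset)
    then show ?thesis by (simp only: funpow_Suc_right o_apply)
  qed
  finally show ?case unfolding glauber_dist_Suc .
qed

lemma tv_dist_le:
  assumes "x \<in> set_pmf \<mu>" "\<Delta> \<ge> 1"
    and t: "(1 - 1 / (gap_const * card V)) ^ t \<le> W (spins x) / mass / 4"
  shows "tv_dist (glauber_dist V E \<beta> \<gamma> lam t x) \<mu> \<le> 1 / 4"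
  unfolding tv_dist_def
proof (rule cSUP_least)
  fix X :: "('a \<Rightarrow> nat) set"
  have x: "state (spins x) = x" using assms(1) support_configs state_spins by auto
  then have "W (spins x) \<noteq> 0" using assms(1) state_support_iff[OF spins_subset, of x] by simp
  then have "\<bar>(glauber_op ^^ t) (\<lambda>A. indicator X (state A)) (spins x) - total (\<lambda>A. indicator X (state A)) / mass\<bar> \<le> 1 / 4"
    using t by (intro convergence V_nonempty assms(2)) (auto simp: indicator_def spins_subset)
  moreover have "measure_pmf.prob (glauber_dist V E \<beta> \<gamma> lam t x) X
      = (glauber_op ^^ t) (\<lambda>A. indicator X (state A)) (spins x)"
    using expectation_glauber_dist[OF assms(1), of t "indicator X"] by simp
  ultimately show "\<bar>measure_pmf.prob (glauber_dist V E \<beta> \<gamma> lam t x) X - measure_pmf.prob \<mu> X\<bar> \<le> 1 / 4"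
    by (simp add: prob_gibbs)
qed simp

lemma mixing_time_le:
  assumes "\<Delta> \<ge> 1" "0 < b" "b \<le> 1" "\<And>v. b \<le> fld v"
  defines "c \<equiv> b * (if \<kappa> = 0 then 1 else \<kappa>) ^ \<Delta> / (2 * (1 + M))"
  shows "ereal_of_enat (mixing_time V E \<beta> \<gamma> lam)
    \<le> ereal ((gap_const * (ln 4 - ln c) + 1) * real (card V) ^ 2)"
proof -
  let ?n = "real (card V)"
  have n: "?n \<ge> 1" using card_V_pos[OF V_nonempty] by simp
  have g: "gap_const \<ge> 1" by (rule gap_const_ge_1[OF assms(1)])
  have k: "0 < (if \<kappa> = 0 then 1 else \<kappa>)" "(if \<kappa> = 0 then 1 else \<kappa>) \<le> 1"
    using \<kappa>_nonneg \<kappa>_less by auto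
  have bk: "0 < b * (if \<kappa> = 0 then 1 else \<kappa>) ^ \<Delta>" "b * (if \<kappa> = 0 then 1 else \<kappa>) ^ \<Delta> \<le> 1"
    using k assms(2,3) by (auto intro!: mult_le_one power_le_one)
  have c: "0 < c" "c \<le> 1"
    unfolding c_def using bk M_pos by (simp_all add: divide_le_eq_1)
  then have lnc: "- ln c \<ge> 0" by simp
  have ln4: "ln (4::real) \<ge> 0" by simp
  \<comment> \<open>Chosen so that exp (- T / (gap_const * n)) \<le> c^n / 4. One factor n comes
    from selecting a vertex at random, the other from the logarithm of the smallest
    probability.\<close>
  define T where "T = nat \<lceil>gap_const * ?n * (ln 4 - ?n * ln c)\<rceil>"
  have pos: "gap_const * ?n * (ln 4 - ?n * ln c) \<ge> 0"
    using g n lnc ln4 mult_nonneg_nonneg[of ?n "- ln c"]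
    by (intro mult_nonneg_nonneg) linarith+
  have T: "gap_const * ?n * (ln 4 - ?n * ln c) \<le> T" "T \<le> gap_const * ?n * (ln 4 - ?n * ln c) + 1"
    unfolding T_def using pos by linarith+
  have gn: "gap_const * ?n \<ge> 1" using mult_mono[of 1 gap_const 1 ?n] g n by simp
  have "(1 - 1 / (gap_const * ?n)) ^ T \<le> exp (- (1 / (gap_const * ?n))) ^ T"
    using gn exp_ge_add_one_self[of "- (1 / (gap_const * ?n))"] by (intro power_mono) auto
  also have "\<dots> = exp (- (T / (gap_const * ?n)))"
    by (simp add: exp_of_nat_mult[symmetric])
  also have "\<dots> \<le> exp (?n * ln c - ln 4)"
  proof -
    have "ln 4 - ?n * ln c \<le> T / (gap_const * ?n)" using T(1) gn by (simp only: pos_le_divide_eq[of "gap_const * ?n"] mult.commute[of _ "gap_const * ?n"])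
    then show ?thesis by simp
  qed
  also have "\<dots> = c ^ card V / 4"
    using c by (simp add: exp_diff exp_of_nat_mult)
  finally have rate: "(1 - 1 / (gap_const * ?n)) ^ T \<le> c ^ card V / 4" .
  have "mixing_time V E \<beta> \<gamma> lam \<le> enat T"
    unfolding mixing_time_def
  proof (intro SUP_least INF_lower CollectI)
    fix x assume x: "x \<in> set_pmf \<mu>"
    then have "state (spins x) = x" using support_configs state_spins by auto
    then have "W (spins x) \<noteq> 0" using x state_support_iff[OF spins_subset, of x] by simp
    then have "c ^ card V \<le> W (spins x) / mass"
      unfolding c_def using mass_ge[OF spins_subset _ assms(2,3,4)] by blast
    then show "tv_dist (glauber_dist V E \<beta> \<gamma> lam T x) \<mu> \<le> 1 / 4"
      by (intro tv_dist_le x assms(1) order_trans[OF rate] divide_right_mono) auto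
  qed
  then have "ereal_of_enat (mixing_time V E \<beta> \<gamma> lam) \<le> ereal_of_enat (enat T)"
    by (simp only: ereal_of_enat_le_iff)
  also have "\<dots> = ereal T" by simp
  also have "\<dots> \<le> ereal ((gap_const * (ln 4 - ln c) + 1) * ?n ^ 2)"
  proof -
    have "ln 4 - ?n * ln c \<le> ?n * (ln 4 - ln c)"
      using mult_right_mono[OF n ln4] by (simp add: algebra_simps)
    then have "gap_const * ?n * (ln 4 - ?n * ln c) \<le> gap_const * ?n * (?n * (ln 4 - ln c))"
      using g n by (intro mult_left_mono) auto
    moreover have "1 \<le> ?n ^ 2" using n by (simp add: one_le_power)
    ultimately have "T \<le> gap_const * ?n * (?n * (ln 4 - ln c)) + ?n ^ 2" using T(2) by linarith
    then show ?thesis by (simp add: algebra_simps power2_eq_square)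
  qed
  finally show ?thesis .
qed

end

section \<open>From the uniqueness condition to the uniform bound\<close>

text \<open>Substitute R = \<gamma> c: the power of the fraction releases \<gamma>^(-m), and
  dividing the equation by \<gamma> gives one more, whence the exponent Suc m. Rescaling preserves
  logarithmic derivatives, and at a fixed point the derivative equals the logarithmic one, here - m
  \<open>sens\<close>.\<close>

lemma uniqueness_fixpoint:
  fixes \<beta> \<gamma> lam \<delta> :: real
  assumes "0 \<le> \<beta>" "\<gamma> > 0" "\<beta> * \<gamma> < 1" "lam > 0" "up_to_unique \<Delta> \<delta> \<beta> \<gamma> lam" "1 \<le> m" "m < \<Delta>"
  obtains c where "c > 0" "lam / \<gamma> ^ Suc m * ((1 + \<beta> * \<gamma> * c) / (1 + c)) ^ m = c"
    "m * sens (\<beta> * \<gamma>) c < 1 - \<delta>"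
proof -
  define R where "R = tree_fixpoint \<beta> \<gamma> lam m"
  have R: "R > 0" "tree_rec \<beta> \<gamma> lam m R = R"
    using theI'[OF tree_fixpoint_ex1[OF assms(1-4), of m]] by (auto simp: R_def tree_fixpoint_def)
  define c where "c = R / \<gamma>"
  have Rc: "R = \<gamma> * c" and c: "c > 0" using R assms by (auto simp: c_def)
  have p: "R + \<gamma> > 0" "\<beta> * R + 1 > 0" using R assms by (auto intro!: add_nonneg_pos)
  have pc: "1 + c > 0" "1 + \<beta> * \<gamma> * c > 0" using c assms by (auto intro!: add_pos_nonneg)
  have frac: "(\<beta> * R + 1) / (R + \<gamma>) = ((1 + \<beta> * \<gamma> * c) / (1 + c)) / \<gamma>"
    unfolding Rc using assms pc by (simp add: field_simps)
  have "lam / \<gamma> ^ Suc m * ((1 + \<beta> * \<gamma> * c) / (1 + c)) ^ m = lam * ((\<beta> * R + 1) / (R + \<gamma>)) ^ m / \<gamma>"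
    unfolding frac by (simp add: power_divide power_mult_distrib)
  also have "\<dots> = c" using R(2) by (simp add: tree_rec_def c_def)
  finally have fixpoint: "lam / \<gamma> ^ Suc m * ((1 + \<beta> * \<gamma> * c) / (1 + c)) ^ m = c" .
  have g: "((\<lambda>R. (\<beta> * R + 1) / (R + \<gamma>)) has_real_derivative
      (\<beta> * (R + \<gamma>) - (\<beta> * R + 1)) / ((R + \<gamma>) * (R + \<gamma>))) (at R)"
    using p by (auto intro!: derivative_eq_intros)
  obtain j where j: "m = Suc j" using assms(6) by (cases m) auto
  have "(tree_rec \<beta> \<gamma> lam m has_real_derivative
      lam * (m * ((\<beta> * (R + \<gamma>) - (\<beta> * R + 1)) / ((R + \<gamma>) * (R + \<gamma>)) * ((\<beta> * R + 1) / (R + \<gamma>)) ^ j))) (at R)"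
    using DERIV_cmult[OF DERIV_power[OF g, of m], of lam] j
    unfolding tree_rec_def[abs_def] by (simp add: mult_ac)
  moreover have "lam * (m * ((\<beta> * (R + \<gamma>) - (\<beta> * R + 1)) / ((R + \<gamma>) * (R + \<gamma>)) * ((\<beta> * R + 1) / (R + \<gamma>)) ^ j))
    = - (m * sens (\<beta> * \<gamma>) c)"
  proof -
    have "lam * ((\<beta> * R + 1) / (R + \<gamma>)) ^ j = R * (R + \<gamma>) / (\<beta> * R + 1)"
    proof -
      define z where "z = (\<beta> * R + 1) / (R + \<gamma>)"
      have "z > 0" using p by (simp add: z_def)
      moreover have "lam * z ^ j * z = R" using R(2) by (simp add: tree_rec_def j z_def mult_ac)
      ultimately have "lam * z ^ j = R / z" by (simp add: nonzero_eq_divide_eq)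
      then show ?thesis by (simp add: z_def)
    qed
    moreover have "lam * (m * (X * Y)) = m * X * (lam * Y)" for X Y :: real by (simp add: mult_ac)
    ultimately have "lam * (m * ((\<beta> * (R + \<gamma>) - (\<beta> * R + 1)) / ((R + \<gamma>) * (R + \<gamma>)) * ((\<beta> * R + 1) / (R + \<gamma>)) ^ j))
      = m * ((\<beta> * (R + \<gamma>) - (\<beta> * R + 1)) / ((R + \<gamma>) * (R + \<gamma>))) * (R * (R + \<gamma>) / (\<beta> * R + 1))"
      by (simp only:)
    also have "\<dots> = - (m * ((1 - \<beta> * \<gamma>) * R / ((\<beta> * R + 1) * (R + \<gamma>))))"
    proof -
      have "(\<beta> * (R + \<gamma>) - (\<beta> * R + 1)) / ((R + \<gamma>) * (R + \<gamma>)) * (R * (R + \<gamma>) / (\<beta> * R + 1))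
        = - ((1 - \<beta> * \<gamma>) * R / ((\<beta> * R + 1) * (R + \<gamma>)))"
        using p by (simp add: divide_simps) (simp add: algebra_simps)
      then show ?thesis by (simp only: mult.assoc mult_minus_right)
    qed
    also have "(1 - \<beta> * \<gamma>) * R / ((\<beta> * R + 1) * (R + \<gamma>)) = sens (\<beta> * \<gamma>) c"
    proof -
      have "\<beta> * R + 1 = 1 + \<beta> * \<gamma> * c" "R + \<gamma> = \<gamma> * (1 + c)" by (simp_all add: Rc algebra_simps)
      moreover have "(1 - \<beta> * \<gamma>) * R = \<gamma> * ((1 - \<beta> * \<gamma>) * c)" by (simp add: Rc)
      ultimately show ?thesis unfolding sens_def using assms(2) by (simp only: mult.left_commute) simp
    qed
    finally show ?thesis .
  qed
  ultimately have "deriv (tree_rec \<beta> \<gamma> lam m) R = - (m * sens (\<beta> * \<gamma>) c)"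
    using DERIV_imp_deriv by simp
  moreover have "\<bar>deriv (tree_rec \<beta> \<gamma> lam m) R\<bar> < 1 - \<delta>"
    using assms(5-7) unfolding up_to_unique_def R_def by blast
  ultimately have "m * sens (\<beta> * \<gamma>) c < 1 - \<delta>" by linarith
  then show ?thesis using that c fixpoint by blast
qed

theorem theorem3:
  fixes \<Delta> :: nat and \<delta> \<beta> \<gamma> lam :: real
  assumes "\<Delta> \<ge> 3"
    and "0 < \<delta>" and "\<delta> < 1"
    and "0 \<le> \<beta>" and "\<beta> \<le> \<gamma>" and "\<gamma> > 0" and "\<beta> * \<gamma> < 1" and "lam > 0"
    and "up_to_unique \<Delta> \<delta> \<beta> \<gamma> lam"
  shows "\<exists>C::real. \<forall>n. \<forall>(V :: 'a set) E.
    simple_graph V E \<and> V \<noteq> {} \<and> card V = n \<and> max_degree V E = \<Delta> \<longrightarrow>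
      ereal_of_enat (mixing_time V E \<beta> \<gamma> lam) \<le> ereal (C * real n powr (2 + 72 / \<delta>))"
proof -
  define \<kappa> where "\<kappa> = \<beta> * \<gamma>"
  define q where "q = sqrt (1 - \<delta>)"
  \<comment> \<open>M and b enclose the fields lam / \<gamma>^k of all degrees k \<le> \<Delta>. The
    factor lam / (1 + lam) and the base 1 + \<gamma> keep b at most 1 as well.\<close>
  define M where "M = (\<Sum>k\<le>\<Delta>. lam / \<gamma> ^ k)"
  define b where "b = lam / (1 + lam) / (1 + \<gamma>) ^ \<Delta>"
  define c where "c = b * (if \<kappa> = 0 then 1 else \<kappa>) ^ \<Delta> / (2 * (1 + M))"
  \<comment> \<open>\<open>gap_const\<close> depends only on q, \<Delta> and M, so C is fixed before
    any graph is chosen.\<close>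
  define C where "C = energy.gap_const q \<Delta> M * (ln 4 - ln c) + 1"
  have \<kappa>: "0 \<le> \<kappa>" "\<kappa> < 1" using assms by (auto simp: \<kappa>_def)
  have b: "0 < b" "b \<le> 1"
  proof -
    have "lam / (1 + lam) \<le> 1" "1 \<le> (1 + \<gamma>) ^ \<Delta>" using assms by (auto intro: one_le_power)
    then have "lam / (1 + lam) \<le> (1 + \<gamma>) ^ \<Delta>" by linarith
    then show "b \<le> 1" unfolding b_def by (subst divide_le_eq_1_pos) (use assms in auto)
    show "0 < b" using assms by (simp add: b_def)
  qed
  have M_ge: "lam / \<gamma> ^ k \<le> M" if "k \<le> \<Delta>" for k
    unfolding M_def using that assms by (intro member_le_sum[of k "{..\<Delta>}" "\<lambda>k. lam / \<gamma> ^ k"]) auto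
  have b_le: "b \<le> lam / \<gamma> ^ k" if "k \<le> \<Delta>" for k
  proof -
    have "\<gamma> ^ k \<le> (1 + \<gamma>) ^ k" using assms by (intro power_mono) auto
    also have "\<dots> \<le> (1 + \<gamma>) ^ \<Delta>" using assms that by (intro power_increasing) auto
    finally have "lam / (1 + \<gamma>) ^ \<Delta> \<le> lam / \<gamma> ^ k" using assms by (intro divide_left_mono) auto
    moreover have "lam / (1 + lam) / (1 + \<gamma>) ^ \<Delta> \<le> lam / (1 + \<gamma>) ^ \<Delta>"
      using assms by (intro divide_right_mono) (auto simp: divide_le_eq)
    ultimately show ?thesis unfolding b_def by linarith
  qed
  have c: "0 < c" "c \<le> 1"
  proof -
    have "0 < M" using M_ge[of 0] assms by simp
    moreover have "0 < b * (if \<kappa> = 0 then 1 else \<kappa>) ^ \<Delta>" "b * (if \<kappa> = 0 then 1 else \<kappa>) ^ \<Delta> \<le> 1"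
      using b \<kappa> by (auto intro!: mult_le_one power_le_one)
    ultimately show "0 < c" "c \<le> 1" unfolding c_def by (simp_all add: divide_le_eq_1)
  qed
  have "ereal_of_enat (mixing_time V E \<beta> \<gamma> lam) \<le> ereal (C * real n powr (2 + 72 / \<delta>))"
    if asm: "simple_graph V E" "V \<noteq> {}" "card V = n" "max_degree V E = \<Delta>" for n and V :: "'a set" and E
  proof -
    interpret finite_graph V E using asm by unfold_locales
    have deg: "card (N v) \<le> \<Delta>" if "v \<in> V" for v
    proof -
      have "degree E v \<le> Max (degree E ` V)" using finite_V that by (intro Max_ge) auto
      then show ?thesis using asm(4) by (simp only: max_degree_def degree_eq)
    qed
    \<comment> \<open>The bounds on the fields are required at every v of the type; outside V the
      field is that of degree 0.\<close>
    have "N v = {}" if "v \<notin> V" for v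
      using edge_subset that by (fastforce simp: N_def)
    then have deg': "card (N v) \<le> \<Delta>" for v using deg[of v] by (cases "v \<in> V") auto
    interpret two_spin V E \<kappa> "\<lambda>v. lam / \<gamma> ^ card (N v)" q \<Delta> M \<beta> \<gamma> lam
    proof unfold_locales
      fix v a and J :: "'a set" and \<rho> :: "'a \<Rightarrow> real"
      assume v: "v \<in> V" and J: "finite J" "card J + a < card (N v)" and \<rho>: "\<forall>u\<in>J. \<rho> u \<ge> 0"
      define m where "m = card (N v) - 1"
      have m: "card (N v) = Suc m" "card J + a \<le> m" using J by (auto simp: m_def)
      show "sqrt (sens \<kappa> (lam / \<gamma> ^ card (N v) * \<kappa> ^ a * (\<Prod>u\<in>J. (1 + \<kappa> * \<rho> u) / (1 + \<rho> u)))) *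
        (\<Sum>u\<in>J. sqrt (sens \<kappa> (\<rho> u))) \<le> q"
      proof (cases "m = 0")
        \<comment> \<open>A vertex of degree 1 with its only neighbour pinned to 0 has no children,
          and the sum is empty.\<close>
        case True
        then have "J = {}" using J m by simp
        then show ?thesis using assms by (simp add: q_def)
      next
        case False
        then have "1 \<le> m" "m < \<Delta>" using m deg[OF v] by auto
        then obtain c where "c > 0" "lam / \<gamma> ^ Suc m * ((1 + \<kappa> * c) / (1 + c)) ^ m = c"
          "m * sens \<kappa> c < 1 - \<delta>"
          using uniqueness_fixpoint[OF assms(4,6,7,8,9)] unfolding \<kappa>_def by blast
        then show ?thesis unfolding m(1) q_def using assms \<kappa> J(1) m(2) \<rho>
          by (intro tree_contraction[of _ _ c m \<delta>]) auto
      qed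
    qed (use assms asm \<kappa> deg' M_ge in \<open>auto simp: q_def \<kappa>_def\<close>)
    have "ereal_of_enat (mixing_time V E \<beta> \<gamma> lam) \<le> ereal (C * real (card V) ^ 2)"
      unfolding C_def c_def using assms(1) b b_le[OF deg'] by (intro mixing_time_le) auto
    also have "\<dots> \<le> ereal (C * real n powr (2 + 72 / \<delta>))"
    proof -
      have n: "real n \<ge> 1" using card_V_pos[OF asm(2)] asm(3) by simp
      have "ln c \<le> 0" using c by simp
      then have "0 \<le> gap_const * (ln 4 - ln c)"
        using gap_const_ge_1 assms(1) ln_gt_zero[of "4 :: real"]
        by (intro mult_nonneg_nonneg) linarith+
      then have "0 \<le> C" by (simp add: C_def)
      moreover have "real n ^ 2 \<le> real n powr (2 + 72 / \<delta>)"
        using powr_mono[of 2 "2 + 72 / \<delta>" "real n"] n assms by simp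
      ultimately show ?thesis unfolding asm(3) by (simp add: mult_left_mono)
    qed
    finally show ?thesis .
  qed
  then show ?thesis by blast
qed

end
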